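(* Let $\lambda\colon G\times M\to M$ be a smooth action of the Lie group $G$ on the manifold $M$ which admits a slice $S$ through the point $x_0\in M$. Let $\mathfrak g$ and $\mathfrak g_{x_0}$ be the Lie algebras of $G$ and of the isotropy group $G_{x_0}$. Assume furthermore: (i) $\mathfrak g$ admits a $G_{x_0}$-invariant splitting $\mathfrak g=\mathfrak g_{x_0}\oplus\mathfrak t$, where $G_{x_0}$ acts on $\mathfrak g$ by the adjoint action; (ii) there exists a $G_{x_0}$-invariant splitting $TS=(\mathfrak g_{x_0})_M\oplus H$ of the tangent bundle of $S$. Let $U=G\cdot S$ be the open $G$-invariant neighborhood of the orbit through $x_0$. Then the tangent bundle $TU$ admits a $G$-invariant splitting $$T_uM = g\cdot H_s\oplus\left[(g\cdot\mathfrak t)_M(u)\oplus(\mathfrak g_{g\cdot x_0})_M(u)\right],$$ where $u\in U$ is given by $u=g\cdot s$ with $g\in G$, $s\in S$; here the first distribution on the right-hand side is transverse to the group orbits, and the other two form a decomposition of the group directions into directions transverse and tangent to the slice (translated by $g$, i.e. $g\cdot S$), respectively.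
   Context: Write $\lambda_g(x)=\lambda(g,x)=g\cdot x$. For $\xi\in\mathfrak g$, $\xi_M(x)=\frac{d}{dt}\big|_{t=0}\lambda(\exp(t\xi),x)$. For a linear subspace $V\subset\mathfrak g$, $(V)_M(x)=\{\xi_M(x):\xi\in V\}\subset T_xM$, and $\mathfrak g_M(x)=(\mathfrak g)_M(x)$ is the tangent space at $x$ to the orbit through $x$. $G_x=\{g\in G:g\cdot x=x\}$ is the isotropy group at $x$ and $\mathfrak g_x$ its Lie algebra. For $V\subset\mathfrak g$, $g\cdot V=\mathrm{Ad}_g V$; for a subspace $W\subset T_xM$, $g\cdot W=T_x\lambda_g(W)\subset T_{g\cdot x}M$. A slice at $x_0\in M$ of the smooth action is a submanifold $S$ of $M$ through $x_0$ such that: (a) $T_{x_0}M=\mathfrak g_M(x_0)\oplus T_{x_0}S$ and, for all $x\in S$, $T_xM=\mathfrak g_M(x)+T_xS$; (b) $S$ is $G_{x_0}$-invariant; (c) if $x\in S$, $g\in G$ and $\lambda(g,x)\in S$, then $g\in G_{x_0}$. In this case $G\cdot S$ is an open $G$-invariant neighborhood of the orbit $G\cdot x_0$. A $G_{x_0}$-invariant splitting $TS=(\mathfrak g_{x_0})_M\oplus H$ means an assignment to each $s\in S$ of a subspace $H_s\subset T_sS$ with $T_sS=(\mathfrak g_{x_0})_M(s)\oplus H_s$ and $T_s\lambda_h(H_s)=H_{h\cdot s}$ for all $h\in G_{x_0}$. A splitting of $TU$ into distributions is $G$-invariant if each $T\lambda_g$ maps each of the distributions at $u$ onto the corresponding one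 at $g\cdot u$. *)

theory Defs
  imports "HOL-Analysis.Analysis" "HOL-Algebra.Group_Action"
begin

section \<open>Smooth maps between normed spaces\<close>

text \<open>\<open>C\<^sup>k\<close> through iterated directional derivatives. This is the usual notion
  when \<open>S\<close> is open and the domain is finite dimensional, the only case in which it is used.\<close>

primrec Ck_on :: "nat \<Rightarrow> 'a set \<Rightarrow> ('a::real_normed_vector \<Rightarrow> 'b::real_normed_vector) \<Rightarrow> bool" where
  "Ck_on 0 S f \<longleftrightarrow> continuous_on S f"
| "Ck_on (Suc k) S f \<longleftrightarrow> (\<forall>x\<in>S. f differentiable (at x)) \<and>
      (\<forall>v. Ck_on k S (\<lambda>x. frechet_derivative f (at x) v))"

definition smooth_on :: "'a set \<Rightarrow> ('a::real_normed_vector \<Rightarrow> 'b::real_normed_vector) \<Rightarrow> bool" where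
  "smooth_on S f \<longleftrightarrow> (\<forall>k. Ck_on k S f)"

section \<open>Manifolds\<close>

text \<open>A manifold is a whole type with an atlas of charts, a chart being a pair of its domain
  and its coordinate map. The model space is a normed space with a finite spanning set rather
  than a \<open>euclidean_space\<close>, since the latter has dimension at least one and would exclude
  manifolds of dimension zero, in particular discrete Lie groups. A finite-dimensional model
  space may always be taken to be a (complete) inner product space.\<close>

type_synonym ('m, 'e) chart = "'m set \<times> ('m \<Rightarrow> 'e)"

definition is_chart :: "('m::topological_space, 'e::real_normed_vector) chart \<Rightarrow> bool" where
  "is_chart c \<longleftrightarrow> open (fst c) \<and> open (snd c ` fst c) \<and>
     (\<exists>\<psi>. homeomorphism (fst c) (snd c ` fst c) (snd c) \<psi>)"

definition chart_inv :: "('m, 'e) chart \<Rightarrow> 'e \<Rightarrow> 'm" where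
  "chart_inv c = inv_into (fst c) (snd c)"

definition compatible ::
    "('m, 'e::real_normed_vector) chart \<Rightarrow> ('m, 'e) chart \<Rightarrow> bool" where
  "compatible c d \<longleftrightarrow> smooth_on (snd c ` (fst c \<inter> fst d)) (snd d \<circ> chart_inv c) \<and>
     smooth_on (snd d ` (fst c \<inter> fst d)) (snd c \<circ> chart_inv d)"

definition smooth_atlas ::
    "('m::topological_space, 'e::real_normed_vector) chart set \<Rightarrow> bool" where
  "smooth_atlas A \<longleftrightarrow> (\<forall>c\<in>A. is_chart c) \<and> (\<Union>c\<in>A. fst c) = UNIV \<and>
     (\<forall>c\<in>A. \<forall>d\<in>A. compatible c d)"

text \<open>The Hausdorff property is part of the sort of the point type. Second countability
  is not required, so that arbitrary discrete groups are Lie groups.\<close>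

definition smooth_manifold ::
    "('m::t2_space, 'e::real_normed_vector) chart set \<Rightarrow> bool" where
  "smooth_manifold A \<longleftrightarrow> (\<exists>B::'e set. finite B \<and> span B = UNIV) \<and> smooth_atlas A"

definition real_atlas :: "(real, real) chart set" where
  "real_atlas = {(UNIV, \<lambda>t. t)}"

definition prod_atlas ::
    "('m, 'e) chart set \<Rightarrow> ('n, 'f) chart set \<Rightarrow> ('m \<times> 'n, 'e \<times> 'f) chart set" where
  "prod_atlas A B = {(fst c \<times> fst d, map_prod (snd c) (snd d)) | c d. c \<in> A \<and> d \<in> B}"

definition smooth_map ::
    "('m::topological_space, 'e::real_normed_vector) chart set \<Rightarrow>
     ('n::topological_space, 'f::real_normed_vector) chart set \<Rightarrow> ('m \<Rightarrow> 'n) \<Rightarrow> bool" where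
  "smooth_map A B f \<longleftrightarrow> continuous_on UNIV f \<and>
     (\<forall>c\<in>A. \<forall>d\<in>B. smooth_on (snd c ` (fst c \<inter> f -` fst d)) (snd d \<circ> f \<circ> chart_inv c))"

section \<open>Tangent spaces\<close>

text \<open>For each point a chart of the atlas around it is chosen once and for all, and a tangent
  vector at \<open>x\<close> is represented by its coordinates in the chart chosen at \<open>x\<close>. Thus
  \<open>T\<^sub>xM\<close> is the whole model space (\<open>UNIV\<close>), with its linear structure.\<close>

definition chart_at :: "('m, 'e) chart set \<Rightarrow> 'm \<Rightarrow> ('m, 'e) chart" where
  "chart_at A x = (SOME c. c \<in> A \<and> x \<in> fst c)"

definition tangent_map ::
    "('m, 'e::real_normed_vector) chart set \<Rightarrow> ('n, 'f::real_normed_vector) chart set \<Rightarrow>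
     ('m \<Rightarrow> 'n) \<Rightarrow> 'm \<Rightarrow> 'e \<Rightarrow> 'f" where
  "tangent_map A B f x =
     frechet_derivative (snd (chart_at B (f x)) \<circ> f \<circ> chart_inv (chart_at A x))
       (at (snd (chart_at A x) x))"

definition velocity ::
    "('m, 'e::real_normed_vector) chart set \<Rightarrow> (real \<Rightarrow> 'm) \<Rightarrow> real \<Rightarrow> 'e" where
  "velocity A \<gamma> t = vector_derivative (snd (chart_at A (\<gamma> t)) \<circ> \<gamma>) (at t)"

text \<open>Embedded submanifolds, all of whose slice charts have the same model subspace \<open>F\<close>
  (pure dimension). The slice charts may be taken from the maximal atlas.\<close>

definition submanifold ::
    "('m::topological_space, 'e::real_normed_vector) chart set \<Rightarrow> 'm set \<Rightarrow> bool" where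
  "submanifold A S \<longleftrightarrow> (\<exists>F. subspace F \<and>
     (\<forall>x\<in>S. \<exists>c. is_chart c \<and> (\<forall>d\<in>A. compatible c d) \<and> x \<in> fst c \<and>
        snd c ` (S \<inter> fst c) = snd c ` fst c \<inter> F))"

definition tangent_space ::
    "('m::topological_space, 'e::real_normed_vector) chart set \<Rightarrow> 'm set \<Rightarrow> 'm \<Rightarrow> 'e set" where
  "tangent_space A S x =
     {velocity A \<gamma> 0 | \<gamma>. smooth_map real_atlas A \<gamma> \<and> range \<gamma> \<subseteq> S \<and> \<gamma> 0 = x}"

text \<open>\<open>T = V \<oplus> W\<close> for linear subspaces.\<close>

definition direct_sum :: "'v::real_vector set \<Rightarrow> 'v set \<Rightarrow> 'v set \<Rightarrow> bool" where
  "direct_sum T V W \<longleftrightarrow> subspace V \<and> subspace W \<and> V \<inter> W = {0} \<and>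
     T = {v + w | v w. v \<in> V \<and> w \<in> W}"

section \<open>Lie groups\<close>

text \<open>The Lie algebra of \<open>G\<close> is, as a vector space, the tangent space at the identity,
  hence the model space of \<open>G\<close>.\<close>

definition lie_group ::
    "'g::t2_space monoid \<Rightarrow> ('g, 'f::real_normed_vector) chart set \<Rightarrow> bool" where
  "lie_group G AG \<longleftrightarrow> group G \<and> carrier G = UNIV \<and> smooth_manifold AG \<and>
     smooth_map (prod_atlas AG AG) AG (\<lambda>(g, h). g \<otimes>\<^bsub>G\<^esub> h) \<and>
     smooth_map AG AG (\<lambda>g. inv\<^bsub>G\<^esub> g)"

definition one_param_subgroup ::
    "'g::topological_space monoid \<Rightarrow> ('g, 'f::real_normed_vector) chart set \<Rightarrow>
     (real \<Rightarrow> 'g) \<Rightarrow> bool" where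
  "one_param_subgroup G AG \<gamma> \<longleftrightarrow> smooth_map real_atlas AG \<gamma> \<and>
     (\<forall>s t. \<gamma> (s + t) = \<gamma> s \<otimes>\<^bsub>G\<^esub> \<gamma> t)"

definition lie_exp ::
    "'g::topological_space monoid \<Rightarrow> ('g, 'f::real_normed_vector) chart set \<Rightarrow> 'f \<Rightarrow> 'g" where
  "lie_exp G AG \<xi> = (THE \<gamma>. one_param_subgroup G AG \<gamma> \<and> velocity AG \<gamma> 0 = \<xi>) 1"

definition Ad :: "'g monoid \<Rightarrow> ('g, 'f::real_normed_vector) chart set \<Rightarrow> 'g \<Rightarrow> 'f \<Rightarrow> 'f" where
  "Ad G AG g = tangent_map AG AG (\<lambda>h. g \<otimes>\<^bsub>G\<^esub> h \<otimes>\<^bsub>G\<^esub> inv\<^bsub>G\<^esub> g) \<one>\<^bsub>G\<^esub>"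

text \<open>The Lie algebra of a closed subgroup \<open>H\<close>.\<close>

definition lie_subalgebra ::
    "'g::topological_space monoid \<Rightarrow> ('g, 'f::real_normed_vector) chart set \<Rightarrow>
     'g set \<Rightarrow> 'f set" where
  "lie_subalgebra G AG H = {\<xi>. \<forall>t::real. lie_exp G AG (t *\<^sub>R \<xi>) \<in> H}"

section \<open>Smooth actions and slices\<close>

definition smooth_action ::
    "'g::t2_space monoid \<Rightarrow> ('g, 'f::real_normed_vector) chart set \<Rightarrow>
     ('m::t2_space, 'e::real_normed_vector) chart set \<Rightarrow> ('g \<Rightarrow> 'm \<Rightarrow> 'm) \<Rightarrow> bool" where
  "smooth_action G AG AM \<phi> \<longleftrightarrow> lie_group G AG \<and> smooth_manifold AM \<and>
     group_action G UNIV \<phi> \<and> smooth_map (prod_atlas AG AM) AM (\<lambda>(g, x). \<phi> g x)"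

definition generator ::
    "'g::topological_space monoid \<Rightarrow> ('g, 'f::real_normed_vector) chart set \<Rightarrow>
     ('m, 'e::real_normed_vector) chart set \<Rightarrow> ('g \<Rightarrow> 'm \<Rightarrow> 'm) \<Rightarrow> 'f \<Rightarrow> 'm \<Rightarrow> 'e" where
  "generator G AG AM \<phi> \<xi> x = velocity AM (\<lambda>t. \<phi> (lie_exp G AG (t *\<^sub>R \<xi>)) x) 0"

text \<open>\<open>(V)\<^sub>M(x)\<close>\<close>

definition generators ::
    "'g::topological_space monoid \<Rightarrow> ('g, 'f::real_normed_vector) chart set \<Rightarrow>
     ('m, 'e::real_normed_vector) chart set \<Rightarrow> ('g \<Rightarrow> 'm \<Rightarrow> 'm) \<Rightarrow> 'f set \<Rightarrow> 'm \<Rightarrow> 'e set" where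
  "generators G AG AM \<phi> V x = (\<lambda>\<xi>. generator G AG AM \<phi> \<xi> x) ` V"

definition isotropy_algebra ::
    "'g::topological_space monoid \<Rightarrow> ('g, 'f::real_normed_vector) chart set \<Rightarrow>
     ('g \<Rightarrow> 'm \<Rightarrow> 'm) \<Rightarrow> 'm \<Rightarrow> 'f set" where
  "isotropy_algebra G AG \<phi> x = lie_subalgebra G AG (stabilizer G \<phi> x)"

definition is_slice ::
    "'g::topological_space monoid \<Rightarrow> ('g, 'f::real_normed_vector) chart set \<Rightarrow>
     ('m::topological_space, 'e::real_normed_vector) chart set \<Rightarrow> ('g \<Rightarrow> 'm \<Rightarrow> 'm) \<Rightarrow>
     'm \<Rightarrow> 'm set \<Rightarrow> bool" where
  "is_slice G AG AM \<phi> x0 S \<longleftrightarrow>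
     submanifold AM S \<and> x0 \<in> S \<and>
     direct_sum UNIV (generators G AG AM \<phi> UNIV x0) (tangent_space AM S x0) \<and>
     (\<forall>x\<in>S. UNIV = {v + w | v w. v \<in> generators G AG AM \<phi> UNIV x \<and> w \<in> tangent_space AM S x}) \<and>
     (\<forall>h\<in>stabilizer G \<phi> x0. \<phi> h ` S \<subseteq> S) \<and>
     (\<forall>x\<in>S. \<forall>g\<in>carrier G. \<phi> g x \<in> S \<longrightarrow> g \<in> stabilizer G \<phi> x0)"

text \<open>A family \<open>D\<close> of subspaces over \<open>U\<close> is carried to itself by \<open>T\<lambda>\<^sub>g\<close> for \<open>g \<in> K\<close>.\<close>

definition invariant_family ::
    "('m, 'e::real_normed_vector) chart set \<Rightarrow> ('g \<Rightarrow> 'm \<Rightarrow> 'm) \<Rightarrow> 'g set \<Rightarrow> 'm set \<Rightarrow>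
     ('m \<Rightarrow> 'e set) \<Rightarrow> bool" where
  "invariant_family AM \<phi> K U D \<longleftrightarrow>
     (\<forall>g\<in>K. \<forall>u\<in>U. tangent_map AM AM (\<phi> g) u ` D u = D (\<phi> g u))"

end

theory Submission
  imports Defs
begin

text \<open>The map \<open>\<xi> \<mapsto> \<xi>\<^sub>M(x)\<close> is the differential at \<open>\<one>\<close> of \<open>g \<mapsto> g \<cdot> x\<close>, hence linear with kernel
  \<open>\<gg>\<^sub>x\<close>, and \<open>(Ad\<^sub>g \<xi>)\<^sub>M(g \<cdot> x) = T\<lambda>\<^sub>g \<xi>\<^sub>M(x)\<close>. For this \<open>exp\<close> must be defined on all of \<open>\<gg>\<close>; the
  one-parameter subgroups are obtained locally by Picard iteration and extended by
  \<open>\<gamma>(t) = \<gamma>(t/n)\<^sup>n\<close>. All three distributions are therefore translates of \<open>H\<^sub>s\<close>, \<open>(\<tt>)\<^sub>M(s)\<close> and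
  \<open>(\<gg>\<^bsub>x0\<^esub>)\<^sub>M(s)\<close>, and do not depend on how \<open>u = g \<cdot> s\<close> is written because \<open>g\<close> is unique up to
  \<open>G\<^bsub>x0\<^esub>\<close>. It remains to split \<open>T\<^sub>sM\<close> at points of the slice. There \<open>\<tt> \<times> T\<^sub>sS \<rightarrow> T\<^sub>sM\<close> is onto, and it is
  bijective for \<open>s = x0\<close>; since \<open>dim T\<^sub>sS\<close> is constant, it is bijective for every \<open>s\<close>. Finally, the
  differential of \<open>(g, s) \<mapsto> g \<cdot> s\<close> is onto at \<open>(\<one>, s)\<close>, so that \<open>G \<cdot> S\<close> is open.\<close>

section \<open>Calculus of \<open>C\<^sup>k\<close> maps\<close>

text \<open>Tangent vectors are coordinates in a chart picked separately at each point, so they need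
  not vary continuously along a curve. Identities between tangent maps, \<open>Ad\<close> and
  generators are therefore obtained by computing the velocity of one curve in two ways. The other
  recurring tool is that a curve with zero velocity everywhere is constant: it gives uniqueness and
  additivity of one-parameter subgroups, and it turns a vanishing generator into a fixed point.
  Assumption (ii) enters the pointwise splitting because it places \<open>(g_x0)_M(s)\<close> inside
  \<open>T_sS\<close>. The \<open>g_x0\<close>-part of any group direction is then absorbed by
  \<open>T_sS\<close>, which is why \<open>\<tt>\<close> alone spans a complement of the slice. The
  same inclusion gives the intersection of \<open>H_s\<close> with the group directions: the
  \<open>\<tt>\<close>-part of such a vector lies in \<open>T_sS\<close>, hence vanishes, and what
  is left lies both in \<open>H_s\<close> and in \<open>(g_x0)_M(s)\<close>. At \<open>x0\<close>
  the map \<open>\<xi> \<mapsto> \<xi>_M(x0)\<close> has kernel \<open>g_x0\<close>, so it is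
  injective on \<open>\<tt>\<close>; a dimension count carries this to the other points of the
  slice, where the isotropy algebra may be smaller.\<close>

lemma Ck_on_mono_set: "Ck_on k S f \<Longrightarrow> T \<subseteq> S \<Longrightarrow> Ck_on k T f"
proof (induction k arbitrary: f)
  case 0
  then show ?case by (auto intro: continuous_on_subset)
next
  case (Suc k)
  then show ?case by auto
qed

lemma frechet_derivative_transform_open:
  assumes "open S" "x \<in> S" "\<And>y. y \<in> S \<Longrightarrow> f y = g y"
  shows "frechet_derivative f (at x) = frechet_derivative g (at x)"
proof -
  have "(f has_derivative F) (at x) \<longleftrightarrow> (g has_derivative F) (at x)" for F
    using has_derivative_transform_within_open[of f F x UNIV S g]
      has_derivative_transform_within_open[of g F x UNIV S f] assms by auto
  then show ?thesis by (simp add: frechet_derivative_def)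
qed

lemma differentiable_transform_open:
  assumes "f differentiable (at x)" "open S" "x \<in> S" "\<And>y. y \<in> S \<Longrightarrow> f y = g y"
  shows "g differentiable (at x)"
  using assms has_derivative_transform_within_open[of f _ x UNIV S g]
  unfolding differentiable_def by blast

lemma Ck_on_cong:
  assumes "open S" "\<And>x. x \<in> S \<Longrightarrow> f x = g x" "Ck_on k S f"
  shows "Ck_on k S g"
  using assms
proof (induction k arbitrary: f g)
  case 0
  then show ?case by (metis Ck_on.simps(1) continuous_on_eq)
next
  case (Suc k)
  have d: "\<forall>x\<in>S. g differentiable (at x)"
    using Suc.prems differentiable_transform_open[of f _ S g] by auto
  have "Ck_on k S (\<lambda>x. frechet_derivative g (at x) v)" for v
  proof (rule Suc.IH[of "\<lambda>x. frechet_derivative f (at x) v"])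
    show "frechet_derivative f (at x) v = frechet_derivative g (at x) v" if "x \<in> S" for x
      using frechet_derivative_transform_open[of S x f g] Suc.prems that by auto
  qed (use Suc.prems in auto)
  with d show ?case by simp
qed

lemma Ck_on_SucD: "Ck_on (Suc k) S f \<Longrightarrow> Ck_on k S f"
proof (induction k arbitrary: f)
  case 0
  then show ?case
    by (auto intro!: continuous_at_imp_continuous_on differentiable_imp_continuous_within)
next
  case (Suc k)
  then show ?case by auto
qed

lemma Ck_on_le: "Ck_on k S f \<Longrightarrow> j \<le> k \<Longrightarrow> Ck_on j S f"
  by (induction k) (auto simp: le_Suc_eq dest: Ck_on_SucD simp del: Ck_on.simps)

lemma Ck_on_continuous: "Ck_on k S f \<Longrightarrow> continuous_on S f"
  using Ck_on_le[of k S f 0] by simp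

text \<open>Derivatives are taken at points of the full space, so each clause of
  \<open>Ck_on\<close> is local. Smoothness in charts is checked this way, one neighbourhood at a
  time.\<close>

lemma Ck_on_local:
  assumes "\<And>x. x \<in> S \<Longrightarrow> \<exists>T. open T \<and> x \<in> T \<and> Ck_on k T f"
  shows "Ck_on k S f"
  using assms
proof (induction k arbitrary: f)
  case 0
  have "isCont f x" if "x \<in> S" for x
    using 0[OF that] by (auto simp: continuous_on_eq_continuous_at)
  then show ?case by (auto simp: continuous_at_imp_continuous_on)
next
  case (Suc k)
  then have "f differentiable (at x)" if "x \<in> S" for x
    using that by fastforce
  moreover have "Ck_on k S (\<lambda>x. frechet_derivative f (at x) v)" for v
    by (rule Suc.IH) (use Suc.prems in fastforce)
  ultimately show ?case by simp
qed

text \<open>Uniqueness of the derivative lets an explicit formula \<open>F\<close> stand in for the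
  description operator \<open>frechet_derivative\<close>.\<close>

lemma Ck_on_SucI:
  assumes "open S" "\<And>x. x \<in> S \<Longrightarrow> (f has_derivative F x) (at x)"
    and "\<And>v. Ck_on k S (\<lambda>x. F x v)"
  shows "Ck_on (Suc k) S f"
proof -
  have "Ck_on k S (\<lambda>x. frechet_derivative f (at x) v)" for v
  proof (rule Ck_on_cong[OF assms(1) _ assms(3)])
    show "F x v = frechet_derivative f (at x) v" if "x \<in> S" for x
      using frechet_derivative_at[OF assms(2)[OF that]] by simp
  qed
  then show ?thesis using assms(2) by (auto simp: differentiable_def)
qed

lemma Ck_on_has_derivative:
  "Ck_on (Suc k) S f \<Longrightarrow> x \<in> S \<Longrightarrow> (f has_derivative frechet_derivative f (at x)) (at x)"
  using frechet_derivative_works[of f "at x"] by auto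

lemma Ck_on_const: "open S \<Longrightarrow> Ck_on k S (\<lambda>x. c)"
proof (induction k arbitrary: c)
  case 0
  then show ?case by simp
next
  case (Suc k)
  then show ?case by (intro Ck_on_SucI[where F="\<lambda>x v. 0"]) auto
qed

lemma Ck_on_bounded_linear:
  assumes "open S" "bounded_linear L"
  shows "Ck_on k S L"
proof (cases k)
  case 0
  then show ?thesis using assms linear_continuous_on by auto
next
  case (Suc j)
  show ?thesis unfolding Suc
    by (rule Ck_on_SucI[where F="\<lambda>x. L"])
      (use assms in \<open>auto intro: Ck_on_const bounded_linear_imp_has_derivative\<close>)
qed

lemma Ck_on_add:
  "open S \<Longrightarrow> Ck_on k S f \<Longrightarrow> Ck_on k S g \<Longrightarrow> Ck_on k S (\<lambda>x. f x + g x)"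
proof (induction k arbitrary: f g)
  case 0
  then show ?case by (auto intro: continuous_intros)
next
  case (Suc k)
  show ?case
  proof (rule Ck_on_SucI[OF Suc.prems(1)])
    show "((\<lambda>x. f x + g x) has_derivative
        (\<lambda>v. frechet_derivative f (at x) v + frechet_derivative g (at x) v)) (at x)"
      if "x \<in> S" for x
      by (intro has_derivative_add Ck_on_has_derivative[OF Suc.prems(2) that]
          Ck_on_has_derivative[OF Suc.prems(3) that])
  qed (use Suc in auto)
qed

lemma Ck_on_linear_compose:
  assumes "open S" "bounded_linear L"
  shows "Ck_on k S f \<Longrightarrow> Ck_on k S (\<lambda>x. L (f x))"
proof (induction k arbitrary: f)
  case 0
  then show ?case using assms(2) bounded_linear.continuous_on by auto
next
  case (Suc k)
  show ?case
  proof (rule Ck_on_SucI[OF assms(1)])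
    show "((\<lambda>x. L (f x)) has_derivative (\<lambda>v. L (frechet_derivative f (at x) v))) (at x)"
      if "x \<in> S" for x
      by (rule bounded_linear.has_derivative[OF assms(2) Ck_on_has_derivative[OF Suc.prems that]])
  qed (use Suc in auto)
qed

lemma Ck_on_sum:
  "finite B \<Longrightarrow> open S \<Longrightarrow> (\<And>b. b \<in> B \<Longrightarrow> Ck_on k S (f b)) \<Longrightarrow> Ck_on k S (\<lambda>x. \<Sum>b\<in>B. f b x)"
proof (induction B rule: finite_induct)
  case empty
  then show ?case by (simp add: Ck_on_const)
next
  case (insert b B)
  then show ?case by (simp add: Ck_on_add)
qed

lemma Ck_on_scaleR:
  fixes f :: "'a::real_normed_vector \<Rightarrow> real"
  shows "open S \<Longrightarrow> Ck_on k S f \<Longrightarrow> Ck_on k S g \<Longrightarrow> Ck_on k S (\<lambda>x. f x *\<^sub>R g x)"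
proof (induction k arbitrary: f g)
  case 0
  then show ?case by (auto intro: continuous_intros)
next
  case (Suc k)
  show ?case
  proof (rule Ck_on_SucI[OF Suc.prems(1)])
    show "((\<lambda>x. f x *\<^sub>R g x) has_derivative
        (\<lambda>v. f x *\<^sub>R frechet_derivative g (at x) v + frechet_derivative f (at x) v *\<^sub>R g x)) (at x)"
      if "x \<in> S" for x
      by (intro has_derivative_scaleR Ck_on_has_derivative[OF Suc.prems(2) that]
          Ck_on_has_derivative[OF Suc.prems(3) that])
    show "Ck_on k S (\<lambda>x. f x *\<^sub>R frechet_derivative g (at x) v + frechet_derivative f (at x) v *\<^sub>R g x)"
      for v
      using Suc.prems Ck_on_SucD[OF Suc.prems(2)] Ck_on_SucD[OF Suc.prems(3)]
      by (intro Ck_on_add Suc.IH) auto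
  qed
qed

lemma Ck_on_Pair:
  "open S \<Longrightarrow> Ck_on k S f \<Longrightarrow> Ck_on k S g \<Longrightarrow> Ck_on k S (\<lambda>x. (f x, g x))"
proof (induction k arbitrary: f g)
  case 0
  then show ?case by (auto intro: continuous_intros)
next
  case (Suc k)
  show ?case
  proof (rule Ck_on_SucI[OF Suc.prems(1)])
    show "((\<lambda>x. (f x, g x)) has_derivative
        (\<lambda>v. (frechet_derivative f (at x) v, frechet_derivative g (at x) v))) (at x)"
      if "x \<in> S" for x
      by (intro has_derivative_Pair Ck_on_has_derivative[OF Suc.prems(2) that]
          Ck_on_has_derivative[OF Suc.prems(3) that])
  qed (use Suc in auto)
qed

subsection \<open>Finite-dimensional spaces\<close>

definition finite_dim :: "'a::real_vector itself \<Rightarrow> bool" where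
  "finite_dim _ \<longleftrightarrow> (\<exists>B::'a set. finite B \<and> span B = UNIV)"

lemma smooth_manifold_finite_dim:
  "smooth_manifold (A :: ('m::t2_space, 'e::real_normed_vector) chart set) \<Longrightarrow> finite_dim TYPE('e)"
  by (simp add: smooth_manifold_def finite_dim_def)

lemma finite_dim_real: "finite_dim TYPE(real)"
proof -
  have "span {1::real} = UNIV" by (auto simp: span_singleton)
  then show ?thesis unfolding finite_dim_def by blast
qed

lemma finite_dim_prod:
  assumes "finite_dim TYPE('a::real_vector)" "finite_dim TYPE('b::real_vector)"
  shows "finite_dim TYPE('a \<times> 'b)"
proof -
  obtain B :: "'a set" and C :: "'b set"
    where B: "finite B" "span B = UNIV" and C: "finite C" "span C = UNIV"
    using assms by (auto simp: finite_dim_def)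
  let ?D = "(\<lambda>b. (b, 0)) ` B \<union> (\<lambda>c. (0, c)) ` C"
  have l1: "linear (\<lambda>b. (b, 0) :: 'a \<times> 'b)" and l2: "linear (\<lambda>c. (0, c) :: 'a \<times> 'b)"
    by (auto intro!: linearI)
  have "(x, y) \<in> span ?D" for x y
  proof -
    have "span ((\<lambda>b. (b, 0)) ` B) = range (\<lambda>b. (b, 0 :: 'b))"
      "span ((\<lambda>c. (0, c)) ` C) = range (\<lambda>c. (0 :: 'a, c))"
      by (simp_all add: linear_span_image[OF l1] linear_span_image[OF l2] B C)
    then have "(x, 0) \<in> span ?D" "(0, y) \<in> span ?D"
      using span_mono[of "(\<lambda>b. (b, 0)) ` B" ?D] span_mono[of "(\<lambda>c. (0, c)) ` C" ?D] by auto
    then have "(x, 0) + (0, y) \<in> span ?D" by (rule span_add)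
    then show ?thesis by simp
  qed
  then have "span ?D = UNIV" by auto
  then show ?thesis using B(1) C(1) unfolding finite_dim_def by (intro exI[of _ ?D]) auto
qed

text \<open>\<open>B\<close> is an orthonormal basis, empty in dimension zero: orthogonalise a
  finite spanning set, discard 0 and normalise. Expansion in \<open>B\<close> reduces statements
  about linear maps to finitely many vectors.\<close>

lemma finite_dim_frame:
  assumes "finite_dim TYPE('a::real_inner)"
  obtains B :: "'a::real_inner set" where "finite B" "\<And>x. (\<Sum>b\<in>B. (x \<bullet> b) *\<^sub>R b) = x"
proof -
  obtain C0 :: "'a set" where C0: "finite C0" "span C0 = UNIV"
    using assms by (auto simp: finite_dim_def)
  obtain C where C: "finite C" "span C = (UNIV::'a set)" "pairwise orthogonal C"
    using basis_orthogonal[OF C0(1)] C0(2) by auto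
  define D where "D = C - {0}"
  have D: "finite D" "span D = UNIV" "pairwise orthogonal D" "0 \<notin> D"
    using C by (auto simp: D_def span_delete_0 pairwise_def)
  define B where "B = (\<lambda>d. d /\<^sub>R norm d) ` D"
  have inj: "inj_on (\<lambda>d. d /\<^sub>R norm d) D"
  proof (rule inj_onI)
    fix d d' assume h: "d \<in> D" "d' \<in> D" "d /\<^sub>R norm d = d' /\<^sub>R norm d'"
    show "d = d'"
    proof (rule ccontr)
      assume "d \<noteq> d'"
      then have "d \<bullet> d' = 0" using D(3) h by (auto simp: pairwise_def orthogonal_def)
      then have "(d /\<^sub>R norm d) \<bullet> (d' /\<^sub>R norm d') = 0" by simp
      then have "(d /\<^sub>R norm d) \<bullet> (d /\<^sub>R norm d) = 0" using h by simp
      then show False using h D(4) by auto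
    qed
  qed
  have sumB: "(\<Sum>b\<in>B. (x \<bullet> b) *\<^sub>R b) = (\<Sum>d\<in>D. ((x \<bullet> d) / (d \<bullet> d)) *\<^sub>R d)" for x
    unfolding B_def
    by (simp add: sum.reindex[OF inj] dot_square_norm power2_eq_square divide_inverse mult_ac)
  have "(\<Sum>d\<in>D. ((x \<bullet> d) / (d \<bullet> d)) *\<^sub>R d) = x" for x
  proof -
    \<comment> \<open>The remainder of the expansion is orthogonal to \<open>D\<close>, hence to its
      span, which contains the remainder itself.\<close>
    define y where "y = x - (\<Sum>d\<in>D. ((x \<bullet> d) / (d \<bullet> d)) *\<^sub>R d)"
    have *: "y \<bullet> e = 0" if "e \<in> D" for e
    proof -
      have "(\<Sum>d\<in>D. ((x \<bullet> d) / (d \<bullet> d)) *\<^sub>R d) \<bullet> e = (\<Sum>d\<in>D. if d = e then x \<bullet> e else 0)"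
        unfolding inner_sum_left
      proof (rule sum.cong)
        fix d assume "d \<in> D"
        then show "((x \<bullet> d) / (d \<bullet> d)) *\<^sub>R d \<bullet> e = (if d = e then x \<bullet> e else 0)"
          using D that by (auto simp: pairwise_def orthogonal_def)
      qed simp
      then show ?thesis using D(1) that by (simp add: y_def inner_diff_left)
    qed
    have "orthogonal y z" for z
    proof (rule orthogonal_to_span)
      show "z \<in> span D" using D by simp
    qed (use * in \<open>auto simp: orthogonal_def\<close>)
    then have "y = 0" using orthogonal_self by blast
    then show ?thesis by (simp add: y_def)
  qed
  then show ?thesis using that[of B] D(1) sumB by (simp add: B_def)
qed

lemma linear_frame_expand:
  assumes "linear L" "\<And>x. (\<Sum>b\<in>B. (x \<bullet> b) *\<^sub>R b) = x"
  shows "L x = (\<Sum>b\<in>B. (x \<bullet> b) *\<^sub>R L b)"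
proof -
  have "L x = L (\<Sum>b\<in>B. (x \<bullet> b) *\<^sub>R b)" by (simp add: assms(2))
  also have "\<dots> = (\<Sum>b\<in>B. (x \<bullet> b) *\<^sub>R L b)"
    by (simp add: linear_sum[OF assms(1)] linear_scale[OF assms(1)])
  finally show ?thesis .
qed

text \<open>By the chain rule the derivative of \<open>g\<close> is applied to a direction that
  varies with \<open>x\<close>, whereas the induction hypothesis covers fixed directions only.
  Expanding that direction in a finite frame leaves sums of products of \<open>Ck_on\<close>
  functions.\<close>

lemma Ck_on_compose:
  fixes f :: "'a::real_normed_vector \<Rightarrow> 'b::real_inner" and g :: "'b \<Rightarrow> 'c::real_normed_vector"
  assumes "finite_dim TYPE('b)" "open S" "open T" "f ` S \<subseteq> T"
  shows "Ck_on k S f \<Longrightarrow> Ck_on k T g \<Longrightarrow> Ck_on k S (g \<circ> f)"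
proof (induction k arbitrary: g)
  case 0
  then show ?case using assms(4) by (metis Ck_on.simps(1) continuous_on_compose continuous_on_subset)
next
  case (Suc k)
  obtain B :: "'b set" where B: "finite B" "\<And>x. (\<Sum>b\<in>B. (x \<bullet> b) *\<^sub>R b) = x"
    using finite_dim_frame[OF assms(1)] by blast
  let ?Df = "\<lambda>x v. frechet_derivative f (at x) v"
  let ?Dg = "\<lambda>y v. frechet_derivative g (at y) v"
  have Dg: "(g has_derivative ?Dg (f x)) (at (f x))" if "x \<in> S" for x
    using Ck_on_has_derivative[OF Suc.prems(2)] assms(4) that by blast
  show ?case
  proof (rule Ck_on_SucI[OF assms(2)])
    fix x assume x: "x \<in> S"
    have "(g \<circ> f has_derivative (?Dg (f x) \<circ> ?Df x)) (at x)"
      by (rule diff_chain_at[OF Ck_on_has_derivative[OF Suc.prems(1) x] Dg[OF x]])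
    moreover have "?Dg (f x) \<circ> ?Df x = (\<lambda>v. \<Sum>b\<in>B. (?Df x v \<bullet> b) *\<^sub>R ?Dg (f x) b)"
      unfolding o_def
      by (rule ext) (rule linear_frame_expand[OF has_derivative_linear[OF Dg[OF x]] B(2)])
    ultimately show "(g \<circ> f has_derivative (\<lambda>v. \<Sum>b\<in>B. (?Df x v \<bullet> b) *\<^sub>R ?Dg (f x) b)) (at x)"
      by (simp only:)
  next
    fix v
    have 1: "Ck_on k S (\<lambda>x. ?Df x v \<bullet> b)" for b
      using Ck_on_linear_compose[OF assms(2) bounded_linear_inner_left, of k "\<lambda>x. ?Df x v" b]
        Suc.prems(1) by simp
    have 2: "Ck_on k S (\<lambda>x. ?Dg (f x) b)" for b
      using Suc.IH[of "\<lambda>y. ?Dg y b"] Ck_on_SucD[OF Suc.prems(1)] Suc.prems(2) by (simp add: o_def)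
    show "Ck_on k S (\<lambda>x. \<Sum>b\<in>B. (?Df x v \<bullet> b) *\<^sub>R ?Dg (f x) b)"
      by (intro Ck_on_sum B(1) assms(2) Ck_on_scaleR 1 2)
  qed
qed

text \<open>The mean value inequality is applied to \<open>f\<close> minus its linear part at
  \<open>x0\<close>, whose derivative is small near \<open>x0\<close> in operator norm. With
  \<open>e\<close> below 1 this drives the contraction for local surjectivity; with
  \<open>e = 1\<close> it yields a local Lipschitz bound for vector fields.\<close>

lemma C1_strict_differentiable:
  fixes f :: "'a::real_inner \<Rightarrow> 'b::real_normed_vector"
  assumes "finite_dim TYPE('a)" "open S" "x0 \<in> S" "Ck_on 1 S f" "e > 0"
  obtains r where "r > 0" "cball x0 r \<subseteq> S"
    "\<And>x y. x \<in> cball x0 r \<Longrightarrow> y \<in> cball x0 r \<Longrightarrow>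
      norm (f y - f x - frechet_derivative f (at x0) (y - x)) \<le> e * norm (y - x)"
proof -
  let ?D = "\<lambda>x v. frechet_derivative f (at x) v"
  obtain B :: "'a set" where B: "finite B" "\<And>x. (\<Sum>b\<in>B. (x \<bullet> b) *\<^sub>R b) = x"
    using finite_dim_frame[OF assms(1)] by blast
  have D: "(f has_derivative ?D x) (at x)" if "x \<in> S" for x
    using Ck_on_has_derivative[of 0 S f x] assms(4) that by simp
  \<comment> \<open>By expansion in the frame and Cauchy-Schwarz, \<open>h x\<close> dominates the
    operator norm of the difference of the derivatives at \<open>x\<close> and \<open>x0\<close>. It
    is continuous because only finitely many fixed directions occur.\<close>
  define h where "h x = (\<Sum>b\<in>B. norm b * norm (?D x b - ?D x0 b))" for x
  have "isCont h x0"
    unfolding h_def using assms(2,3,4)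
    by (intro continuous_intros) (auto simp: continuous_on_eq_continuous_at)
  then have "\<forall>\<^sub>F x in nhds x0. h x < e"
    using assms(5) by (intro order_tendstoD(2)[of h "h x0"])
      (simp add: isCont_def tendsto_at_iff_tendsto_nhds, simp add: h_def)
  moreover have "\<forall>\<^sub>F x in nhds x0. x \<in> S" using assms(2,3) eventually_nhds by blast
  ultimately have "\<forall>\<^sub>F x in nhds x0. h x < e \<and> x \<in> S" by eventually_elim simp
  then obtain d where d: "d > 0" "\<And>x. dist x x0 < d \<Longrightarrow> h x < e \<and> x \<in> S"
    by (auto simp: eventually_nhds_metric)
  define r where "r = d / 2"
  have r: "r > 0" "\<And>x. x \<in> cball x0 r \<Longrightarrow> h x < e \<and> x \<in> S"
    using d by (auto simp: r_def dist_commute)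
  have on: "onorm (\<lambda>v. ?D x v - ?D x0 v) \<le> e" if "x \<in> cball x0 r" for x
  proof (rule onorm_bound)
    fix v
    have lin: "linear (\<lambda>v. ?D x v - ?D x0 v)"
      using linear_compose_sub D[of x] D[of x0] r(2)[OF that] assms(3) has_derivative_linear by blast
    have "norm (?D x v - ?D x0 v) = norm (\<Sum>b\<in>B. (v \<bullet> b) *\<^sub>R (?D x b - ?D x0 b))"
      by (subst linear_frame_expand[OF lin B(2)]) (rule refl)
    also have "\<dots> \<le> (\<Sum>b\<in>B. norm v * (norm b * norm (?D x b - ?D x0 b)))"
      by (rule sum_norm_le) (simp add: mult.assoc[symmetric] mult_right_mono Cauchy_Schwarz_ineq2)
    also have "\<dots> = h x * norm v" by (simp add: h_def sum_distrib_left mult.commute)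
    also have "\<dots> \<le> e * norm v" using r(2)[OF that] by (intro mult_right_mono) auto
    finally show "norm (?D x v - ?D x0 v) \<le> e * norm v" .
  qed (use assms(5) in simp)
  have "norm (f y - f x - ?D x0 (y - x)) \<le> e * norm (y - x)"
    if "x \<in> cball x0 r" "y \<in> cball x0 r" for x y
  proof -
    have bl: "bounded_linear (?D x0)" using D[OF assms(3)] by (rule has_derivative_bounded_linear)
    have "norm ((f y - ?D x0 y) - (f x - ?D x0 x)) \<le> e * norm (y - x)"
    proof (rule differentiable_bound[where f="\<lambda>x. f x - ?D x0 x" and S="cball x0 r"])
      show "((\<lambda>x. f x - ?D x0 x) has_derivative (\<lambda>v. ?D x v - ?D x0 v)) (at x within cball x0 r)"
        if "x \<in> cball x0 r" for x
        using r(2)[OF that] by (intro has_derivative_diff bounded_linear_imp_has_derivative bl)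
          (auto intro: has_derivative_at_withinI D)
    qed (use on that in auto)
    then show ?thesis
      by (simp add: linear_diff[OF bounded_linear.linear[OF bl]] algebra_simps)
  qed
  then show ?thesis using that[of r] r by blast
qed

text \<open>Apply the contraction \<open>x \<mapsto> y + x - f x\<close>, whose fixed points are the preimages of \<open>y\<close>.\<close>

lemma locally_surjective:
  fixes f :: "'a::{real_inner, banach} \<Rightarrow> 'a"
  assumes "finite_dim TYPE('a)" "open S" "x0 \<in> S" "Ck_on 1 S f"
    and "\<And>v. frechet_derivative f (at x0) v = v"
  shows "f x0 \<in> interior (f ` S)"
proof -
  obtain r where r: "r > 0" "cball x0 r \<subseteq> S"
    "\<And>x y. x \<in> cball x0 r \<Longrightarrow> y \<in> cball x0 r \<Longrightarrow> norm (f y - f x - (y - x)) \<le> 1/2 * norm (y - x)"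
    using C1_strict_differentiable[OF assms(1-4), of "1/2"] assms(5) by auto
  \<comment> \<open>One half of \<open>r\<close> is spent on the distance from \<open>y\<close> to
    \<open>f x0\<close>, the other on the contraction with factor 1/2; together they keep the map
    inside the closed ball.\<close>
  have "ball (f x0) (r/2) \<subseteq> f ` S"
  proof
    fix y assume y: "y \<in> ball (f x0) (r/2)"
    have "\<exists>!x\<in>cball x0 r. y + x - f x = x"
    proof (rule Banach_fix)
      show "complete (cball x0 r)" by (simp add: complete_eq_closed)
      show "(\<lambda>x. y + x - f x) ` cball x0 r \<subseteq> cball x0 r"
      proof clarify
        fix x assume x: "x \<in> cball x0 r"
        have "norm ((y - f x0) - (f x - f x0 - (x - x0))) \<le> norm (y - f x0) + norm (f x - f x0 - (x - x0))"
          by (rule norm_triangle_ineq4)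
        also have "\<dots> \<le> r/2 + 1/2 * norm (x - x0)"
          using y r(1) r(3)[of x0 x] x by (intro add_mono) (auto simp: dist_norm norm_minus_commute)
        also have "\<dots> \<le> r" using x by (simp add: dist_norm norm_minus_commute)
        finally show "y + x - f x \<in> cball x0 r"
          by (simp add: dist_norm norm_minus_commute algebra_simps)
      qed
      show "dist (y + x - f x) (y + z - f z) \<le> 1/2 * dist x z"
        if "x \<in> cball x0 r" "z \<in> cball x0 r" for x z
        using r(3)[OF that] by (simp add: dist_norm norm_minus_commute algebra_simps)
    qed (use r in auto)
    then obtain x where "x \<in> cball x0 r" "y + x - f x = x" by auto
    then have "f x = y" "x \<in> S" using r(2) by auto
    then show "y \<in> f ` S" by auto
  qed
  then show ?thesis using r(1) by (meson centre_in_ball half_gt_zero interiorI open_ball)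
qed

subsection \<open>Local solutions of autonomous differential equations\<close>

lemma vector_derivative_bound:
  fixes F :: "real \<Rightarrow> 'a::real_normed_vector"
  assumes "convex I" "\<And>t. t \<in> I \<Longrightarrow> (F has_vector_derivative h t) (at t within I)"
    and "\<And>t. t \<in> I \<Longrightarrow> norm (h t) \<le> M" "s \<in> I" "t \<in> I"
  shows "norm (F t - F s) \<le> M * \<bar>t - s\<bar>"
proof -
  have "norm (F t - F s) \<le> M * norm (t - s)"
  proof (rule differentiable_bound[OF assms(1)])
    show "(F has_derivative (\<lambda>v. v *\<^sub>R h x)) (at x within I)" if "x \<in> I" for x
      using assms(2)[OF that] by (simp add: has_vector_derivative_def)
    show "onorm (\<lambda>v. v *\<^sub>R h x) \<le> M" if "x \<in> I" for x
    proof (rule onorm_bound)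
      show "0 \<le> M" using assms(3)[OF that] norm_ge_zero order_trans by blast
      show "norm (v *\<^sub>R h x) \<le> M * norm v" for v
        using mult_left_mono[OF assms(3)[OF that], of "\<bar>v\<bar>"] by (simp add: mult.commute)
    qed
  qed (use assms in auto)
  then show ?thesis by simp
qed

lemma local_solution_exists:
  fixes X :: "'a::{real_inner, banach} \<Rightarrow> 'a"
  assumes "finite_dim TYPE('a)" "open S" "x0 \<in> S" "Ck_on 1 S X"
  obtains a \<gamma> where "a > 0" "\<gamma> 0 = x0"
    "\<And>t. t \<in> {-a<..<a} \<Longrightarrow> \<gamma> t \<in> S \<and> (\<gamma> has_vector_derivative X (\<gamma> t)) (at t)"
proof -
  let ?D = "frechet_derivative X (at x0)"
  obtain r where r: "r > 0" "cball x0 r \<subseteq> S"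
    "\<And>x y. x \<in> cball x0 r \<Longrightarrow> y \<in> cball x0 r \<Longrightarrow> norm (X y - X x - ?D (y - x)) \<le> 1 * norm (y - x)"
    using C1_strict_differentiable[OF assms(1-4), of 1] by auto
  have blD: "bounded_linear ?D"
    using Ck_on_has_derivative[of 0 S X x0] assms(3,4) by (auto intro: has_derivative_bounded_linear)
  define L where "L = onorm ?D + 1"
  have L: "L > 0" using onorm_pos_le[OF blD] by (simp add: L_def)
  have lip: "norm (X y - X x) \<le> L * norm (y - x)" if "x \<in> cball x0 r" "y \<in> cball x0 r" for x y
  proof -
    have "norm (X y - X x) \<le> norm (X y - X x - ?D (y - x)) + norm (?D (y - x))"
      using norm_triangle_ineq[of "X y - X x - ?D (y - x)" "?D (y - x)"] by simp
    also have "\<dots> \<le> L * norm (y - x)"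
      using r(3)[OF that] onorm[OF blD, of "y - x"] by (simp add: L_def algebra_simps)
    finally show ?thesis .
  qed
  define M where "M = norm (X x0) + L * r + 1"
  have M: "M > 0" unfolding M_def using L r(1) by (auto intro!: add_nonneg_pos add_nonneg_nonneg)
  have XM: "norm (X x) \<le> M" if "x \<in> cball x0 r" for x
  proof -
    have "norm (X x) \<le> norm (X x0) + norm (X x - X x0)" by (metis add.commute diff_add_cancel norm_triangle_ineq)
    also have "norm (X x - X x0) \<le> L * norm (x - x0)" using lip[of x0 x] that r(1) by simp
    also have "\<dots> \<le> L * r" using that L by (simp add: dist_norm norm_minus_commute)
    finally show ?thesis by (simp add: M_def)
  qed
  \<comment> \<open>\<open>r / M\<close> keeps the Picard iterates within distance \<open>r\<close>
    of \<open>x0\<close>, since their speed is at most \<open>M\<close>; \<open>1 / (2 * L)\<close>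
    makes the Picard operator a contraction with factor 1/2.\<close>
  define a where "a = min (r / M) (1 / (2 * L))"
  have a: "a > 0" "M * a \<le> r" "L * a \<le> 1/2"
    using r(1) M L by (auto simp: a_def min_def field_simps)
  let ?J = "{-a..a}"
  \<comment> \<open>Time is frozen outside \<open>[-a, a]\<close>. The iterates thus become bounded
    continuous functions on the whole line, an already complete metric space.\<close>
  define cl where "cl t = max (-a) (min a t)" for t :: real
  have cl: "cl t \<in> ?J" "\<bar>cl t\<bar> \<le> a" for t using a(1) by (auto simp: cl_def)
  have clc: "continuous_on UNIV cl" unfolding cl_def by (intro continuous_intros)
  define C where "C = {f :: real \<Rightarrow>\<^sub>C 'a. \<forall>t. f t \<in> cball x0 r}"
  have contX: "continuous_on (cball x0 r) X"
    using Ck_on_continuous[OF assms(4)] r(2) continuous_on_subset by blast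
  \<comment> \<open>The integral starts at \<open>-a\<close> rather than at 0, so that one formula
    is differentiable on the whole interval. Subtracting \<open>I f 0\<close> in \<open>P\<close>
    moves the base point back to time 0.\<close>
  define I where "I f t = integral {-a..t} (\<lambda>s. X (apply_bcontfun f s))" for f t
  define P where "P f t = x0 + (I f (cl t) - I f 0)" for f t
  have ID: "(I f has_vector_derivative X (f t)) (at t within ?J)" if "f \<in> C" "t \<in> ?J" for f t
    unfolding I_def using that
    by (intro integral_has_vector_derivative continuous_on_compose2[OF contX]) (auto simp: C_def)
  have Ibound: "norm (I f t - I f 0) \<le> M * \<bar>t\<bar>" if "f \<in> C" "t \<in> ?J" for f t
    using vector_derivative_bound[of ?J "I f" "\<lambda>t. X (f t)" M 0 t] ID XM that a(1) by (auto simp: C_def)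
  have Pball: "P f t \<in> cball x0 r" if "f \<in> C" for f t
  proof -
    have "norm (I f (cl t) - I f 0) \<le> M * \<bar>cl t\<bar>" using Ibound[OF that cl(1)] .
    also have "\<dots> \<le> M * a" using cl(2) M by simp
    finally show ?thesis using a(2) by (simp add: P_def dist_norm norm_minus_commute)
  qed
  have Pcont: "continuous_on UNIV (P f)" if "f \<in> C" for f
  proof -
    have "continuous_on ?J (I f)"
      by (metis ID[OF that] has_vector_derivative_continuous continuous_on_eq_continuous_within)
    then have "continuous_on UNIV (\<lambda>t. I f (cl t))"
      by (rule continuous_on_compose2[OF _ clc]) (use cl in auto)
    then show ?thesis unfolding P_def by (intro continuous_intros)
  qed
  define T where "T f = Bcontfun (P f)" for f
  have T: "apply_bcontfun (T f) = P f" if "f \<in> C" for f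
    unfolding T_def
  proof (rule Bcontfun_inverse)
    have "bounded (range (P f))"
      by (rule bounded_subset[OF bounded_cball[of x0 r]]) (use Pball[OF that] in blast)
    then show "P f \<in> bcontfun" using Pcont[OF that] by (simp add: bcontfun_def)
  qed
  have "\<exists>!f\<in>C. T f = f"
  proof (rule Banach_fix)
    have "C = PiC UNIV (\<lambda>_. cball x0 r)" by (auto simp: C_def mem_PiC_iff Pi_iff)
    moreover have "closed (PiC (UNIV :: real set) (\<lambda>_. cball x0 r))" by (rule closed_PiC) simp
    ultimately show "complete C" by (simp add: complete_eq_closed)
    have "const_bcontfun x0 \<in> C" using r(1) by (simp add: C_def const_bcontfun.rep_eq)
    then show "C \<noteq> {}" by auto
    show "T ` C \<subseteq> C" using T Pball by (auto simp: C_def)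
    show "dist (T f) (T g) \<le> 1/2 * dist f g" if "f \<in> C" "g \<in> C" for f g
    proof (rule dist_bound)
      fix t
      have "norm ((I f (cl t) - I g (cl t)) - (I f 0 - I g 0)) \<le> L * dist f g * \<bar>cl t - 0\<bar>"
      proof (rule vector_derivative_bound[of ?J "\<lambda>t. I f t - I g t" "\<lambda>t. X (f t) - X (g t)"])
        fix s assume s: "s \<in> ?J"
        show "((\<lambda>t. I f t - I g t) has_vector_derivative X (f s) - X (g s)) (at s within ?J)"
          by (intro has_vector_derivative_diff ID that s)
        have "norm (X (f s) - X (g s)) \<le> L * norm (f s - g s)"
          using lip[of "g s" "f s"] that by (auto simp: C_def)
        also have "\<dots> \<le> L * dist f g"
          using L dist_bounded[of f s g] by (simp add: dist_norm)
        finally show "norm (X (f s) - X (g s)) \<le> L * dist f g" .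
      qed (use cl a(1) in auto)
      also have "\<dots> \<le> L * dist f g * a" using L cl(2)[of t] by (intro mult_left_mono) auto
      also have "\<dots> = (L * a) * dist f g" by simp
      also have "\<dots> \<le> 1/2 * dist f g" using a(3) by (intro mult_right_mono) auto
      finally show "dist (T f t) (T g t) \<le> 1/2 * dist f g"
        by (simp add: T that P_def dist_norm algebra_simps)
    qed
  qed auto
  then obtain \<gamma> where g: "\<gamma> \<in> C" "T \<gamma> = \<gamma>" by blast
  then have gP: "apply_bcontfun \<gamma> t = P \<gamma> t" for t using T[of \<gamma>] by simp
  show ?thesis
  proof (rule that[of a "apply_bcontfun \<gamma>"])
    show "\<gamma> 0 = x0" using a(1) by (simp add: gP P_def cl_def)
    fix t assume t: "t \<in> {-a<..<a}"
    have "(I \<gamma> has_vector_derivative X (\<gamma> t)) (at t within {-a<..<a})"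
      by (rule has_vector_derivative_within_subset[OF ID[OF g(1)]]) (use t in auto)
    then have "(I \<gamma> has_vector_derivative X (\<gamma> t)) (at t)"
      using t by (simp add: at_within_open[OF t open_greaterThanLessThan])
    then have "((\<lambda>t. x0 + (I \<gamma> t - I \<gamma> 0)) has_vector_derivative X (\<gamma> t)) (at t)"
      by (auto intro!: derivative_eq_intros)
    then have "(apply_bcontfun \<gamma> has_vector_derivative X (\<gamma> t)) (at t)"
      by (rule has_vector_derivative_transform_within_open[OF _ open_greaterThanLessThan t])
        (auto simp: gP P_def cl_def)
    then show "\<gamma> t \<in> S \<and> (apply_bcontfun \<gamma> has_vector_derivative X (\<gamma> t)) (at t)"
      using g(1) r(2) by (auto simp: C_def)
  qed (fact a(1))
qed

text \<open>Bootstrapping: if the solution is \<open>k\<close> times differentiable, so is its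
  derivative \<open>X \<circ> \<gamma>\<close>, which gains one order.\<close>

lemma solution_Ck_on:
  fixes X :: "'a::real_inner \<Rightarrow> 'a" and \<gamma> :: "real \<Rightarrow> 'a"
  assumes "finite_dim TYPE('a)" "open S" "open I" "\<And>k. Ck_on k S X"
    and sol: "\<And>t. t \<in> I \<Longrightarrow> \<gamma> t \<in> S \<and> (\<gamma> has_vector_derivative X (\<gamma> t)) (at t)"
  shows "Ck_on k I \<gamma>"
proof (induction k)
  case 0
  then show ?case
    using sol by (auto intro!: continuous_at_imp_continuous_on has_vector_derivative_continuous)
next
  case (Suc k)
  show ?case
  proof (rule Ck_on_SucI[OF assms(3)])
    show "(\<gamma> has_derivative (\<lambda>v. v *\<^sub>R X (\<gamma> t))) (at t)" if "t \<in> I" for t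
      using sol[OF that] by (simp add: has_vector_derivative_def)
    have "Ck_on k I (X \<circ> \<gamma>)"
      by (rule Ck_on_compose[OF assms(1,3,2) _ Suc assms(4)]) (use sol in auto)
    then show "Ck_on k I (\<lambda>t. v *\<^sub>R X (\<gamma> t))" for v
      using Ck_on_linear_compose[OF assms(3) bounded_linear_scaleR_right, of k "X \<circ> \<gamma>" v]
      by (simp add: o_def)
  qed
qed

section \<open>Charts and smooth maps\<close>

lemma chart_inv_chart: "is_chart c \<Longrightarrow> x \<in> fst c \<Longrightarrow> chart_inv c (snd c x) = x"
  unfolding is_chart_def chart_inv_def by (metis homeomorphism_def inj_on_inverseI inv_into_f_f)

lemma chart_inv_in: "u \<in> snd c ` fst c \<Longrightarrow> chart_inv c u \<in> fst c"
  unfolding chart_inv_def by (rule inv_into_into)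

lemma chart_chart_inv: "u \<in> snd c ` fst c \<Longrightarrow> snd c (chart_inv c u) = u"
  unfolding chart_inv_def by (rule f_inv_into_f)

lemma chart_open: "is_chart c \<Longrightarrow> open (fst c)"
  by (simp add: is_chart_def)

lemma chart_continuous: "is_chart c \<Longrightarrow> continuous_on (fst c) (snd c)"
  by (auto simp: is_chart_def homeomorphism_def)

lemma chart_inv_continuous:
  assumes "is_chart c"
  shows "continuous_on (snd c ` fst c) (chart_inv c)"
proof -
  obtain \<psi> where "homeomorphism (fst c) (snd c ` fst c) (snd c) \<psi>"
    using assms by (auto simp: is_chart_def)
  then show ?thesis
    by (auto simp: homeomorphism_def chart_inv_chart[OF assms] elim!: continuous_on_eq)
qed

lemma chart_image_eq:
  assumes "is_chart c"
  shows "snd c ` (fst c \<inter> T) = {u \<in> snd c ` fst c. chart_inv c u \<in> T}"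
  using chart_inv_chart[OF assms] by (auto simp: image_iff)

lemma open_chart_image:
  assumes "is_chart c" "open T"
  shows "open (snd c ` (fst c \<inter> T))"
proof -
  have "open (snd c ` fst c \<inter> chart_inv c -` T)"
    using assms continuous_open_preimage[OF chart_inv_continuous[OF assms(1)] _ assms(2)]
    by (simp add: is_chart_def)
  moreover have "snd c ` fst c \<inter> chart_inv c -` T = snd c ` (fst c \<inter> T)"
    using chart_image_eq[OF assms(1)] by blast
  ultimately show ?thesis by simp
qed

text \<open>What is left of \<open>smooth_atlas\<close> when transition maps are set aside. The
  chain rule for tangent maps works in this generality, since it never changes the chart at a
  point.\<close>

definition covering_charts ::
    "('m::topological_space, 'e::real_normed_vector) chart set \<Rightarrow> bool" where
  "covering_charts A \<longleftrightarrow> (\<forall>c\<in>A. is_chart c) \<and> (\<Union>c\<in>A. fst c) = UNIV"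

lemma smooth_atlas_covering: "smooth_atlas A \<Longrightarrow> covering_charts A"
  by (simp add: smooth_atlas_def covering_charts_def)

lemma chart_at:
  assumes "covering_charts A"
  shows "chart_at A x \<in> A" "x \<in> fst (chart_at A x)" "is_chart (chart_at A x)"
proof -
  have "\<exists>c. c \<in> A \<and> x \<in> fst c" using assms unfolding covering_charts_def by blast
  from someI_ex[OF this] show "chart_at A x \<in> A" "x \<in> fst (chart_at A x)"
    unfolding chart_at_def by auto
  then show "is_chart (chart_at A x)" using assms by (auto simp: covering_charts_def)
qed

section \<open>Product charts\<close>

definition prod_chart :: "('m, 'e) chart \<Rightarrow> ('n, 'f) chart \<Rightarrow> ('m \<times> 'n, 'e \<times> 'f) chart" where
  "prod_chart c d = (fst c \<times> fst d, map_prod (snd c) (snd d))"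

lemma fst_prod_chart: "fst (prod_chart c d) = fst c \<times> fst d"
  and snd_prod_chart: "snd (prod_chart c d) (x, y) = (snd c x, snd d y)"
  by (simp_all add: prod_chart_def)

lemma prod_chart_image: "snd (prod_chart c d) ` fst (prod_chart c d) = (snd c ` fst c) \<times> (snd d ` fst d)"
  by (auto simp: prod_chart_def)

lemma is_chart_prod:
  assumes "is_chart c" "is_chart d"
  shows "is_chart (prod_chart c d)"
proof -
  obtain \<psi> \<psi>' where h: "homeomorphism (fst c) (snd c ` fst c) (snd c) \<psi>"
    "homeomorphism (fst d) (snd d ` fst d) (snd d) \<psi>'"
    using assms by (auto simp: is_chart_def)
  have "homeomorphism (fst c \<times> fst d) ((snd c ` fst c) \<times> (snd d ` fst d))
      (map_prod (snd c) (snd d)) (map_prod \<psi> \<psi>')"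
  proof (rule homeomorphismI)
    show "continuous_on (fst c \<times> fst d) (map_prod (snd c) (snd d))"
      using h unfolding homeomorphism_def map_prod_def split_beta'
      by (intro continuous_intros continuous_on_compose2[of "fst c" "snd c" _ fst]
          continuous_on_compose2[of "fst d" "snd d" _ snd]) auto
    show "continuous_on ((snd c ` fst c) \<times> (snd d ` fst d)) (map_prod \<psi> \<psi>')"
      using h unfolding homeomorphism_def map_prod_def split_beta'
      by (intro continuous_intros continuous_on_compose2[of "snd c ` fst c" \<psi> _ fst]
          continuous_on_compose2[of "snd d ` fst d" \<psi>' _ snd]) auto
  qed (use h in \<open>auto simp: homeomorphism_def\<close>)
  then have "homeomorphism (fst (prod_chart c d)) (snd (prod_chart c d) ` fst (prod_chart c d))
      (snd (prod_chart c d)) (map_prod \<psi> \<psi>')"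
    unfolding prod_chart_image by (simp add: prod_chart_def)
  moreover have "open (fst (prod_chart c d))" "open (snd (prod_chart c d) ` fst (prod_chart c d))"
    using assms by (simp_all only: prod_chart_image) (auto simp: fst_prod_chart is_chart_def intro: open_Times)
  ultimately show ?thesis unfolding is_chart_def by blast
qed

lemma prod_chart_inv:
  assumes "is_chart c" "is_chart d" "u \<in> snd c ` fst c" "v \<in> snd d ` fst d"
  shows "chart_inv (prod_chart c d) (u, v) = (chart_inv c u, chart_inv d v)"
  using chart_inv_chart[OF is_chart_prod[OF assms(1,2)], of "(chart_inv c u, chart_inv d v)"]
    chart_inv_in[OF assms(3)] chart_inv_in[OF assms(4)]
    chart_chart_inv[OF assms(3)] chart_chart_inv[OF assms(4)]
  by (simp add: fst_prod_chart snd_prod_chart)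

lemma prod_chart_in_atlas: "c \<in> A \<Longrightarrow> d \<in> B \<Longrightarrow> prod_chart c d \<in> prod_atlas A B"
  unfolding prod_chart_def prod_atlas_def by blast

section \<open>Composition and partial maps of smooth maps\<close>

lemma smooth_map_Ck:
  "smooth_map A B f \<Longrightarrow> c \<in> A \<Longrightarrow> d \<in> B \<Longrightarrow>
    Ck_on k (snd c ` (fst c \<inter> f -` fst d)) (snd d \<circ> f \<circ> chart_inv c)"
  by (auto simp: smooth_map_def smooth_on_def)

lemma smooth_map_continuous: "smooth_map A B f \<Longrightarrow> continuous_on UNIV f"
  by (simp add: smooth_map_def)

lemma open_continuous_vimage: "continuous_on UNIV f \<Longrightarrow> open T \<Longrightarrow> open (f -` T)"
  by (simp add: continuous_on_open_vimage)

lemma isCont_compose_continuous: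
  fixes \<gamma> :: "'a::t2_space \<Rightarrow> 'b::topological_space"
  assumes "continuous_on UNIV f" "isCont \<gamma> t"
  shows "isCont (\<lambda>s. f (\<gamma> s)) t"
  using assms continuous_on_tendsto_compose[of UNIV f \<gamma> "\<gamma> t" "at t"] by (simp add: isCont_def)

lemma smooth_map_compose:
  fixes A :: "('m::topological_space, 'e::real_normed_vector) chart set"
    and B :: "('n::topological_space, 'f::real_inner) chart set"
    and C :: "('p::topological_space, 'h::real_normed_vector) chart set"
  assumes "finite_dim TYPE('f)" "covering_charts A" "covering_charts B" "covering_charts C"
    and f: "smooth_map A B f" and g: "smooth_map B C g"
  shows "smooth_map A C (\<lambda>x. g (f x))"
  unfolding smooth_map_def smooth_on_def
proof (intro conjI ballI allI)
  note cf = smooth_map_continuous[OF f] and cg = smooth_map_continuous[OF g]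
  show cgf: "continuous_on UNIV (\<lambda>x. g (f x))"
    by (rule continuous_on_compose2[OF cg cf]) auto
  fix c e k assume c: "c \<in> A" and e: "e \<in> C"
  have ic: "is_chart c" "is_chart e" using c e assms(2,4) by (auto simp: covering_charts_def)
  show "Ck_on k (snd c ` (fst c \<inter> (\<lambda>x. g (f x)) -` fst e)) (snd e \<circ> (\<lambda>x. g (f x)) \<circ> chart_inv c)"
  proof (rule Ck_on_local)
    fix u assume "u \<in> snd c ` (fst c \<inter> (\<lambda>x. g (f x)) -` fst e)"
    then obtain x where x: "x \<in> fst c" "g (f x) \<in> fst e" "u = snd c x" by auto
    obtain d where d: "d \<in> B" "f x \<in> fst d" "is_chart d"
      using chart_at[OF assms(3), of "f x"] by blast
    define T where "T = snd c ` (fst c \<inter> (f -` fst d \<inter> (\<lambda>x. g (f x)) -` fst e))"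
    have oT: "open T"
      unfolding T_def using ic d cf cgf
      by (intro open_chart_image ic open_Int open_continuous_vimage) (auto simp: chart_open)
    have oW: "open (snd d ` (fst d \<inter> g -` fst e))"
      using ic d cg by (intro open_chart_image d open_continuous_vimage) (auto simp: chart_open)
    have 1: "Ck_on k T (snd d \<circ> f \<circ> chart_inv c)"
      by (rule Ck_on_mono_set[OF smooth_map_Ck[OF f c d(1)]]) (auto simp: T_def)
    have "Ck_on k T ((snd e \<circ> g \<circ> chart_inv d) \<circ> (snd d \<circ> f \<circ> chart_inv c))"
      by (rule Ck_on_compose[OF assms(1) oT oW _ 1 smooth_map_Ck[OF g d(1) e]])
        (auto simp: T_def chart_inv_chart[OF ic(1)])
    then have "Ck_on k T (snd e \<circ> (\<lambda>x. g (f x)) \<circ> chart_inv c)"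
      by (rule Ck_on_cong[OF oT, rotated])
        (auto simp: T_def chart_inv_chart[OF ic(1)] chart_inv_chart[OF d(3)])
    then show "\<exists>T. open T \<and> u \<in> T \<and> Ck_on k T (snd e \<circ> (\<lambda>x. g (f x)) \<circ> chart_inv c)"
      using oT x d by (intro exI[of _ T]) (auto simp: T_def)
  qed
qed

lemma Ck_on_ident: "open S \<Longrightarrow> Ck_on k S (\<lambda>x. x)"
  by (rule Ck_on_bounded_linear) (auto intro: bounded_linear_ident)

text \<open>In charts, fixing the second argument is composition with the affine map
  \<open>u \<mapsto> (u, snd ?b y)\<close> into a product chart.\<close>

lemma smooth_map_section_left:
  fixes A :: "('m::topological_space, 'e::real_inner) chart set"
    and B :: "('n::topological_space, 'f::real_inner) chart set"
    and C :: "('p::topological_space, 'h::real_normed_vector) chart set"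
  assumes "finite_dim TYPE('e)" "finite_dim TYPE('f)"
    "covering_charts A" "covering_charts B" "covering_charts C"
    and F: "smooth_map (prod_atlas A B) C F"
  shows "smooth_map A C (\<lambda>x. F (x, y))"
  unfolding smooth_map_def smooth_on_def
proof (intro conjI ballI allI)
  show cF: "continuous_on UNIV (\<lambda>x. F (x, y))"
    by (rule continuous_on_compose2[OF smooth_map_continuous[OF F]]) (auto intro!: continuous_intros)
  fix c e k assume c: "c \<in> A" and e: "e \<in> C"
  have ic: "is_chart c" "is_chart e" using c e assms(3,5) by (auto simp: covering_charts_def)
  let ?b = "chart_at B y"
  note b = chart_at[OF assms(4), of y]
  let ?T = "snd c ` (fst c \<inter> (\<lambda>x. F (x, y)) -` fst e)"
  let ?p = "prod_chart c ?b"
  have oT: "open ?T" using ic cF by (intro open_chart_image ic open_continuous_vimage) (auto simp: chart_open)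
  have oW: "open (snd ?p ` (fst ?p \<inter> F -` fst e))"
    using ic b smooth_map_continuous[OF F]
    by (intro open_chart_image is_chart_prod open_continuous_vimage) (auto simp: chart_open)
  have "Ck_on k ?T ((snd e \<circ> F \<circ> chart_inv ?p) \<circ> (\<lambda>u. (u, snd ?b y)))"
  proof (rule Ck_on_compose[OF finite_dim_prod[OF assms(1,2)] oT oW])
    show "Ck_on k ?T (\<lambda>u. (u, snd ?b y))"
      by (intro Ck_on_Pair Ck_on_const Ck_on_ident oT)
    show "Ck_on k (snd ?p ` (fst ?p \<inter> F -` fst e)) (snd e \<circ> F \<circ> chart_inv ?p)"
      by (rule smooth_map_Ck[OF F prod_chart_in_atlas[OF c b(1)] e])
    show "(\<lambda>u. (u, snd ?b y)) ` ?T \<subseteq> snd ?p ` (fst ?p \<inter> F -` fst e)"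
    proof clarify
      fix x assume "x \<in> fst c" "F (x, y) \<in> fst e"
      then show "(snd c x, snd ?b y) \<in> snd ?p ` (fst ?p \<inter> F -` fst e)"
        using b by (intro image_eqI[of _ _ "(x, y)"]) (auto simp: fst_prod_chart snd_prod_chart)
    qed
  qed
  then show "Ck_on k ?T (snd e \<circ> (\<lambda>x. F (x, y)) \<circ> chart_inv c)"
    by (rule Ck_on_cong[OF oT, rotated])
      (use b in \<open>auto simp: prod_chart_inv[OF ic(1) b(3)] chart_inv_chart[OF ic(1)] chart_inv_chart[OF b(3)]\<close>)
qed

lemma smooth_map_section_right:
  fixes A :: "('m::topological_space, 'e::real_inner) chart set"
    and B :: "('n::topological_space, 'f::real_inner) chart set"
    and C :: "('p::topological_space, 'h::real_normed_vector) chart set"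
  assumes "finite_dim TYPE('e)" "finite_dim TYPE('f)"
    "covering_charts A" "covering_charts B" "covering_charts C"
    and F: "smooth_map (prod_atlas A B) C F"
  shows "smooth_map B C (\<lambda>y. F (x, y))"
  unfolding smooth_map_def smooth_on_def
proof (intro conjI ballI allI)
  show cF: "continuous_on UNIV (\<lambda>y. F (x, y))"
    by (rule continuous_on_compose2[OF smooth_map_continuous[OF F]]) (auto intro!: continuous_intros)
  fix c e k assume c: "c \<in> B" and e: "e \<in> C"
  have ic: "is_chart c" "is_chart e" using c e assms(4,5) by (auto simp: covering_charts_def)
  let ?b = "chart_at A x"
  note b = chart_at[OF assms(3), of x]
  let ?T = "snd c ` (fst c \<inter> (\<lambda>y. F (x, y)) -` fst e)"
  let ?p = "prod_chart ?b c"
  have oT: "open ?T" using ic cF by (intro open_chart_image ic open_continuous_vimage) (auto simp: chart_open)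
  have oW: "open (snd ?p ` (fst ?p \<inter> F -` fst e))"
    using ic b smooth_map_continuous[OF F]
    by (intro open_chart_image is_chart_prod open_continuous_vimage) (auto simp: chart_open)
  have "Ck_on k ?T ((snd e \<circ> F \<circ> chart_inv ?p) \<circ> (\<lambda>u. (snd ?b x, u)))"
  proof (rule Ck_on_compose[OF finite_dim_prod[OF assms(1,2)] oT oW])
    show "Ck_on k ?T (\<lambda>u. (snd ?b x, u))"
      by (intro Ck_on_Pair Ck_on_const Ck_on_ident oT)
    show "Ck_on k (snd ?p ` (fst ?p \<inter> F -` fst e)) (snd e \<circ> F \<circ> chart_inv ?p)"
      by (rule smooth_map_Ck[OF F prod_chart_in_atlas[OF b(1) c] e])
    show "(\<lambda>u. (snd ?b x, u)) ` ?T \<subseteq> snd ?p ` (fst ?p \<inter> F -` fst e)"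
    proof clarify
      fix y assume "y \<in> fst c" "F (x, y) \<in> fst e"
      then show "(snd ?b x, snd c y) \<in> snd ?p ` (fst ?p \<inter> F -` fst e)"
        using b by (intro image_eqI[of _ _ "(x, y)"]) (auto simp: fst_prod_chart snd_prod_chart)
    qed
  qed
  then show "Ck_on k ?T (snd e \<circ> (\<lambda>y. F (x, y)) \<circ> chart_inv c)"
    by (rule Ck_on_cong[OF oT, rotated])
      (use b in \<open>auto simp: prod_chart_inv[OF b(3) ic(1)] chart_inv_chart[OF ic(1)] chart_inv_chart[OF b(3)]\<close>)
qed

section \<open>Velocities\<close>

text \<open>Unlike \<^const>\<open>velocity\<close>, this applies to curves that are differentiable at one
  parameter only, such as the straight lines in a chart.\<close>

definition has_velocity ::
    "('m::topological_space, 'e::real_normed_vector) chart set \<Rightarrow> (real \<Rightarrow> 'm) \<Rightarrow> 'e \<Rightarrow> real \<Rightarrow> bool" where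
  "has_velocity A \<gamma> v t \<longleftrightarrow> isCont \<gamma> t \<and>
     ((\<lambda>s. snd (chart_at A (\<gamma> t)) (\<gamma> s)) has_vector_derivative v) (at t)"

lemma has_velocity_imp_velocity: "has_velocity A \<gamma> v t \<Longrightarrow> velocity A \<gamma> t = v"
  by (simp add: has_velocity_def velocity_def o_def vector_derivative_at)

lemma has_velocity_unique: "has_velocity A \<gamma> v t \<Longrightarrow> has_velocity A \<gamma> w t \<Longrightarrow> v = w"
  using has_velocity_imp_velocity by metis

lemma has_velocity_cong:
  assumes "has_velocity A \<gamma> v t" "open I" "t \<in> I" "\<And>s. s \<in> I \<Longrightarrow> \<gamma> s = \<delta> s"
  shows "has_velocity A \<delta> v t"
proof -
  have "\<forall>\<^sub>F s in nhds t. \<gamma> s = \<delta> s" using assms eventually_nhds by blast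
  then have "isCont \<delta> t" using assms(1) isCont_cong unfolding has_velocity_def by blast
  moreover have "((\<lambda>s. snd (chart_at A (\<delta> t)) (\<delta> s)) has_vector_derivative v) (at t)"
    using assms(1) unfolding has_velocity_def
    by (auto intro: has_vector_derivative_transform_within_open[OF _ assms(2,3)] simp: assms(4) assms(4)[OF assms(3), symmetric])
  ultimately show ?thesis by (simp add: has_velocity_def)
qed

lemma has_velocity_const: "has_velocity A (\<lambda>s. x) 0 t"
  by (simp add: has_velocity_def)

lemma has_velocity_reparam:
  assumes "has_velocity A \<gamma> v (h t)" "(h has_real_derivative r) (at t)"
  shows "has_velocity A (\<lambda>s. \<gamma> (h s)) (r *\<^sub>R v) t"
proof -
  have "isCont h t" using assms(2) DERIV_isCont by blast
  then have "isCont (\<lambda>s. \<gamma> (h s)) t"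
    using assms(1) isCont_o2 unfolding has_velocity_def by blast
  moreover have "((\<lambda>s. snd (chart_at A (\<gamma> (h t))) (\<gamma> (h s))) has_vector_derivative r *\<^sub>R v) (at t)"
    using vector_diff_chain_at[of h r t] assms
    unfolding has_velocity_def has_real_derivative_iff_has_vector_derivative by (force simp: o_def)
  ultimately show ?thesis by (simp add: has_velocity_def)
qed

lemma has_velocity_shift: "has_velocity A (\<lambda>s. \<gamma> (t + s)) v 0 \<longleftrightarrow> has_velocity A \<gamma> v t"
proof
  assume h: "has_velocity A (\<lambda>s. \<gamma> (t + s)) v 0"
  have "((\<lambda>s. s - t) has_real_derivative 1) (at t)" by (auto intro!: derivative_eq_intros)
  from has_velocity_reparam[OF _ this, of A "\<lambda>s. \<gamma> (t + s)" v] h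
  show "has_velocity A \<gamma> v t" by simp
next
  assume h: "has_velocity A \<gamma> v t"
  have "((\<lambda>s. t + s) has_real_derivative 1) (at 0)" by (auto intro!: derivative_eq_intros)
  from has_velocity_reparam[OF _ this, of A \<gamma> v] h
  show "has_velocity A (\<lambda>s. \<gamma> (t + s)) v 0" by simp
qed

text \<open>The chain rule for charts other than those picked by \<open>chart_at\<close>. With
  \<open>f = id\<close> it describes a change of charts; with product charts it handles maps of two
  arguments.\<close>

lemma vector_derivative_in_charts:
  assumes "is_chart c" "isCont \<gamma> t" "\<gamma> t \<in> fst c"
    and "((\<lambda>s. snd c (\<gamma> s)) has_vector_derivative v) (at t)"
    and "(snd d \<circ> f \<circ> chart_inv c has_derivative L) (at (snd c (\<gamma> t)))"
  shows "((\<lambda>s. snd d (f (\<gamma> s))) has_vector_derivative L v) (at t)"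
proof -
  have "\<forall>\<^sub>F s in nhds t. \<gamma> s \<in> fst c"
    using assms(2,3) chart_open[OF assms(1)]
    by (metis isCont_def tendsto_at_iff_tendsto_nhds topological_tendstoD)
  then obtain I where I: "open I" "t \<in> I" "\<And>s. s \<in> I \<Longrightarrow> \<gamma> s \<in> fst c"
    by (auto simp: eventually_nhds)
  have "((snd d \<circ> f \<circ> chart_inv c) \<circ> (\<lambda>s. snd c (\<gamma> s)) has_derivative L \<circ> (\<lambda>s. s *\<^sub>R v)) (at t)"
    using assms(4) unfolding has_vector_derivative_def
    by (rule diff_chain_at[where f="\<lambda>s. snd c (\<gamma> s)" and x=t]) (fact assms(5))
  then have "((snd d \<circ> f \<circ> chart_inv c) \<circ> (\<lambda>s. snd c (\<gamma> s)) has_vector_derivative L v) (at t)"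
    using linear_scale[OF has_derivative_linear[OF assms(5)]]
    by (simp add: has_vector_derivative_def o_def)
  then show ?thesis
    by (rule has_vector_derivative_transform_within_open[OF _ I(1,2)])
      (simp add: chart_inv_chart[OF assms(1) I(3)])
qed

text \<open>Away from 0 the line may leave the chart image, where \<open>chart_inv\<close> has
  unspecified values; the claims concern only parameters near 0.\<close>

lemma chart_line:
  fixes c :: "('m::topological_space, 'e::real_normed_vector) chart" and v :: 'e
  assumes "is_chart c" "x \<in> fst c"
  defines "\<gamma> \<equiv> \<lambda>s. chart_inv c (snd c x + s *\<^sub>R v)"
  shows "\<gamma> 0 = x" "isCont \<gamma> 0" "((\<lambda>s. snd c (\<gamma> s)) has_vector_derivative v) (at 0)"
proof -
  have op: "open (snd c ` fst c)" using assms(1) by (simp add: is_chart_def)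
  have x: "snd c x \<in> snd c ` fst c" using assms(2) by blast
  show "\<gamma> 0 = x" by (simp add: \<gamma>_def chart_inv_chart assms(1,2))
  have 1: "isCont (\<lambda>s. snd c x + s *\<^sub>R v) 0" for s by (intro continuous_intros)
  have "isCont (chart_inv c) (snd c x)"
    using chart_inv_continuous[OF assms(1)] op x continuous_on_eq_continuous_at by blast
  then show "isCont \<gamma> 0" unfolding \<gamma>_def using isCont_o2[OF 1] by simp
  define I where "I = (\<lambda>s. snd c x + s *\<^sub>R v) -` (snd c ` fst c)"
  have I: "open I" unfolding I_def by (intro open_continuous_vimage op continuous_intros)
  have "((\<lambda>s. snd c x + s *\<^sub>R v) has_vector_derivative v) (at 0)"
    by (auto intro!: derivative_eq_intros)
  then show "((\<lambda>s. snd c (\<gamma> s)) has_vector_derivative v) (at 0)"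
    by (rule has_vector_derivative_transform_within_open[OF _ I])
      (use x in \<open>auto simp: I_def \<gamma>_def chart_chart_inv\<close>)
qed

lemma has_velocity_exists:
  assumes "covering_charts A"
  obtains \<gamma> where "\<gamma> 0 = x" "has_velocity A \<gamma> v 0"
  using chart_line[OF chart_at(3,2)[OF assms, of x], of v] that unfolding has_velocity_def by metis

lemma smooth_map_has_derivative:
  fixes A :: "('m::topological_space, 'e::real_normed_vector) chart set"
    and B :: "('n::topological_space, 'f::real_normed_vector) chart set"
  assumes "smooth_map A B f" "c \<in> A" "x \<in> fst c" "d \<in> B" "f x \<in> fst d"
  shows "(snd d \<circ> f \<circ> chart_inv c has_derivative
    frechet_derivative (snd d \<circ> f \<circ> chart_inv c) (at (snd c x))) (at (snd c x))"
  by (rule Ck_on_has_derivative[OF smooth_map_Ck[OF assms(1,2,4)]]) (use assms in auto)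

lemma tangent_map_has_derivative:
  assumes "covering_charts A" "covering_charts B" "smooth_map A B f"
  shows "(snd (chart_at B (f x)) \<circ> f \<circ> chart_inv (chart_at A x) has_derivative tangent_map A B f x)
    (at (snd (chart_at A x) x))"
  unfolding tangent_map_def using chart_at[OF assms(1), of x] chart_at[OF assms(2), of "f x"]
  by (intro smooth_map_has_derivative[OF assms(3)])

lemma linear_tangent_map:
  "covering_charts A \<Longrightarrow> covering_charts B \<Longrightarrow> smooth_map A B f \<Longrightarrow> linear (tangent_map A B f x)"
  by (rule has_derivative_linear[OF tangent_map_has_derivative])

lemma has_velocity_map:
  assumes "covering_charts A" "covering_charts B" "smooth_map A B f" "has_velocity A \<gamma> v t"
  shows "has_velocity B (\<lambda>s. f (\<gamma> s)) (tangent_map A B f (\<gamma> t) v) t"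
proof -
  have "isCont (\<lambda>s. f (\<gamma> s)) t"
    using assms(4) isCont_compose_continuous[OF smooth_map_continuous[OF assms(3)]]
    unfolding has_velocity_def by blast
  moreover have "((\<lambda>s. snd (chart_at B (f (\<gamma> t))) (f (\<gamma> s))) has_vector_derivative
      tangent_map A B f (\<gamma> t) v) (at t)"
    using assms(4) unfolding has_velocity_def
    by (intro vector_derivative_in_charts[OF chart_at(3)[OF assms(1)] _ chart_at(2)[OF assms(1)]
          _ tangent_map_has_derivative[OF assms(1-3)]]) auto
  ultimately show ?thesis by (simp add: has_velocity_def)
qed

text \<open>Both sides are the velocity at 0 of \<open>g \<circ> f \<circ> \<gamma>\<close>, for a
  curve \<open>\<gamma>\<close> through \<open>x\<close> with velocity \<open>v\<close>.\<close>

lemma tangent_map_compose: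
  fixes A :: "('m::topological_space, 'e::real_normed_vector) chart set"
    and B :: "('n::topological_space, 'f::real_inner) chart set"
    and C :: "('p::topological_space, 'h::real_normed_vector) chart set"
  assumes "finite_dim TYPE('f)" "covering_charts A" "covering_charts B" "covering_charts C"
    and f: "smooth_map A B f" and g: "smooth_map B C g"
  shows "tangent_map A C (\<lambda>x. g (f x)) x v = tangent_map B C g (f x) (tangent_map A B f x v)"
proof -
  obtain \<gamma> where \<gamma>: "\<gamma> 0 = x" "has_velocity A \<gamma> v 0" using has_velocity_exists[OF assms(2)] .
  have "has_velocity C (\<lambda>s. g (f (\<gamma> s))) (tangent_map A C (\<lambda>x. g (f x)) x v) 0"
    using has_velocity_map[OF assms(2,4) smooth_map_compose[OF assms] \<gamma>(2)] \<gamma>(1) by simp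
  moreover have "has_velocity C (\<lambda>s. g (f (\<gamma> s))) (tangent_map B C g (f x) (tangent_map A B f x v)) 0"
    using has_velocity_map[OF assms(3,4) g has_velocity_map[OF assms(2,3) f \<gamma>(2)]] \<gamma>(1) by simp
  ultimately show ?thesis by (rule has_velocity_unique)
qed

lemma tangent_map_ident:
  assumes "covering_charts A"
  shows "tangent_map A A (\<lambda>x. x) x v = v"
proof -
  note c = chart_at[OF assms, of x]
  have "frechet_derivative (snd (chart_at A x) \<circ> (\<lambda>x. x) \<circ> chart_inv (chart_at A x)) (at (snd (chart_at A x) x))
      = frechet_derivative (\<lambda>u. u) (at (snd (chart_at A x) x))"
    by (rule frechet_derivative_transform_open[of "snd (chart_at A x) ` fst (chart_at A x)"])
      (use c in \<open>auto simp: is_chart_def chart_chart_inv\<close>)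
  then show ?thesis by (simp add: tangent_map_def)
qed

text \<open>The differential of \<open>F\<close> is the sum of its partial differentials. It is
  taken in the product of the two chosen charts, since the chart that \<open>chart_at\<close> picks
  in \<open>prod_atlas\<close> may be a different one.\<close>

lemma has_velocity_map2:
  fixes A :: "('m::topological_space, 'e::real_inner) chart set"
    and B :: "('n::topological_space, 'f::real_inner) chart set"
    and C :: "('p::topological_space, 'h::real_normed_vector) chart set"
  assumes "finite_dim TYPE('e)" "finite_dim TYPE('f)"
    "covering_charts A" "covering_charts B" "covering_charts C"
    and F: "smooth_map (prod_atlas A B) C F"
    and \<alpha>: "has_velocity A \<alpha> a t" and \<beta>: "has_velocity B \<beta> b t"
  shows "has_velocity C (\<lambda>s. F (\<alpha> s, \<beta> s))
    (tangent_map A C (\<lambda>x. F (x, \<beta> t)) (\<alpha> t) a + tangent_map B C (\<lambda>y. F (\<alpha> t, y)) (\<beta> t) b) t"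
proof -
  let ?c = "chart_at A (\<alpha> t)" and ?d = "chart_at B (\<beta> t)" and ?e = "chart_at C (F (\<alpha> t, \<beta> t))"
  let ?p = "prod_chart ?c ?d"
  note c = chart_at[OF assms(3), of "\<alpha> t"] and d = chart_at[OF assms(4), of "\<beta> t"]
    and e = chart_at[OF assms(5), of "F (\<alpha> t, \<beta> t)"]
  define L where "L = frechet_derivative (snd ?e \<circ> F \<circ> chart_inv ?p) (at (snd ?p (\<alpha> t, \<beta> t)))"
  have L: "(snd ?e \<circ> F \<circ> chart_inv ?p has_derivative L) (at (snd ?p (\<alpha> t, \<beta> t)))"
    unfolding L_def
    by (rule smooth_map_has_derivative[OF F prod_chart_in_atlas])
      (use c d e in \<open>auto simp: fst_prod_chart\<close>)
  \<comment> \<open>Stated for arbitrary curves through the same two points, so that freezing one of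
    them identifies \<open>L (a, 0)\<close> and \<open>L (0, b)\<close> with the partial tangent
    maps.\<close>
  have vel: "has_velocity C (\<lambda>s. F (\<alpha>' s, \<beta>' s)) (L (a', b')) t"
    if "has_velocity A \<alpha>' a' t" "has_velocity B \<beta>' b' t" "\<alpha>' t = \<alpha> t" "\<beta>' t = \<beta> t" for \<alpha>' \<beta>' a' b'
  proof -
    have cont: "isCont (\<lambda>s. (\<alpha>' s, \<beta>' s)) t"
      using that by (auto simp: has_velocity_def intro: continuous_intros)
    have "isCont (\<lambda>s. F (\<alpha>' s, \<beta>' s)) t"
      by (rule isCont_compose_continuous[OF smooth_map_continuous[OF F] cont])
    moreover have "((\<lambda>s. snd ?e (F (\<alpha>' s, \<beta>' s))) has_vector_derivative L (a', b')) (at t)"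
    proof (rule vector_derivative_in_charts[OF is_chart_prod[OF c(3) d(3)] cont])
      show "((\<lambda>s. snd ?p (\<alpha>' s, \<beta>' s)) has_vector_derivative (a', b')) (at t)"
        using that unfolding snd_prod_chart has_velocity_def by (auto intro: has_vector_derivative_Pair)
      show "(snd ?e \<circ> F \<circ> chart_inv ?p has_derivative L) (at (snd ?p (\<alpha>' t, \<beta>' t)))"
        using L that by simp
    qed (use that c d in \<open>auto simp: fst_prod_chart\<close>)
    ultimately show ?thesis using that by (simp add: has_velocity_def)
  qed
  have "L (a, 0) = tangent_map A C (\<lambda>x. F (x, \<beta> t)) (\<alpha> t) a"
    by (rule has_velocity_unique[OF vel[OF \<alpha> has_velocity_const refl refl]])
      (rule has_velocity_map[OF assms(3,5) smooth_map_section_left[OF assms(1-6)] \<alpha>])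
  moreover have "L (0, b) = tangent_map B C (\<lambda>y. F (\<alpha> t, y)) (\<beta> t) b"
    by (rule has_velocity_unique[OF vel[OF has_velocity_const \<beta> refl refl]])
      (rule has_velocity_map[OF assms(4,5) smooth_map_section_right[OF assms(1-6)] \<beta>])
  moreover have "L (a, b) = L (a, 0) + L (0, b)"
    using linear_add[OF has_derivative_linear[OF L], of "(a, 0)" "(0, b)"] by simp
  ultimately show ?thesis using vel[OF \<alpha> \<beta> refl refl] by simp
qed

subsection \<open>Change of charts\<close>

lemma compatible_has_derivative:
  assumes "compatible c d" "x \<in> fst c" "x \<in> fst d"
  shows "(snd d \<circ> chart_inv c has_derivative frechet_derivative (snd d \<circ> chart_inv c) (at (snd c x)))
    (at (snd c x))"
proof (rule Ck_on_has_derivative)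
  show "Ck_on (Suc 0) (snd c ` (fst c \<inter> fst d)) (snd d \<circ> chart_inv c)"
    using assms(1) unfolding compatible_def smooth_on_def by blast
qed (use assms in auto)

lemma vector_derivative_chart_change:
  assumes "compatible c d" "is_chart c" "isCont \<gamma> t" "\<gamma> t \<in> fst c" "\<gamma> t \<in> fst d"
    and "((\<lambda>s. snd c (\<gamma> s)) has_vector_derivative v) (at t)"
  shows "((\<lambda>s. snd d (\<gamma> s)) has_vector_derivative
    frechet_derivative (snd d \<circ> chart_inv c) (at (snd c (\<gamma> t))) v) (at t)"
  using vector_derivative_in_charts[where f=id and c=c and d=d and \<gamma>=\<gamma> and t=t and v=v] compatible_has_derivative[OF assms(1)] assms
  by simp

lemma has_velocity_chartI:
  assumes "covering_charts A" "is_chart c" "\<forall>d\<in>A. compatible c d" "isCont \<gamma> t" "\<gamma> t \<in> fst c"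
    and "((\<lambda>s. snd c (\<gamma> s)) has_vector_derivative v) (at t)"
  shows "has_velocity A \<gamma>
    (frechet_derivative (snd (chart_at A (\<gamma> t)) \<circ> chart_inv c) (at (snd c (\<gamma> t))) v) t"
  unfolding has_velocity_def
  using vector_derivative_chart_change[of c "chart_at A (\<gamma> t)"] chart_at[OF assms(1), of "\<gamma> t"] assms
  by auto

text \<open>The velocity at each \<open>s\<close> refers to the chart chosen at
  \<open>\<gamma> s\<close>. Compatibility carries all of them into the single chart at
  \<open>\<gamma> t\<close>; transition derivatives are linear and keep zero at zero, so the
  coordinates there are constant.\<close>

lemma has_velocity_zero_locally_const:
  assumes "smooth_atlas A" "open I" "t \<in> I" "\<And>s. s \<in> I \<Longrightarrow> has_velocity A \<gamma> 0 s"
  shows "\<forall>\<^sub>F s in at t within I. \<gamma> t = \<gamma> s"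
proof -
  note cov = smooth_atlas_covering[OF assms(1)]
  let ?c = "chart_at A (\<gamma> t)"
  note c = chart_at[OF cov, of "\<gamma> t"]
  have "isCont \<gamma> t" using assms(3,4) by (auto simp: has_velocity_def)
  then have "\<forall>\<^sub>F s in nhds t. \<gamma> s \<in> fst ?c"
    using c chart_open by (metis isCont_def tendsto_at_iff_tendsto_nhds topological_tendstoD)
  moreover have "\<forall>\<^sub>F s in nhds t. s \<in> I" using assms(2,3) eventually_nhds by blast
  ultimately have "\<forall>\<^sub>F s in nhds t. \<gamma> s \<in> fst ?c \<and> s \<in> I" by eventually_elim simp
  then obtain e where e: "e > 0" "\<And>s. s \<in> ball t e \<Longrightarrow> \<gamma> s \<in> fst ?c \<and> s \<in> I"
    by (auto simp: eventually_nhds_metric dist_commute)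
  have "((\<lambda>s. snd ?c (\<gamma> s)) has_derivative (\<lambda>h. 0)) (at s within ball t e)" if "s \<in> ball t e" for s
  proof -
    let ?d = "chart_at A (\<gamma> s)"
    note d = chart_at[OF cov, of "\<gamma> s"]
    have comp: "compatible ?d ?c" using assms(1) c d by (auto simp: smooth_atlas_def)
    have s: "has_velocity A \<gamma> 0 s" "\<gamma> s \<in> fst ?c" using e(2)[OF that] assms(4) by auto
    have "((\<lambda>s. snd ?c (\<gamma> s)) has_vector_derivative
        frechet_derivative (snd ?c \<circ> chart_inv ?d) (at (snd ?d (\<gamma> s))) 0) (at s)"
      using vector_derivative_chart_change[OF comp d(3)] s d unfolding has_velocity_def by auto
    moreover have "frechet_derivative (snd ?c \<circ> chart_inv ?d) (at (snd ?d (\<gamma> s))) 0 = 0"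
      by (rule linear_0[OF has_derivative_linear[OF compatible_has_derivative[OF comp d(2) s(2)]]])
    ultimately show ?thesis by (simp add: has_vector_derivative_def has_derivative_at_withinI)
  qed
  then have "snd ?c (\<gamma> s) = snd ?c (\<gamma> t)" if "s \<in> ball t e" for s
    using has_derivative_zero_unique[of "ball t e" "\<lambda>s. snd ?c (\<gamma> s)" s t] that e(1) by auto
  then have "\<gamma> t = \<gamma> s" if "s \<in> ball t e" for s
    using e(2)[OF that] chart_inv_chart[OF c(3)] c(2) that by metis
  then show ?thesis
    using e(1) unfolding eventually_at by (auto simp: dist_commute)
qed

lemma has_velocity_zero_const:
  assumes "smooth_atlas A" "open I" "connected I" "\<And>s. s \<in> I \<Longrightarrow> has_velocity A \<gamma> 0 s" "s \<in> I" "t \<in> I"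
  shows "\<gamma> s = \<gamma> t"
  by (rule connected_local_const[OF assms(3,5,6)])
    (use has_velocity_zero_locally_const[OF assms(1,2) _ assms(4)] in blast)

section \<open>Smooth curves\<close>

lemma covering_real_atlas: "covering_charts real_atlas"
  unfolding covering_charts_def real_atlas_def is_chart_def
  by (auto intro!: exI[of _ "\<lambda>t::real. t"] simp: homeomorphism_def)

lemma real_chart_inv: "chart_inv (UNIV, \<lambda>t::real. t) = (\<lambda>t. t)"
proof
  fix t :: real
  have "inv_into UNIV (\<lambda>t::real. t) ((\<lambda>t. t) t) = t" by (rule inv_into_f_f) auto
  then show "chart_inv (UNIV, \<lambda>t::real. t) t = t" by (simp add: chart_inv_def)
qed

lemma smooth_curve_iff:
  "smooth_map real_atlas A \<gamma> \<longleftrightarrow>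
    continuous_on UNIV \<gamma> \<and> (\<forall>d\<in>A. \<forall>k. Ck_on k (\<gamma> -` fst d) (\<lambda>t. snd d (\<gamma> t)))"
  by (auto simp: smooth_map_def real_atlas_def real_chart_inv smooth_on_def o_def)

lemma smooth_curve_has_velocity:
  assumes "covering_charts A" "smooth_map real_atlas A \<gamma>"
  shows "has_velocity A \<gamma> (velocity A \<gamma> t) t"
proof -
  have "(\<lambda>s. snd (chart_at A (\<gamma> t)) (\<gamma> s)) differentiable (at t)"
    using assms(2) chart_at[OF assms(1), of "\<gamma> t"] unfolding smooth_curve_iff
    by (metis Ck_on.simps(2) vimageI)
  moreover have "isCont \<gamma> t"
    using smooth_map_continuous[OF assms(2)] by (simp add: continuous_on_eq_continuous_at)
  ultimately show ?thesis
    by (simp add: has_velocity_def velocity_def o_def vector_derivative_works)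
qed

section \<open>One-parameter subgroups\<close>

locale lie_group_setting =
  fixes G :: "'g::t2_space monoid" (structure)
    and AG :: "('g, 'f::{real_inner, banach}) chart set"
  assumes lie_group: "lie_group G AG"
begin

lemma carrier_UNIV [simp]: "carrier G = UNIV"
  using lie_group by (simp add: lie_group_def)

sublocale group G
  using lie_group by (simp add: lie_group_def)

lemma atlas: "smooth_atlas AG"
  using lie_group by (simp add: lie_group_def smooth_manifold_def)

lemma cov: "covering_charts AG"
  by (rule smooth_atlas_covering[OF atlas])

lemma finite_dim_lie: "finite_dim TYPE('f)"
  using lie_group smooth_manifold_finite_dim[of AG] by (simp add: lie_group_def)

lemma smooth_mult: "smooth_map (prod_atlas AG AG) AG (\<lambda>(g, h). g \<otimes> h)"
  using lie_group by (simp add: lie_group_def)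

lemma smooth_inv: "smooth_map AG AG (\<lambda>g. inv g)"
  using lie_group by (simp add: lie_group_def)

lemma smooth_left: "smooth_map AG AG (\<lambda>h. g \<otimes> h)"
  using smooth_map_section_right[OF finite_dim_lie finite_dim_lie cov cov cov smooth_mult, of g] by simp

lemma smooth_right: "smooth_map AG AG (\<lambda>h. h \<otimes> g)"
  using smooth_map_section_left[OF finite_dim_lie finite_dim_lie cov cov cov smooth_mult, of g] by simp

lemma inv_mult_cancel: "inv g \<otimes> (g \<otimes> h) = h" "g \<otimes> (inv g \<otimes> h) = h"
  by (simp_all add: m_assoc[symmetric])

text \<open>The velocity of the quotient depends on \<open>P\<close> only through
  \<open>\<xi>\<close>. Replacing \<open>P\<close> by \<open>Q\<close> makes the quotient constant,
  so this velocity is 0, and the derivative of inversion need not be computed.\<close>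

lemma has_velocity_quotient:
  assumes P: "has_velocity AG P \<xi> 0" "P 0 = \<one>" and Q: "has_velocity AG Q \<xi> 0" "Q 0 = \<one>"
  shows "has_velocity AG (\<lambda>s. P s \<otimes> inv (Q s)) 0 0"
proof -
  define w where "w = tangent_map AG AG (\<lambda>x. x \<otimes> inv \<one>) \<one> \<xi>
    + tangent_map AG AG (\<lambda>y. \<one> \<otimes> y) (inv \<one>) (tangent_map AG AG (\<lambda>g. inv g) \<one> \<xi>)"
  have Qi: "has_velocity AG (\<lambda>s. inv (Q s)) (tangent_map AG AG (\<lambda>g. inv g) \<one> \<xi>) 0"
    using has_velocity_map[OF cov cov smooth_inv Q(1)] Q(2) by simp
  have w: "has_velocity AG (\<lambda>s. R s \<otimes> inv (Q s)) w 0" if "has_velocity AG R \<xi> 0" "R 0 = \<one>" for R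
    using has_velocity_map2[OF finite_dim_lie finite_dim_lie cov cov cov smooth_mult that(1) Qi] that(2) Q(2)
    by (simp add: w_def)
  have "has_velocity AG (\<lambda>s. Q s \<otimes> inv (Q s)) 0 0"
    using has_velocity_const[of AG \<one> 0] by simp
  then have "w = 0" by (rule has_velocity_unique[OF w[OF Q]])
  then show ?thesis using w[OF P] by simp
qed

text \<open>The left logarithmic derivative, informally \<open>p(t)^(-1) p'(t) = \<xi>\<close>: the
  curve solves the equation of the left-invariant field of \<open>\<xi>\<close>. The translate
  passes through the identity, so \<open>\<xi>\<close> is always read in one and the same
  chart.\<close>

definition left_velocity :: "(real \<Rightarrow> 'g) \<Rightarrow> 'f \<Rightarrow> real \<Rightarrow> bool" where
  "left_velocity p \<xi> t \<longleftrightarrow> has_velocity AG (\<lambda>s. inv (p t) \<otimes> p (t + s)) \<xi> 0"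

text \<open>Near \<open>t\<close> the quotient is \<open>p t\<close> times the quotient of the
  left-translated curves times \<open>inv (q t)\<close>. The middle factor has velocity 0, and
  translations map 0 to 0. This is the uniqueness principle for the left-invariant equation, used in
  place of an estimate for differential equations.\<close>

lemma left_velocity_quotient_const:
  assumes "open I" "connected I" "\<And>t. t \<in> I \<Longrightarrow> left_velocity p \<xi> t" "\<And>t. t \<in> I \<Longrightarrow> left_velocity q \<xi> t"
    and "s \<in> I" "t \<in> I"
  shows "p s \<otimes> inv (q s) = p t \<otimes> inv (q t)"
proof (rule has_velocity_zero_const[OF atlas assms(1,2) _ assms(5,6)])
  fix t assume t: "t \<in> I"
  have "has_velocity AG (\<lambda>s. (inv (p t) \<otimes> p (t + s)) \<otimes> inv (inv (q t) \<otimes> q (t + s))) 0 0"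
    using assms(3,4)[OF t] by (intro has_velocity_quotient) (auto simp: left_velocity_def)
  from has_velocity_map[OF cov cov smooth_left this, of "p t"]
  have "has_velocity AG (\<lambda>s. p t \<otimes> ((inv (p t) \<otimes> p (t + s)) \<otimes> inv (inv (q t) \<otimes> q (t + s)))) 0 0"
    by (simp add: linear_0[OF linear_tangent_map[OF cov cov smooth_left]])
  from has_velocity_map[OF cov cov smooth_right this, of "inv (q t)"]
  have "has_velocity AG (\<lambda>s. p t \<otimes> ((inv (p t) \<otimes> p (t + s)) \<otimes> inv (inv (q t) \<otimes> q (t + s))) \<otimes> inv (q t)) 0 0"
    by (simp add: linear_0[OF linear_tangent_map[OF cov cov smooth_right]])
  then have "has_velocity AG (\<lambda>s. p (t + s) \<otimes> inv (q (t + s))) 0 0"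
    by (simp add: inv_mult_group m_assoc inv_mult_cancel)
  then show "has_velocity AG (\<lambda>s. p s \<otimes> inv (q s)) 0 t"
    using has_velocity_shift[of AG "\<lambda>s. p s \<otimes> inv (q s)" t 0] by simp
qed

lemma left_velocity_shift: "left_velocity p \<xi> (s + t) \<Longrightarrow> left_velocity (\<lambda>r. p (s + r)) \<xi> t"
  by (simp add: left_velocity_def add.assoc)

text \<open>The curve solves the equation of the left-invariant vector field, written in the chart
  at the identity.\<close>

lemma local_one_param_subgroup_exists:
  obtains a y where "a > 0" "y 0 = snd (chart_at AG \<one>) \<one>"
    "\<And>t. t \<in> {-a<..<a} \<Longrightarrow> y t \<in> snd (chart_at AG \<one>) ` fst (chart_at AG \<one>)"
    "\<And>k. Ck_on k {-a<..<a} y"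
    "\<And>t. t \<in> {-a<..<a} \<Longrightarrow> left_velocity (\<lambda>t. chart_inv (chart_at AG \<one>) (y t)) \<xi> t"
proof -
  let ?c = "chart_at AG \<one>" and ?m = "\<lambda>(g, h). g \<otimes> h"
  note c = chart_at[OF cov, of \<one>]
  let ?p = "prod_chart ?c ?c"
  let ?e = "snd ?c \<one>"
  define V where "V = snd ?c ` fst ?c"
  define W where "W = snd ?p ` (fst ?p \<inter> ?m -` fst ?c)"
  define \<mu> where "\<mu> = snd ?c \<circ> ?m \<circ> chart_inv ?p"
  have V: "open V" "?e \<in> V" using c by (auto simp: V_def is_chart_def)
  have W: "open W"
    unfolding W_def using c smooth_map_continuous[OF smooth_mult]
    by (intro open_chart_image is_chart_prod open_continuous_vimage) (auto simp: chart_open)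
  have Ck\<mu>: "Ck_on k W \<mu>" for k
    unfolding \<mu>_def W_def by (rule smooth_map_Ck[OF smooth_mult prod_chart_in_atlas[OF c(1) c(1)] c(1)])
  have VW: "(x, ?e) \<in> W" if "x \<in> V" for x
  proof -
    obtain g where g: "g \<in> fst ?c" "x = snd ?c g" using \<open>x \<in> V\<close> unfolding V_def by blast
    show ?thesis unfolding W_def
      by (rule image_eqI[of _ _ "(g, \<one>)"]) (use g c in \<open>auto simp: fst_prod_chart snd_prod_chart\<close>)
  qed
  \<comment> \<open>The left-invariant vector field in coordinates: multiplication is differentiated
    in its second argument at the identity, in direction \<open>\<xi>\<close>.\<close>
  define X where "X x = frechet_derivative \<mu> (at (x, ?e)) (0, \<xi>)" for x
  have CkX: "Ck_on k V X" for k
  proof -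
    have "Ck_on k V ((\<lambda>z. frechet_derivative \<mu> (at z) (0, \<xi>)) \<circ> (\<lambda>x. (x, ?e)))"
    proof (rule Ck_on_compose[OF finite_dim_prod[OF finite_dim_lie finite_dim_lie] V(1) W])
      show "Ck_on k V (\<lambda>x. (x, ?e))" by (intro Ck_on_Pair Ck_on_ident Ck_on_const V)
      show "Ck_on k W (\<lambda>z. frechet_derivative \<mu> (at z) (0, \<xi>))" using Ck\<mu>[of "Suc k"] by simp
    qed (use VW in auto)
    then show ?thesis by (simp add: o_def X_def[abs_def])
  qed
  obtain a y where y: "a > 0" "y 0 = ?e"
    "\<And>t. t \<in> {-a<..<a} \<Longrightarrow> y t \<in> V \<and> (y has_vector_derivative X (y t)) (at t)"
    using local_solution_exists[OF finite_dim_lie V CkX[of 1]] by blast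
  have Cky: "Ck_on k {-a<..<a} y" for k
    by (rule solution_Ck_on[OF finite_dim_lie V(1) _ CkX y(3)]) auto
  define \<gamma> where "\<gamma> t = chart_inv ?c (y t)" for t
  have lv: "left_velocity \<gamma> \<xi> t" if t: "t \<in> {-a<..<a}" for t
  proof -
    have \<gamma>t: "\<gamma> t \<in> fst ?c" "snd ?c (\<gamma> t) = y t"
      using y(3)[OF t] by (auto simp: \<gamma>_def V_def chart_chart_inv chart_inv_in)
    \<comment> \<open>\<open>l\<close> is a test curve with velocity \<open>\<xi>\<close>. Both
      \<open>\<gamma> t \<otimes> l s\<close> at \<open>s = 0\<close> and \<open>\<gamma>\<close> at
      \<open>t\<close> have coordinate derivative \<open>X (y t)\<close>, hence the same velocity
      \<open>D (X (y t))\<close>. Translating the first back to the identity gives \<open>l\<close>,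
      so the translation sends this velocity to \<open>\<xi>\<close>; then the same holds for
      \<open>\<gamma>\<close>.\<close>
    define l where "l s = chart_inv ?c (?e + s *\<^sub>R \<xi>)" for s
    note cl = chart_line[OF c(3,2), of \<xi>, folded l_def]
    define D where "D = frechet_derivative (snd (chart_at AG (\<gamma> t)) \<circ> chart_inv ?c) (at (snd ?c (\<gamma> t)))"
    have comp: "\<forall>d\<in>AG. compatible ?c d" using atlas c by (auto simp: smooth_atlas_def)
    have L: "(\<mu> has_derivative frechet_derivative \<mu> (at (y t, ?e))) (at (y t, ?e))"
      by (rule Ck_on_has_derivative[OF Ck\<mu>]) (use VW y(3)[OF t] in blast)
    have contl: "isCont (\<lambda>s. (\<gamma> t, l s)) 0" using cl(2) by (intro continuous_intros)
    have "((\<lambda>s. snd ?c (?m (\<gamma> t, l s))) has_vector_derivative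
        frechet_derivative \<mu> (at (y t, ?e)) (0, \<xi>)) (at 0)"
    proof (rule vector_derivative_in_charts[OF is_chart_prod[OF c(3) c(3)] contl])
      show "((\<lambda>s. snd ?p (\<gamma> t, l s)) has_vector_derivative (0, \<xi>)) (at 0)"
        unfolding snd_prod_chart by (intro has_vector_derivative_Pair cl(3)) simp
      show "(snd ?c \<circ> ?m \<circ> chart_inv ?p has_derivative frechet_derivative \<mu> (at (y t, ?e)))
          (at (snd ?p (\<gamma> t, l 0)))"
        using L by (simp add: \<mu>_def snd_prod_chart \<gamma>t cl(1))
    qed (use \<gamma>t c cl(1) in \<open>auto simp: fst_prod_chart\<close>)
    then have d1: "((\<lambda>s. snd ?c (\<gamma> t \<otimes> l s)) has_vector_derivative X (y t)) (at 0)"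
      by (simp add: X_def)
    have "has_velocity AG (\<lambda>s. \<gamma> t \<otimes> l s) (D (X (y t))) 0"
      using has_velocity_chartI[OF cov c(3) comp _ _ d1] \<gamma>t cl
        isCont_compose_continuous[OF smooth_map_continuous[OF smooth_left] cl(2), of "\<gamma> t"]
      by (simp add: D_def)
    from has_velocity_map[OF cov cov smooth_left this, of "inv (\<gamma> t)"]
    have "has_velocity AG l (tangent_map AG AG (\<lambda>h. inv (\<gamma> t) \<otimes> h) (\<gamma> t) (D (X (y t)))) 0"
      by (simp add: inv_mult_cancel cl(1))
    moreover have "has_velocity AG l \<xi> 0" using cl by (simp add: has_velocity_def)
    ultimately have \<xi>: "tangent_map AG AG (\<lambda>h. inv (\<gamma> t) \<otimes> h) (\<gamma> t) (D (X (y t))) = \<xi>"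
      by (rule has_velocity_unique)
    have conty: "isCont y t" using y(3)[OF t] has_vector_derivative_continuous by blast
    have "isCont (chart_inv ?c) (y t)"
      using chart_inv_continuous[OF c(3)] V(1) y(3)[OF t] continuous_on_eq_continuous_at
      unfolding V_def by blast
    then have cont\<gamma>: "isCont \<gamma> t" unfolding \<gamma>_def using isCont_o2[OF conty] by blast
    have "((\<lambda>s. snd ?c (\<gamma> s)) has_vector_derivative X (y t)) (at t)"
      by (rule has_vector_derivative_transform_within_open[OF _ open_greaterThanLessThan t])
        (use y(3) t in \<open>auto simp: \<gamma>_def V_def chart_chart_inv\<close>)
    then have "has_velocity AG \<gamma> (D (X (y t))) t"
      unfolding D_def using \<gamma>t by (intro has_velocity_chartI[OF cov c(3) comp cont\<gamma>])
    from has_velocity_map[OF cov cov smooth_left this, of "inv (\<gamma> t)"]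
    show ?thesis unfolding left_velocity_def \<xi>
      using has_velocity_shift[of AG "\<lambda>s. inv (\<gamma> t) \<otimes> \<gamma> s" t \<xi>] by simp
  qed
  show ?thesis
    by (rule that[of a y]) (use y Cky lv in \<open>auto simp: V_def \<gamma>_def[abs_def]\<close>)
qed

lemma one_param_subgroup_exists: "\<exists>\<gamma>. one_param_subgroup G AG \<gamma> \<and> velocity AG \<gamma> 0 = \<xi>"
proof -
  let ?c = "chart_at AG \<one>"
  note c = chart_at[OF cov, of \<one>]
  obtain a y where a: "a > 0" and y: "y 0 = snd ?c \<one>"
    "\<And>t. t \<in> {-a<..<a} \<Longrightarrow> y t \<in> snd ?c ` fst ?c"
    "\<And>k. Ck_on k {-a<..<a} y"
    "\<And>t. t \<in> {-a<..<a} \<Longrightarrow> left_velocity (\<lambda>t. chart_inv ?c (y t)) \<xi> t"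
    using local_one_param_subgroup_exists by blast
  define \<gamma> where "\<gamma> t = chart_inv ?c (y t)" for t
  have lv: "left_velocity \<gamma> \<xi> t" if "\<bar>t\<bar> < a" for t
    using y(4)[of t] that by (simp add: \<gamma>_def[abs_def] abs_less_iff)
  have \<gamma>0: "\<gamma> 0 = \<one>" by (simp add: \<gamma>_def y(1) chart_inv_chart c)
  \<comment> \<open>For fixed \<open>s\<close>, the curves \<open>\<gamma> (s + t)\<close> and
    \<open>\<gamma> t\<close> both have left velocity \<open>\<xi>\<close> on \<open>?I\<close>, so
    their quotient has the same value at \<open>t\<close> and at 0.\<close>
  have hom: "\<gamma> (s + t) = \<gamma> s \<otimes> \<gamma> t" if "\<bar>s\<bar> < a" "\<bar>t\<bar> < a" "\<bar>s + t\<bar> < a" for s t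
  proof -
    let ?I = "{-a<..<a} \<inter> {-a-s<..<a-s}"
    have "\<gamma> (s + t) \<otimes> inv (\<gamma> t) = \<gamma> (s + 0) \<otimes> inv (\<gamma> 0)"
    proof (rule left_velocity_quotient_const[of ?I "\<lambda>t. \<gamma> (s + t)" \<xi> \<gamma>])
      show "left_velocity (\<lambda>t. \<gamma> (s + t)) \<xi> t" if "t \<in> ?I" for t
        using that by (intro left_velocity_shift lv) auto
      show "connected ?I" by (intro convex_connected convex_Int convex_real_interval)
    qed (use that a lv in auto)
    then have "\<gamma> (s + t) \<otimes> inv (\<gamma> t) \<otimes> \<gamma> t = \<gamma> s \<otimes> \<gamma> t" by (simp add: \<gamma>0)
    then show ?thesis by (simp add: m_assoc)
  qed
  have pow: "\<gamma> (real n * x) = \<gamma> x [^] n" if "\<bar>real n * x\<bar> < a" for n x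
    using that
  proof (induction n)
    case (Suc n)
    have le: "\<bar>real n * x\<bar> \<le> \<bar>real (Suc n) * x\<bar>" "\<bar>x\<bar> \<le> \<bar>real (Suc n) * x\<bar>"
      using mult_right_mono[of 1 "real (Suc n)" "\<bar>x\<bar>"] by (auto simp: abs_mult intro: mult_right_mono)
    have "\<gamma> (real n * x + x) = \<gamma> (real n * x) \<otimes> \<gamma> x"
      by (rule hom) (use le Suc.prems in \<open>auto simp: algebra_simps\<close>)
    then show ?case using Suc le by (simp add: algebra_simps)
  qed (simp add: \<gamma>0)
  \<comment> \<open>Any \<open>n\<close> with \<open>t / n\<close> in the domain
    \<open>(-a, a)\<close> would do; the choice is arbitrary and shown next to be
    irrelevant.\<close>
  define \<Gamma> where "\<Gamma> t = (let n = SOME n. n > 0 \<and> \<bar>t\<bar> < a * real n in \<gamma> (t / real n) [^] n)" for t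
  have \<Gamma>: "\<Gamma> t = \<gamma> (t / real n) [^] n" if n: "n > 0" "\<bar>t\<bar> < a * real n" for t n
  proof -
    define m where "m = (SOME n. n > 0 \<and> \<bar>t\<bar> < a * real n)"
    have m: "m > 0" "\<bar>t\<bar> < a * real m"
      using someI[of "\<lambda>n. n > 0 \<and> \<bar>t\<bar> < a * real n" n] n by (auto simp: m_def)
    \<comment> \<open>Refining the subdivision \<open>t / k\<close> further by \<open>j\<close> does
      not change the value. Subdivisions into \<open>m\<close> and \<open>n\<close> pieces are then
      compared through their common refinement into \<open>m * n\<close> pieces.\<close>
    have *: "\<gamma> (t / real k) = \<gamma> (t / (real k * real j)) [^] j" if "k > 0" "\<bar>t\<bar> < a * real k" "j > 0" for k j :: nat
      using pow[of j "t / (real k * real j)"] that by (simp add: abs_mult field_simps)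
    have "\<gamma> (t / real m) [^] m = \<gamma> (t / (real m * real n)) [^] (n * m)"
      using *[OF m n(1)] by (simp add: nat_pow_pow)
    also have "\<dots> = \<gamma> (t / real n) [^] n"
      using *[OF n m(1)] by (simp add: nat_pow_pow mult.commute)
    finally show ?thesis by (simp add: \<Gamma>_def m_def)
  qed
  have \<Gamma>_local: "\<Gamma> t = \<gamma> t" if "\<bar>t\<bar> < a" for t using \<Gamma>[of 1 t] that by simp
  have \<Gamma>_add: "\<Gamma> (s + t) = \<Gamma> s \<otimes> \<Gamma> t" for s t
  proof -
    obtain n where n: "(\<bar>s\<bar> + \<bar>t\<bar>) / a < real n" using reals_Archimedean2 by blast
    have le: "\<bar>s\<bar> + \<bar>t\<bar> < a * real n" using n a by (simp add: field_simps)
    then have "0 < a * real n" by (smt (verit) abs_ge_zero)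
    then have n0: "n > 0" using a by (simp add: zero_less_mult_iff)
    have st: "\<bar>s\<bar> < a * real n" "\<bar>t\<bar> < a * real n" "\<bar>s + t\<bar> < a * real n" using le by auto
    have st': "\<bar>s / real n\<bar> < a" "\<bar>t / real n\<bar> < a" "\<bar>s / real n + t / real n\<bar> < a"
      using st n0 by (auto simp: field_simps abs_mult simp flip: add_divide_distrib)
    \<comment> \<open>Both orders are recorded because the power of a product splits only for
      commuting factors; they commute since addition of parameters does.\<close>
    have h: "\<gamma> (s / real n + t / real n) = \<gamma> (s / real n) \<otimes> \<gamma> (t / real n)"
      "\<gamma> (s / real n + t / real n) = \<gamma> (t / real n) \<otimes> \<gamma> (s / real n)"
      using hom[of "s / real n" "t / real n"] hom[of "t / real n" "s / real n"] st'
      by (auto simp: add.commute)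
    have "\<Gamma> (s + t) = (\<gamma> (s / real n) \<otimes> \<gamma> (t / real n)) [^] n"
      using \<Gamma>[OF n0 st(3)] h(1) by (simp add: add_divide_distrib)
    also have "\<dots> = \<gamma> (s / real n) [^] n \<otimes> \<gamma> (t / real n) [^] n"
      by (rule pow_mult_distrib) (use h in auto)
    also have "\<dots> = \<Gamma> s \<otimes> \<Gamma> t" using \<Gamma>[OF n0] st by simp
    finally show ?thesis .
  qed
  \<comment> \<open>Near any \<open>t0\<close> the extension is a left translate of the local curve,
    so continuity and smoothness everywhere follow from those on \<open>(-a, a)\<close>.\<close>
  have \<Gamma>_near: "\<Gamma> t = \<Gamma> t0 \<otimes> \<gamma> (t - t0)" if "t \<in> {t0-a<..<t0+a}" for t t0
    using \<Gamma>_add[of t0 "t - t0"] \<Gamma>_local[of "t - t0"] that by (simp add: abs_less_iff)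
  have shift: "Ck_on k {t0-a<..<t0+a} (\<lambda>t. y (t - t0))" for k t0
  proof -
    have "Ck_on k {t0-a<..<t0+a} (y \<circ> (\<lambda>t. t + (- t0)))"
    proof (rule Ck_on_compose[OF finite_dim_real _ _ _ _ y(3)])
      show "Ck_on k {t0-a<..<t0+a} (\<lambda>t. t + (- t0))"
        by (intro Ck_on_add Ck_on_ident Ck_on_const) auto
    qed auto
    then show ?thesis by (simp add: o_def)
  qed
  have inI: "t - t0 \<in> {-a<..<a}" if "t \<in> {t0-a<..<t0+a}" for t t0 using that by auto
  have cont: "continuous_on UNIV \<Gamma>"
  proof (rule continuous_at_imp_continuous_on, rule ballI)
    fix t0 :: real
    have t0: "t0 \<in> {t0-a<..<t0+a}" using a by simp
    have "continuous_on {t0-a<..<t0+a} (\<lambda>t. \<gamma> (t - t0))" unfolding \<gamma>_def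
      by (rule continuous_on_compose2[OF chart_inv_continuous[OF c(3)] Ck_on_continuous[OF shift]])
        (use y(2) inI in blast)
    then have "isCont (\<lambda>t. \<gamma> (t - t0)) t0"
      using t0 by (simp add: continuous_on_eq_continuous_at)
    from isCont_compose_continuous[OF smooth_map_continuous[OF smooth_left] this, of "\<Gamma> t0"]
    have "isCont (\<lambda>t. \<Gamma> t0 \<otimes> \<gamma> (t - t0)) t0" .
    moreover have "\<forall>\<^sub>F t in nhds t0. \<Gamma> t0 \<otimes> \<gamma> (t - t0) = \<Gamma> t"
      unfolding eventually_nhds using t0 \<Gamma>_near[of _ t0, symmetric]
      by (intro exI[of _ "{t0-a<..<t0+a}"]) auto
    ultimately show "isCont \<Gamma> t0"
      using isCont_cong[of "\<lambda>t. \<Gamma> t0 \<otimes> \<gamma> (t - t0)" \<Gamma> t0] by simp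
  qed
  have "Ck_on k (\<Gamma> -` fst d) (\<lambda>t. snd d (\<Gamma> t))" if d: "d \<in> AG" for d k
  proof (rule Ck_on_local)
    fix t0 assume "t0 \<in> \<Gamma> -` fst d"
    define T where "T = \<Gamma> -` fst d \<inter> {t0-a<..<t0+a}"
    have id: "is_chart d" using d cov by (simp add: covering_charts_def)
    have oT: "open T"
      unfolding T_def by (intro open_Int open_continuous_vimage cont chart_open id) auto
    let ?W = "snd ?c ` (fst ?c \<inter> (\<lambda>h. \<Gamma> t0 \<otimes> h) -` fst d)"
    have oW: "open ?W"
      by (intro open_chart_image c open_continuous_vimage smooth_map_continuous[OF smooth_left] chart_open id)
    have "Ck_on k T ((snd d \<circ> (\<lambda>h. \<Gamma> t0 \<otimes> h) \<circ> chart_inv ?c) \<circ> (\<lambda>t. y (t - t0)))"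
    proof (rule Ck_on_compose[OF finite_dim_lie oT oW])
      show "Ck_on k T (\<lambda>t. y (t - t0))" by (rule Ck_on_mono_set[OF shift]) (auto simp: T_def)
      show "Ck_on k ?W (snd d \<circ> (\<lambda>h. \<Gamma> t0 \<otimes> h) \<circ> chart_inv ?c)"
        by (rule smooth_map_Ck[OF smooth_left c(1) d])
      show "(\<lambda>t. y (t - t0)) ` T \<subseteq> ?W"
      proof clarify
        fix t assume t: "t \<in> T"
        then have "y (t - t0) \<in> snd ?c ` fst ?c" using y(2)[OF inI, of t t0] by (simp add: T_def)
        moreover have "\<Gamma> t0 \<otimes> chart_inv ?c (y (t - t0)) \<in> fst d"
          using t \<Gamma>_near[of t t0, symmetric] by (simp add: T_def \<gamma>_def)
        ultimately show "y (t - t0) \<in> ?W"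
          using chart_image_eq[OF c(3)] by blast
      qed
    qed
    then have "Ck_on k T (\<lambda>t. snd d (\<Gamma> t))"
      by (rule Ck_on_cong[OF oT, rotated])
        (use \<Gamma>_near[of _ t0, symmetric] in \<open>auto simp: T_def \<gamma>_def\<close>)
    then show "\<exists>T. open T \<and> t0 \<in> T \<and> Ck_on k T (\<lambda>t. snd d (\<Gamma> t))"
      using oT \<open>t0 \<in> _\<close> a by (intro exI[of _ T]) (auto simp: T_def)
  qed
  then have "smooth_map real_atlas AG \<Gamma>" using cont by (simp add: smooth_curve_iff)
  moreover have "has_velocity AG \<Gamma> \<xi> 0"
  proof (rule has_velocity_cong)
    show "has_velocity AG \<gamma> \<xi> 0" using lv[of 0] a by (simp add: left_velocity_def \<gamma>0)
    show "open {-a<..<a}" by simp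
  qed (use a \<Gamma>_local in auto)
  ultimately show ?thesis
    using \<Gamma>_add has_velocity_imp_velocity unfolding one_param_subgroup_def by blast
qed

section \<open>Uniqueness of one-parameter subgroups and the exponential map\<close>

lemma one_param_subgroup_zero:
  assumes "one_param_subgroup G AG \<gamma>"
  shows "\<gamma> 0 = \<one>"
proof -
  have "\<gamma> (0 + 0) = \<gamma> 0 \<otimes> \<gamma> 0" using assms unfolding one_param_subgroup_def by blast
  then show ?thesis using l_cancel_one'[of "\<gamma> 0" "\<gamma> 0"] by simp
qed

lemma one_param_subgroup_left_velocity:
  assumes "one_param_subgroup G AG \<gamma>"
  shows "left_velocity \<gamma> (velocity AG \<gamma> 0) t"
proof -
  have "smooth_map real_atlas AG \<gamma>" using assms by (simp add: one_param_subgroup_def)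
  then have "has_velocity AG \<gamma> (velocity AG \<gamma> 0) 0" by (rule smooth_curve_has_velocity[OF cov])
  moreover have "inv (\<gamma> t) \<otimes> \<gamma> (t + s) = \<gamma> s" for s
  proof -
    have "\<gamma> (t + s) = \<gamma> t \<otimes> \<gamma> s" using assms unfolding one_param_subgroup_def by blast
    then show ?thesis by (simp only: inv_mult_cancel)
  qed
  ultimately show ?thesis by (simp only: left_velocity_def)
qed

lemma one_param_subgroup_unique:
  assumes "one_param_subgroup G AG p" "one_param_subgroup G AG q" "velocity AG p 0 = velocity AG q 0"
  shows "p = q"
proof
  fix t
  have "p t \<otimes> inv (q t) = p 0 \<otimes> inv (q 0)"
    using left_velocity_quotient_const[of UNIV p "velocity AG p 0" q t 0]
      one_param_subgroup_left_velocity[OF assms(1)] one_param_subgroup_left_velocity[OF assms(2)] assms(3)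
    by simp
  then show "p t = q t"
    using assms by (simp add: one_param_subgroup_zero inv_solve_right')
qed

lemma one_param_subgroup_scale:
  assumes "one_param_subgroup G AG \<gamma>"
  shows "one_param_subgroup G AG (\<lambda>s. \<gamma> (r * s))" "velocity AG (\<lambda>s. \<gamma> (r * s)) 0 = r *\<^sub>R velocity AG \<gamma> 0"
proof -
  have \<gamma>: "smooth_map real_atlas AG \<gamma>" using assms by (simp add: one_param_subgroup_def)
  have "smooth_map real_atlas real_atlas (\<lambda>s. r * s)"
    unfolding smooth_curve_iff
    by (auto simp: real_atlas_def intro!: continuous_intros Ck_on_bounded_linear bounded_linear_mult_right)
  from smooth_map_compose[OF finite_dim_real covering_real_atlas covering_real_atlas cov this \<gamma>]
  show "one_param_subgroup G AG (\<lambda>s. \<gamma> (r * s))"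
    using assms by (simp add: one_param_subgroup_def distrib_left)
  have "((\<lambda>s. r * s) has_real_derivative r) (at 0)" by (auto intro!: derivative_eq_intros)
  from has_velocity_reparam[OF _ this, of AG \<gamma> "velocity AG \<gamma> 0"]
  have "has_velocity AG (\<lambda>s. \<gamma> (r * s)) (r *\<^sub>R velocity AG \<gamma> 0) 0"
    using smooth_curve_has_velocity[OF cov \<gamma>, of 0] by simp
  then show "velocity AG (\<lambda>s. \<gamma> (r * s)) 0 = r *\<^sub>R velocity AG \<gamma> 0"
    by (rule has_velocity_imp_velocity)
qed

text \<open>Existence and uniqueness make the definite description in \<open>lie_exp\<close> denote.
  For \<open>t *\<^sub>R \<xi>\<close> it denotes the subgroup of \<open>\<xi>\<close> run at speed
  \<open>t\<close>, whose value at 1 is \<open>\<gamma> t\<close>.\<close>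

lemma lie_exp_one_param_subgroup: "one_param_subgroup G AG (\<lambda>t. lie_exp G AG (t *\<^sub>R \<xi>))"
  and velocity_lie_exp: "velocity AG (\<lambda>t. lie_exp G AG (t *\<^sub>R \<xi>)) 0 = \<xi>"
proof -
  obtain \<gamma> where \<gamma>: "one_param_subgroup G AG \<gamma>" "velocity AG \<gamma> 0 = \<xi>"
    using one_param_subgroup_exists by blast
  have "lie_exp G AG (t *\<^sub>R \<xi>) = \<gamma> t" for t
  proof -
    have "(THE p. one_param_subgroup G AG p \<and> velocity AG p 0 = t *\<^sub>R \<xi>) = (\<lambda>s. \<gamma> (t * s))"
      using one_param_subgroup_scale[OF \<gamma>(1), of t] \<gamma>(2)
      by (intro the_equality) (auto intro: one_param_subgroup_unique)
    then show ?thesis by (simp add: lie_exp_def)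
  qed
  then show "one_param_subgroup G AG (\<lambda>t. lie_exp G AG (t *\<^sub>R \<xi>))"
    "velocity AG (\<lambda>t. lie_exp G AG (t *\<^sub>R \<xi>)) 0 = \<xi>" using \<gamma> by simp_all
qed

lemma has_velocity_lie_exp: "has_velocity AG (\<lambda>t. lie_exp G AG (t *\<^sub>R \<xi>)) \<xi> 0"
  using smooth_curve_has_velocity[OF cov, of "\<lambda>t. lie_exp G AG (t *\<^sub>R \<xi>)" 0]
    lie_exp_one_param_subgroup[of \<xi>] velocity_lie_exp[of \<xi>]
  by (simp add: one_param_subgroup_def)

lemma lie_exp_add: "lie_exp G AG ((s + t) *\<^sub>R \<xi>) = lie_exp G AG (s *\<^sub>R \<xi>) \<otimes> lie_exp G AG (t *\<^sub>R \<xi>)"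
  using lie_exp_one_param_subgroup[of \<xi>] unfolding one_param_subgroup_def by blast

lemma lie_exp_zero: "lie_exp G AG 0 = \<one>"
  using one_param_subgroup_zero[OF lie_exp_one_param_subgroup[of 0]] by simp

end

section \<open>Smooth actions\<close>

lemma direct_sum_linear_image:
  assumes "direct_sum T V W" "linear L" "inj L"
  shows "direct_sum (L ` T) (L ` V) (L ` W)"
  unfolding direct_sum_def
proof (intro conjI)
  have d: "subspace V" "subspace W" "V \<inter> W = {0}" "T = {v + w | v w. v \<in> V \<and> w \<in> W}"
    using assms(1) by (auto simp: direct_sum_def)
  show "subspace (L ` V)" "subspace (L ` W)"
    using d linear_subspace_image[OF assms(2)] by auto
  show "L ` V \<inter> L ` W = {0}"
    using image_Int[OF assms(3), of V W] d(3) linear_0[OF assms(2)] by simp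
  show "L ` T = {v + w | v w. v \<in> L ` V \<and> w \<in> L ` W}"
  proof
    show "L ` T \<subseteq> {v + w | v w. v \<in> L ` V \<and> w \<in> L ` W}"
      unfolding d(4) using linear_add[OF assms(2)] by blast
    show "{v + w | v w. v \<in> L ` V \<and> w \<in> L ` W} \<subseteq> L ` T"
    proof clarify
      fix v w assume "v \<in> V" "w \<in> W"
      then have "v + w \<in> T" unfolding d(4) by blast
      then show "L v + L w \<in> L ` T" using linear_add[OF assms(2), of v w] by (metis imageI)
    qed
  qed
qed

locale smooth_action_setting =
  fixes G :: "'g::t2_space monoid" (structure)
    and AG :: "('g, 'f::{real_inner, banach}) chart set"
    and AM :: "('m::t2_space, 'e::{real_inner, banach}) chart set"
    and \<phi> :: "'g \<Rightarrow> 'm \<Rightarrow> 'm"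
  assumes action: "smooth_action G AG AM \<phi>"
begin

sublocale lie_group_setting G AG
  using action by unfold_locales (simp add: smooth_action_def)

lemma atlas_M: "smooth_atlas AM"
  using action by (simp add: smooth_action_def smooth_manifold_def)

lemma cov_M: "covering_charts AM"
  by (rule smooth_atlas_covering[OF atlas_M])

lemma finite_dim_M: "finite_dim TYPE('e)"
  using action smooth_manifold_finite_dim[of AM] by (simp add: smooth_action_def)

lemma group_action: "group_action G UNIV \<phi>"
  using action by (simp add: smooth_action_def)

lemma act_mult: "\<phi> (g \<otimes> h) x = \<phi> g (\<phi> h x)"
  using group_action.composition_rule[OF group_action, of x g h] by simp

lemma act_one [simp]: "\<phi> \<one> x = x"
  using group_action.id_eq_one[OF group_action] by (metis UNIV_I restrict_apply')

lemma act_inv [simp]: "\<phi> (inv g) (\<phi> g x) = x" "\<phi> g (\<phi> (inv g) x) = x"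
  by (simp_all add: act_mult[symmetric])

lemma smooth_action_map: "smooth_map (prod_atlas AG AM) AM (\<lambda>(g, x). \<phi> g x)"
  using action by (simp add: smooth_action_def)

lemma smooth_act: "smooth_map AM AM (\<phi> g)"
  using smooth_map_section_right[OF finite_dim_lie finite_dim_M cov cov_M cov_M smooth_action_map, of g]
  by simp

lemma smooth_orbit_map: "smooth_map AG AM (\<lambda>g. \<phi> g x)"
  using smooth_map_section_left[OF finite_dim_lie finite_dim_M cov cov_M cov_M smooth_action_map, of x]
  by simp

abbreviation T :: "'g \<Rightarrow> 'm \<Rightarrow> 'e \<Rightarrow> 'e" where
  "T g x \<equiv> tangent_map AM AM (\<phi> g) x"

abbreviation gen :: "'f \<Rightarrow> 'm \<Rightarrow> 'e" where
  "gen \<xi> x \<equiv> generator G AG AM \<phi> \<xi> x"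

abbreviation gens :: "'f set \<Rightarrow> 'm \<Rightarrow> 'e set" where
  "gens V x \<equiv> generators G AG AM \<phi> V x"

abbreviation isot :: "'m \<Rightarrow> 'f set" where
  "isot x \<equiv> isotropy_algebra G AG \<phi> x"

lemma linear_T: "linear (T g x)"
  by (rule linear_tangent_map[OF cov_M cov_M smooth_act])

lemma T_mult: "T (g \<otimes> h) x v = T g (\<phi> h x) (T h x v)"
  using tangent_map_compose[OF finite_dim_M cov_M cov_M cov_M smooth_act smooth_act, of g h x v]
  by (simp add: act_mult[abs_def])

lemma T_one: "T \<one> x v = v"
  using tangent_map_ident[OF cov_M, of x v] by (simp add: act_one[abs_def])

lemma T_inv: "T (inv g) (\<phi> g x) (T g x v) = v" "T g x (T (inv g) (\<phi> g x) v) = v"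
  using T_mult[of "inv g" g x v] T_mult[of g "inv g" "\<phi> g x" v] by (simp_all add: T_one)

lemma inj_T: "inj (T g x)" and surj_T: "range (T g x) = UNIV"
  using T_inv[of g x] by (metis injI, metis surjI)

lemma direct_sum_T: "direct_sum V W Z \<Longrightarrow> direct_sum (T g x ` V) (T g x ` W) (T g x ` Z)"
  by (rule direct_sum_linear_image[OF _ linear_T inj_T])

lemma generator_eq: "gen \<xi> x = tangent_map AG AM (\<lambda>g. \<phi> g x) \<one> \<xi>"
  using has_velocity_imp_velocity[OF has_velocity_map[OF cov cov_M smooth_orbit_map[of x] has_velocity_lie_exp[of \<xi>]]]
  by (simp add: generator_def lie_exp_zero)

lemma linear_generator: "linear (\<lambda>\<xi>. gen \<xi> x)"
  unfolding generator_eq by (rule linear_tangent_map[OF cov cov_M smooth_orbit_map])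

lemma generator_curve:
  assumes "has_velocity AG \<alpha> \<xi> 0" "\<alpha> 0 = \<one>"
  shows "has_velocity AM (\<lambda>t. \<phi> (\<alpha> t) x) (gen \<xi> x) 0"
  using has_velocity_map[OF cov cov_M smooth_orbit_map[of x] assms(1)] assms(2) by (simp add: generator_eq)

text \<open>If the generator vanishes at \<open>x\<close>, the curve \<open>exp (t \<xi>) x\<close>
  has zero velocity at time 0. Near any other time it is the translate by
  \<open>exp (t \<xi>)\<close> of its piece near 0, so its velocity vanishes throughout and it stays
  at \<open>x\<close>. The isotropy algebra is thereby described by a linear condition.\<close>

lemma isotropy_algebra_iff: "\<xi> \<in> isot x \<longleftrightarrow> gen \<xi> x = 0"
proof
  let ?e = "\<lambda>t. lie_exp G AG (t *\<^sub>R \<xi>)"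
  have e: "has_velocity AM (\<lambda>t. \<phi> (?e t) x) (gen \<xi> x) 0"
    by (rule generator_curve[OF has_velocity_lie_exp]) (simp add: lie_exp_zero)
  show "gen \<xi> x = 0" if "\<xi> \<in> isot x"
  proof -
    have "\<phi> (?e t) x = x" for t
      using that by (simp add: isotropy_algebra_def lie_subalgebra_def stabilizer_def)
    then show ?thesis
      using has_velocity_unique[OF e] has_velocity_const[of AM x 0] by simp
  qed
  show "\<xi> \<in> isot x" if "gen \<xi> x = 0"
  proof -
    have "has_velocity AM (\<lambda>t. \<phi> (?e t) x) 0 t" for t
    proof -
      have "has_velocity AM (\<lambda>s. \<phi> (?e t) (\<phi> (?e s) x)) 0 0"
        using has_velocity_map[OF cov_M cov_M smooth_act e, of "?e t"] that linear_0[OF linear_T] by simp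
      then have "has_velocity AM (\<lambda>s. \<phi> (?e (t + s)) x) 0 0"
        by (simp only: lie_exp_add act_mult)
      then show ?thesis using has_velocity_shift[of AM "\<lambda>t. \<phi> (?e t) x" t 0] by simp
    qed
    then have "\<phi> (?e t) x = \<phi> (?e 0) x" for t
      using has_velocity_zero_const[OF atlas_M, of UNIV "\<lambda>t. \<phi> (?e t) x" t 0] by simp
    then show ?thesis
      by (simp add: isotropy_algebra_def lie_subalgebra_def stabilizer_def lie_exp_zero)
  qed
qed

section \<open>The adjoint action and translates of generators, isotropy algebras and tangent
  spaces\<close>

lemma smooth_conj: "smooth_map AG AG (\<lambda>h. g \<otimes> h \<otimes> inv g)"
  by (rule smooth_map_compose[OF finite_dim_lie cov cov cov smooth_left smooth_right])

lemma Ad_curve: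
  assumes "has_velocity AG \<alpha> \<xi> 0" "\<alpha> 0 = \<one>"
  shows "has_velocity AG (\<lambda>t. g \<otimes> \<alpha> t \<otimes> inv g) (Ad G AG g \<xi>) 0"
  using has_velocity_map[OF cov cov smooth_conj assms(1), of g] assms(2) by (simp add: Ad_def)

lemma Ad_mult: "Ad G AG (g \<otimes> h) \<xi> = Ad G AG g (Ad G AG h \<xi>)"
proof -
  obtain \<alpha> where \<alpha>: "\<alpha> 0 = \<one>" "has_velocity AG \<alpha> \<xi> 0" using has_velocity_exists[OF cov] .
  have "has_velocity AG (\<lambda>t. g \<otimes> (h \<otimes> \<alpha> t \<otimes> inv h) \<otimes> inv g) (Ad G AG g (Ad G AG h \<xi>)) 0"
    by (rule Ad_curve[OF Ad_curve[OF \<alpha>(2,1)]]) (simp add: \<alpha>(1))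
  moreover have "has_velocity AG (\<lambda>t. g \<otimes> h \<otimes> \<alpha> t \<otimes> inv (g \<otimes> h)) (Ad G AG (g \<otimes> h) \<xi>) 0"
    by (rule Ad_curve[OF \<alpha>(2,1)])
  ultimately show ?thesis
    using has_velocity_unique by (simp add: m_assoc inv_mult_group) blast
qed

lemma Ad_one: "Ad G AG \<one> \<xi> = \<xi>"
  using tangent_map_ident[OF cov, of \<one> \<xi>] by (simp add: Ad_def)

lemma Ad_inv: "Ad G AG g (Ad G AG (inv g) \<xi>) = \<xi>"
  using Ad_mult[of g "inv g" \<xi>] by (simp add: Ad_one)

text \<open>Both sides are velocities of one curve, by
  \<open>(g \<alpha>(t) g^(-1)) (g x) = g (\<alpha>(t) x)\<close>.\<close>

lemma generator_Ad: "gen (Ad G AG g \<xi>) (\<phi> g x) = T g x (gen \<xi> x)"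
proof -
  obtain \<alpha> where \<alpha>: "\<alpha> 0 = \<one>" "has_velocity AG \<alpha> \<xi> 0" using has_velocity_exists[OF cov] .
  have "has_velocity AM (\<lambda>t. \<phi> (g \<otimes> \<alpha> t \<otimes> inv g) (\<phi> g x)) (gen (Ad G AG g \<xi>) (\<phi> g x)) 0"
    by (rule generator_curve[OF Ad_curve[OF \<alpha>(2,1)]]) (simp add: \<alpha>(1))
  moreover have "has_velocity AM (\<lambda>t. \<phi> g (\<phi> (\<alpha> t) x)) (T g x (gen \<xi> x)) 0"
    using has_velocity_map[OF cov_M cov_M smooth_act generator_curve[OF \<alpha>(2,1)], of g x] \<alpha>(1) by simp
  ultimately show ?thesis
    using has_velocity_unique by (simp add: act_mult) blast
qed

lemma generators_Ad: "gens (Ad G AG g ` V) (\<phi> g x) = T g x ` gens V x"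
  by (simp add: generators_def image_image generator_Ad)

lemma generators_UNIV: "gens UNIV (\<phi> g x) = T g x ` gens UNIV x"
proof -
  have "Ad G AG g ` UNIV = UNIV" using Ad_inv by (metis surjI)
  then show ?thesis using generators_Ad[of g UNIV x] by simp
qed

text \<open>Isotropy algebras are kernels of generator maps, and the maps at \<open>x\<close> and
  \<open>\<phi> g x\<close> correspond under \<open>Ad\<close> and the injective
  \<open>T g x\<close>. No exponential has to be conjugated.\<close>

lemma isotropy_algebra_act: "isot (\<phi> g x) = Ad G AG g ` isot x"
proof -
  have *: "Ad G AG g \<xi> \<in> isot (\<phi> g x) \<longleftrightarrow> \<xi> \<in> isot x" for \<xi>
    using linear_injective_0[OF linear_T] inj_T linear_0[OF linear_T]
    by (auto simp: isotropy_algebra_iff generator_Ad)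
  show ?thesis
  proof (intro Set.set_eqI iffI)
    fix \<xi> assume "\<xi> \<in> isot (\<phi> g x)"
    then have "Ad G AG (inv g) \<xi> \<in> isot x" using *[of "Ad G AG (inv g) \<xi>"] by (simp add: Ad_inv)
    then show "\<xi> \<in> Ad G AG g ` isot x" using Ad_inv[of g \<xi>] by (metis imageI)
  qed (use * in auto)
qed

lemma tangent_space_act_subset: "T g x ` tangent_space AM S x \<subseteq> tangent_space AM (\<phi> g ` S) (\<phi> g x)"
proof clarify
  fix v assume "v \<in> tangent_space AM S x"
  then obtain \<gamma> where \<gamma>: "smooth_map real_atlas AM \<gamma>" "range \<gamma> \<subseteq> S" "\<gamma> 0 = x" "v = velocity AM \<gamma> 0"
    by (auto simp: tangent_space_def)
  have "velocity AM (\<lambda>t. \<phi> g (\<gamma> t)) 0 = T g x v"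
    using has_velocity_map[OF cov_M cov_M smooth_act smooth_curve_has_velocity[OF cov_M \<gamma>(1)], of g 0] \<gamma>(3,4)
    by (simp add: has_velocity_imp_velocity)
  moreover have "smooth_map real_atlas AM (\<lambda>t. \<phi> g (\<gamma> t))"
    by (rule smooth_map_compose[OF finite_dim_M covering_real_atlas cov_M cov_M \<gamma>(1) smooth_act])
  ultimately show "T g x v \<in> tangent_space AM (\<phi> g ` S) (\<phi> g x)"
    unfolding tangent_space_def using \<gamma>(2,3)
    by (intro CollectI exI[of _ "\<lambda>t. \<phi> g (\<gamma> t)"]) auto
qed

lemma tangent_space_act: "tangent_space AM (\<phi> g ` S) (\<phi> g x) = T g x ` tangent_space AM S x"
proof
  have "T (inv g) (\<phi> g x) ` tangent_space AM (\<phi> g ` S) (\<phi> g x) \<subseteq> tangent_space AM S x"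
    using tangent_space_act_subset[of "inv g" "\<phi> g x" "\<phi> g ` S"] by (simp add: image_image)
  then have "T g x ` T (inv g) (\<phi> g x) ` tangent_space AM (\<phi> g ` S) (\<phi> g x)
      \<subseteq> T g x ` tangent_space AM S x" by (rule image_mono)
  then show "tangent_space AM (\<phi> g ` S) (\<phi> g x) \<subseteq> T g x ` tangent_space AM S x"
    by (simp add: image_image T_inv)
qed (rule tangent_space_act_subset)

end

section \<open>Tangent spaces of submanifolds\<close>

text \<open>The two-parameter family is closed under differentiation, so the induction runs over
  \<open>p\<close> and \<open>q\<close>. For \<open>e = 0\<close> the quotient is 0 and the function
  constant. It serves to reparametrise lines within a bounded range.\<close>

lemma Ck_on_sin_cos: "Ck_on k UNIV (\<lambda>t. p * sin (t / e) + q * cos (t / e :: real))"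
proof (induction k arbitrary: p q)
  case 0
  then show ?case unfolding Ck_on.simps divide_inverse by (intro continuous_intros)
next
  case (Suc k)
  show ?case
  proof (rule Ck_on_SucI[where F="\<lambda>t v. (- (v * q) / e) * sin (t / e) + (v * p / e) * cos (t / e)"])
    show "((\<lambda>t. p * sin (t / e) + q * cos (t / e)) has_derivative
        (\<lambda>v. (- (v * q) / e) * sin (t / e) + (v * p / e) * cos (t / e))) (at t)" for t
    proof (cases "e = 0")
      case False
      then show ?thesis
        by (auto intro!: derivative_eq_intros simp: field_simps)
    qed simp
  qed (rule open_UNIV Suc)+
qed

text \<open>\<open>P\<close> is the orthogonal projection onto \<open>F\<close>. Membership in
  \<open>F\<close> becomes an equation that can be differentiated along a curve. A zero vector in
  \<open>C\<close> contributes nothing to the sum.\<close>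

lemma subspace_fixed_points:
  fixes F :: "'e::real_inner set"
  assumes "finite_dim TYPE('e)" "subspace F"
  obtains P :: "'e \<Rightarrow> 'e" where "bounded_linear P" "\<And>x. x \<in> F \<longleftrightarrow> P x = x"
proof -
  obtain B where B: "B \<subseteq> F" "independent B" "F \<subseteq> span B"
    using maximal_independent_subset[of F] by blast
  obtain C0 :: "'e set" where C0: "finite C0" "span C0 = UNIV" using assms(1) by (auto simp: finite_dim_def)
  have "finite B" using independent_span_bound[OF C0(1) B(2)] C0(2) by auto
  then obtain C where C: "finite C" "span C = span B" "pairwise orthogonal C"
    using basis_orthogonal by blast
  have FC: "F = span C" using B span_minimal[OF B(1) assms(2)] C(2) by auto
  define P where "P x = (\<Sum>d\<in>C. (x \<bullet> (d /\<^sub>R (d \<bullet> d))) *\<^sub>R d)" for x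
  have "bounded_linear P" unfolding P_def[abs_def]
    by (intro bounded_linear_sum bounded_linear_scaleR_const bounded_linear_inner_left)
  moreover have "x \<in> F \<longleftrightarrow> P x = x" for x
  proof
    assume "P x = x"
    moreover have "P x \<in> span C" unfolding P_def by (intro span_sum span_scale span_base)
    ultimately show "x \<in> F" using FC by simp
  next
    assume x: "x \<in> F"
    have lP: "linear P" using \<open>bounded_linear P\<close> bounded_linear.linear by blast
    have "P y = y" if "y \<in> C" for y
    proof (cases "y = 0")
      case False
      have "P y = (\<Sum>d\<in>C. if d = y then y else 0)" unfolding P_def
        by (rule sum.cong) (use C(3) that False in \<open>auto simp: pairwise_def orthogonal_def\<close>)
      then show ?thesis using C(1) that by simp
    qed (simp add: linear_0[OF lP])
    then show "P x = x"
      using linear_eq_on_span[OF lP linear_ident, of C x] x FC by simp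
  qed
  ultimately show ?thesis using that by blast
qed

text \<open>The coordinate change at \<open>x\<close> from \<open>c\<close> to the chart chosen
  there. It turns coordinate vectors of \<open>c\<close>, typically a slice chart outside the atlas,
  into tangent vectors.\<close>

definition from_chart ::
    "('m::topological_space, 'e::real_normed_vector) chart set \<Rightarrow> ('m, 'e) chart \<Rightarrow> 'm \<Rightarrow> 'e \<Rightarrow> 'e" where
  "from_chart A c x = frechet_derivative (snd (chart_at A x) \<circ> chart_inv c) (at (snd c x))"

lemma linear_from_chart:
  assumes "covering_charts A" "\<forall>d\<in>A. compatible c d" "x \<in> fst c"
  shows "linear (from_chart A c x)"
  using compatible_has_derivative[of c "chart_at A x" x] chart_at[OF assms(1), of x] assms has_derivative_linear
  unfolding from_chart_def by blast

lemma chart_line_has_velocity: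
  assumes "covering_charts A" "is_chart c" "\<forall>d\<in>A. compatible c d" "x \<in> fst c"
  shows "has_velocity A (\<lambda>s. chart_inv c (snd c x + s *\<^sub>R v)) (from_chart A c x v) 0"
  using has_velocity_chartI[OF assms(1-3) chart_line(2)[OF assms(2,4)] _ chart_line(3)[OF assms(2,4)], of v]
    chart_line(1)[OF assms(2,4), of v] assms(4)
  unfolding from_chart_def by simp

definition to_chart ::
    "('m::topological_space, 'e::real_normed_vector) chart set \<Rightarrow> ('m, 'e) chart \<Rightarrow> 'm \<Rightarrow> 'e \<Rightarrow> 'e" where
  "to_chart A c x = frechet_derivative (snd c \<circ> chart_inv (chart_at A x)) (at (snd (chart_at A x) x))"

lemma compatible_sym: "compatible c d \<longleftrightarrow> compatible d c"
  by (auto simp: compatible_def Int_commute)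

lemma linear_to_chart:
  assumes "covering_charts A" "\<forall>d\<in>A. compatible c d" "x \<in> fst c"
  shows "linear (to_chart A c x)"
  using compatible_has_derivative[of "chart_at A x" c x] chart_at[OF assms(1), of x] assms
    has_derivative_linear compatible_sym[of c]
  unfolding to_chart_def by blast

lemma has_velocity_in_chart:
  assumes "covering_charts A" "\<forall>d\<in>A. compatible c d" "\<gamma> t \<in> fst c" "has_velocity A \<gamma> v t"
  shows "((\<lambda>s. snd c (\<gamma> s)) has_vector_derivative to_chart A c (\<gamma> t) v) (at t)"
proof -
  note a = chart_at[OF assms(1), of "\<gamma> t"]
  have comp: "compatible (chart_at A (\<gamma> t)) c" using assms(2) a compatible_sym[of c] by blast
  show ?thesis unfolding to_chart_def
    by (rule vector_derivative_chart_change[where \<gamma>=\<gamma>])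
      (use assms(3,4) comp a in \<open>auto simp: has_velocity_def\<close>)
qed

lemma to_chart_from_chart:
  assumes "covering_charts A" "is_chart c" "\<forall>d\<in>A. compatible c d" "x \<in> fst c"
  shows "to_chart A c x (from_chart A c x v) = v"
proof -
  have 0: "chart_inv c (snd c x) = x" by (simp add: chart_inv_chart assms)
  have "((\<lambda>s. snd c (chart_inv c (snd c x + s *\<^sub>R v))) has_vector_derivative
      to_chart A c x (from_chart A c x v)) (at 0)"
    using has_velocity_in_chart[OF assms(1,3) _ chart_line_has_velocity[OF assms]] assms(4) by (simp add: 0)
  then show ?thesis using chart_line(3)[OF assms(2,4), of v] vector_derivative_at by metis
qed

lemma from_chart_to_chart:
  assumes "covering_charts A" "is_chart c" "\<forall>d\<in>A. compatible c d" "x \<in> fst c"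
  shows "from_chart A c x (to_chart A c x v) = v"
proof -
  obtain \<gamma> where \<gamma>: "\<gamma> 0 = x" "has_velocity A \<gamma> v 0" using has_velocity_exists[OF assms(1)] .
  have "has_velocity A \<gamma> (from_chart A c x (to_chart A c x v)) 0"
    using has_velocity_chartI[OF assms(1-3) _ _ has_velocity_in_chart[OF assms(1,3) _ \<gamma>(2)]] \<gamma> assms(4)
    by (simp add: has_velocity_def from_chart_def)
  then show ?thesis using has_velocity_unique[OF _ \<gamma>(2)] by blast
qed

text \<open>Curves in \<open>S\<close> run in \<open>F\<close> when read in the slice chart, so
  their derivatives lie in \<open>F\<close>. Conversely, \<open>tangent_space\<close> asks for a
  curve smooth on the whole line and inside \<open>S\<close>; a straight line would leave the chart,
  so it is traversed back and forth by a sine.\<close>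

lemma tangent_space_submanifold:
  fixes A :: "('m::topological_space, 'e::real_inner) chart set"
  assumes "finite_dim TYPE('e)" "covering_charts A" "is_chart c" "\<forall>d\<in>A. compatible c d"
    and "x \<in> fst c" "x \<in> S" "subspace F" and SF: "snd c ` (S \<inter> fst c) = snd c ` fst c \<inter> F"
  shows "tangent_space A S x = from_chart A c x ` F"
proof (intro Set.set_eqI iffI)
  fix v assume "v \<in> tangent_space A S x"
  then obtain \<gamma> where \<gamma>: "smooth_map real_atlas A \<gamma>" "range \<gamma> \<subseteq> S" "\<gamma> 0 = x" "v = velocity A \<gamma> 0"
    by (auto simp: tangent_space_def)
  define E where "E = to_chart A c x"
  have d: "((\<lambda>s. snd c (\<gamma> s)) has_vector_derivative E v) (at 0)"
    using has_velocity_in_chart[OF assms(2,4) _ smooth_curve_has_velocity[OF assms(2) \<gamma>(1)], of 0]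
      \<gamma>(3,4) assms(5) by (simp add: E_def)
  obtain P where P: "bounded_linear P" "\<And>x. x \<in> F \<longleftrightarrow> P x = x"
    using subspace_fixed_points[OF assms(1,7)] by blast
  have op: "open (\<gamma> -` fst c)"
    by (intro open_continuous_vimage smooth_map_continuous[OF \<gamma>(1)] chart_open assms(3))
  have "((\<lambda>s. snd c (\<gamma> s)) has_vector_derivative P (E v)) (at 0)"
  proof (rule has_vector_derivative_transform_within_open[OF bounded_linear.has_vector_derivative[OF P(1) d] op])
    show "P (snd c (\<gamma> s)) = snd c (\<gamma> s)" if "s \<in> \<gamma> -` fst c" for s
      using SF that \<gamma>(2) P(2) by blast
  qed (use \<gamma>(3) assms(5) in simp)
  then have "P (E v) = E v" using d vector_derivative_at by metis
  then have "E v \<in> F" using P(2) by simp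
  then show "v \<in> from_chart A c x ` F" 
    using from_chart_to_chart[OF assms(2-5), of v] unfolding E_def by (metis imageI)
next
  fix v assume "v \<in> from_chart A c x ` F"
  then obtain w where w: "w \<in> F" "v = from_chart A c x w" by auto
  let ?u = "snd c x" and ?V = "snd c ` fst c"
  have u: "?u \<in> ?V" "?u \<in> F" using SF assms(5,6) by auto
  have oV: "open ?V" using assms(3) by (simp add: is_chart_def)
  then obtain r where r: "r > 0" "ball ?u r \<subseteq> ?V" using u open_contains_ball by blast
  \<comment> \<open>The amplitude \<open>e\<close> keeps \<open>\<beta> t *\<^sub>R w\<close>
    shorter than \<open>r\<close>; the 1 in the denominator allows \<open>w = 0\<close>. The
    frequency \<open>1 / e\<close> in \<open>\<beta>\<close> restores unit speed at time 0.\<close>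
  define e where "e = r / (norm w + 1)"
  have "norm w + 1 > 0" using norm_ge_zero[of w] by linarith
  then have e: "e > 0" "e * norm w < r" using r(1) by (auto simp: e_def field_simps)
  define \<beta> where "\<beta> t = e * sin (t / e)" for t
  define z where "z t = ?u + \<beta> t *\<^sub>R w" for t
  have zV: "z t \<in> ?V" for t
  proof -
    have "norm (\<beta> t *\<^sub>R w) \<le> e * norm w"
      using e(1) mult_right_mono[OF abs_sin_le_one[of "t / e"], of "norm w"] by (simp add: \<beta>_def abs_mult)
    then show ?thesis using r(2) e(2) by (auto simp: z_def dist_norm intro!: subsetD[OF r(2)])
  qed
  have zF: "z t \<in> F" for t
    unfolding z_def using assms(7) u(2) w(1) by (intro subspace_add subspace_scale)
  have Ck\<beta>: "Ck_on k UNIV \<beta>" for k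
    using Ck_on_sin_cos[of k e e 0] by (simp add: \<beta>_def[abs_def])
  have Ckz: "Ck_on k UNIV z" for k
    unfolding z_def[abs_def] by (intro Ck_on_add Ck_on_const Ck_on_scaleR Ck\<beta> open_UNIV)
  define \<gamma> where "\<gamma> t = chart_inv c (z t)" for t
  have \<gamma>c: "\<gamma> t \<in> fst c" "snd c (\<gamma> t) = z t" for t
    using zV[of t] by (auto simp: \<gamma>_def chart_inv_in chart_chart_inv)
  have \<gamma>S: "\<gamma> t \<in> S" for t
  proof -
    have "z t \<in> snd c ` (S \<inter> fst c)" using zV zF SF by blast
    then obtain y where "y \<in> S" "y \<in> fst c" "z t = snd c y" by auto
    then show ?thesis by (simp add: \<gamma>_def chart_inv_chart assms(3))
  qed
  have \<gamma>0: "\<gamma> 0 = x" by (simp add: \<gamma>_def z_def \<beta>_def chart_inv_chart assms(3,5))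
  have cont: "continuous_on UNIV \<gamma>" unfolding \<gamma>_def
    by (rule continuous_on_compose2[OF chart_inv_continuous[OF assms(3)] Ck_on_continuous[OF Ckz]])
      (use zV in auto)
  have "Ck_on k (\<gamma> -` fst d) (\<lambda>t. snd d (\<gamma> t))" if d: "d \<in> A" for d k
  proof -
    have id: "is_chart d" using d assms(2) by (simp add: covering_charts_def)
    have "Ck_on k (\<gamma> -` fst d) ((snd d \<circ> chart_inv c) \<circ> z)"
    proof (rule Ck_on_compose[OF assms(1) _ open_chart_image[OF assms(3) chart_open[OF id]]])
      show "open (\<gamma> -` fst d)" by (intro open_continuous_vimage cont chart_open id)
      show "z ` (\<gamma> -` fst d) \<subseteq> snd c ` (fst c \<inter> fst d)" using \<gamma>c by (metis IntI image_eqI image_subsetI vimageD)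
      show "Ck_on k (\<gamma> -` fst d) z" by (rule Ck_on_mono_set[OF Ckz]) simp
      show "Ck_on k (snd c ` (fst c \<inter> fst d)) (snd d \<circ> chart_inv c)"
        using assms(4) d by (auto simp: compatible_def smooth_on_def)
    qed
    then show ?thesis by (simp add: o_def \<gamma>_def)
  qed
  then have smooth: "smooth_map real_atlas A \<gamma>" using cont by (simp add: smooth_curve_iff)
  have "(\<beta> has_real_derivative 1) (at 0)"
    unfolding \<beta>_def[abs_def] using e(1) by (auto intro!: derivative_eq_intros)
  then have "(z has_vector_derivative 1 *\<^sub>R w) (at 0)"
    unfolding z_def[abs_def] by (auto intro!: derivative_eq_intros)
  then have "((\<lambda>s. snd c (\<gamma> s)) has_vector_derivative w) (at 0)" by (simp add: \<gamma>c)
  moreover have "isCont \<gamma> 0" using cont by (simp add: continuous_on_eq_continuous_at)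
  ultimately have "has_velocity A \<gamma> v 0"
    using has_velocity_chartI[OF assms(2-4), of 0 \<gamma> w] \<gamma>c(1) \<gamma>0 w(2) assms(5) by (simp add: from_chart_def)
  then show "v \<in> tangent_space A S x"
    unfolding tangent_space_def using smooth \<gamma>S \<gamma>0 has_velocity_imp_velocity by blast
qed

text \<open>Over a finite-dimensional space the surjective endomorphism
  \<open>A0 \<tau> + w \<mapsto> A1 \<tau> + \<theta> w\<close> is injective.\<close>

lemma complement_transport:
  fixes A0 A1 :: "'f::real_vector \<Rightarrow> 'e::real_vector" and \<theta> :: "'e \<Rightarrow> 'e"
  assumes "finite_dim TYPE('e)" and lin: "linear A0" "linear A1" "linear \<theta>"
    and sub: "subspace t" "subspace W"
    and inj0: "\<And>\<tau>. \<tau> \<in> t \<Longrightarrow> A0 \<tau> = 0 \<Longrightarrow> \<tau> = 0" and dir0: "A0 ` t \<inter> W \<subseteq> {0}"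
    and span0: "\<And>v. \<exists>\<tau>\<in>t. \<exists>w\<in>W. v = A0 \<tau> + w"
    and span1: "\<And>v. \<exists>\<tau>\<in>t. \<exists>w\<in>\<theta> ` W. v = A1 \<tau> + w"
    and zero: "\<tau> \<in> t" "w \<in> \<theta> ` W" "A1 \<tau> + w = 0"
  shows "\<tau> = 0 \<and> w = 0"
proof -
  obtain p q where pq: "\<And>v. p v \<in> t" "\<And>v. q v \<in> W" "\<And>v. v = A0 (p v) + q v"
    using span0 by metis
  \<comment> \<open>The components \<open>p\<close> and \<open>q\<close> were chosen pointwise;
    uniqueness of the decomposition is what makes \<open>K\<close> linear.\<close>
  have uniq: "p (A0 \<tau> + w) = \<tau> \<and> q (A0 \<tau> + w) = w" if "\<tau> \<in> t" "w \<in> W" for \<tau> w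
  proof -
    let ?v = "A0 \<tau> + w"
    have eq: "A0 (p ?v - \<tau>) = w - q ?v"
      using pq(3)[of ?v] by (simp add: linear_diff[OF lin(1)] algebra_simps)
    have m: "p ?v - \<tau> \<in> t" "w - q ?v \<in> W" using sub pq that by (auto intro: subspace_diff)
    then have "A0 (p ?v - \<tau>) = 0" using eq dir0 by (metis IntI imageI singletonD subsetD)
    then show ?thesis using inj0[OF m(1)] eq by auto
  qed
  define K where "K v = A1 (p v) + \<theta> (q v)" for v
  have K: "K (A0 \<tau> + w) = A1 \<tau> + \<theta> w" if "\<tau> \<in> t" "w \<in> W" for \<tau> w
    using uniq[OF that] by (simp add: K_def)
  have "linear K"
  proof (rule linearI)
    fix x y
    have "x + y = A0 (p x + p y) + (q x + q y)"
      using pq(3)[of x] pq(3)[of y] by (simp add: linear_add[OF lin(1)] algebra_simps)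
    then have "K (x + y) = A1 (p x + p y) + \<theta> (q x + q y)"
      using K[of "p x + p y" "q x + q y"] sub pq by (auto intro: subspace_add)
    then show "K (x + y) = K x + K y"
      by (simp add: K_def linear_add[OF lin(2)] linear_add[OF lin(3)] algebra_simps)
  next
    fix r x
    have "r *\<^sub>R x = A0 (r *\<^sub>R p x) + r *\<^sub>R q x"
      using arg_cong[OF pq(3)[of x], of "\<lambda>v. r *\<^sub>R v"]
      by (simp only: linear_scale[OF lin(1)] scaleR_add_right)
    then have "K (r *\<^sub>R x) = A1 (r *\<^sub>R p x) + \<theta> (r *\<^sub>R q x)"
      using K[of "r *\<^sub>R p x" "r *\<^sub>R q x"] sub pq by (auto intro: subspace_scale)
    then show "K (r *\<^sub>R x) = r *\<^sub>R K x"
      by (simp add: K_def linear_scale[OF lin(2)] linear_scale[OF lin(3)] scaleR_add_right)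
  qed
  moreover have "surj K"
    unfolding surj_def
  proof
    fix v
    obtain \<tau> w where "\<tau> \<in> t" "w \<in> W" "v = A1 \<tau> + \<theta> w" using span1[of v] by blast
    then show "\<exists>x. v = K x" using K by metis
  qed
  ultimately have injK: "inj K"
  proof -
    obtain C0 :: "'e set" where C0: "finite C0" "span C0 = UNIV"
      using assms(1) by (auto simp: finite_dim_def)
    obtain B :: "'e set" where "B \<subseteq> UNIV" and indep: "independent B" and "UNIV \<subseteq> span B"
      by (rule maximal_independent_subset)
    then have B: "independent B" "span B = UNIV" by auto
    have "finite B" using independent_span_bound[OF C0(1) B(1)] C0(2) by auto
    then interpret fd: finite_dimensional_vector_space "scaleR :: real \<Rightarrow> 'e \<Rightarrow> 'e" B
      using B by unfold_locales (auto simp: dependent_raw_def span_raw_def)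
    show ?thesis using fd.linear_surj_imp_inj[of K] \<open>linear K\<close> \<open>surj K\<close> by (simp add: linear_def)
  qed
  obtain w0 where w0: "w0 \<in> W" "w = \<theta> w0" using zero(2) by auto
  have "K (A0 \<tau> + w0) = 0" using K[OF zero(1) w0(1)] zero(3) w0(2) by simp
  then have 0: "A0 \<tau> + w0 = 0" using injK linear_injective_0[OF \<open>linear K\<close>] by blast
  have "0 \<in> t" "0 \<in> W" using sub by (auto intro: subspace_0)
  then have "p (0::'e) = 0 \<and> q 0 = 0" using uniq[of 0 0] linear_0[OF lin(1)] by simp
  then have "\<tau> = 0" "w0 = 0" using uniq[OF zero(1) w0(1)] 0 by auto
  then show ?thesis using w0 linear_0[OF lin(3)] by simp
qed

section \<open>Slices\<close>

context smooth_action_setting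
begin

text \<open>The map \<open>\<Psi>\<close> below is the action in charts, precomposed with a linear right inverse
  \<open>v \<mapsto> (P v, Q v)\<close> of its differential at \<open>(\<one>, s)\<close>.\<close>

lemma transverse_saturation_interior:
  assumes "is_chart c" "\<forall>d\<in>AM. compatible c d" "s \<in> fst c" "s \<in> S" "subspace F"
    and SF: "snd c ` (S \<inter> fst c) = snd c ` fst c \<inter> F"
    and trans: "\<And>v. \<exists>\<xi>. \<exists>w\<in>tangent_space AM S s. v = gen \<xi> s + w"
  shows "s \<in> interior (\<Union>g. \<phi> g ` S)"
proof -
  let ?cG = "chart_at AG \<one>" and ?d = "chart_at AM s" and ?act = "\<lambda>(g, x). \<phi> g x"
  let ?e = "snd ?cG \<one>" and ?u = "snd c s"
  note cG = chart_at[OF cov, of \<one>] and d = chart_at[OF cov_M, of s]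
  obtain B :: "'e set" where B: "finite B" "\<And>x. (\<Sum>b\<in>B. (x \<bullet> b) *\<^sub>R b) = x"
    using finite_dim_frame[OF finite_dim_M] by blast
  \<comment> \<open>Preimages are chosen for the frame vectors only. Extending them linearly gives
    the right inverse \<open>v \<mapsto> (P v, Q v)\<close>, with \<open>Q v\<close> in the model
    subspace \<open>F\<close> of the slice.\<close>
  have "\<exists>\<xi> f. f \<in> F \<and> b = gen \<xi> s + from_chart AM c s f" for b
    using trans[of b] tangent_space_submanifold[OF finite_dim_M cov_M assms(1-6)] by auto
  then obtain \<xi> f where \<xi>f: "\<And>b. f b \<in> F" "\<And>b. b = gen (\<xi> b) s + from_chart AM c s (f b)"
    by metis
  define P where "P v = (\<Sum>b\<in>B. (v \<bullet> b) *\<^sub>R \<xi> b)" for v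
  define Q where "Q v = (\<Sum>b\<in>B. (v \<bullet> b) *\<^sub>R f b)" for v
  have bl: "bounded_linear P" "bounded_linear Q" unfolding P_def[abs_def] Q_def[abs_def]
    by (intro bounded_linear_sum bounded_linear_scaleR_const bounded_linear_inner_left)+
  note linPQ = bl[THEN bounded_linear.linear]
  have lin_c: "linear (from_chart AM c s)" by (rule linear_from_chart[OF cov_M assms(2,3)])
  have QF: "Q v \<in> F" for v unfolding Q_def using \<xi>f(1) assms(5)
    by (intro subspace_sum subspace_scale) auto
  have PQ: "gen (P v) s + from_chart AM c s (Q v) = v" for v
  proof -
    have "gen (P v) s + from_chart AM c s (Q v)
        = (\<Sum>b\<in>B. (v \<bullet> b) *\<^sub>R (gen (\<xi> b) s + from_chart AM c s (f b)))"
      by (simp add: P_def Q_def linear_sum[OF linear_generator] linear_scale[OF linear_generator]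
          linear_sum[OF lin_c] linear_scale[OF lin_c] sum.distrib scaleR_add_right)
    then show ?thesis using \<xi>f(2) B(2) by simp
  qed
  let ?VG = "snd ?cG ` fst ?cG" and ?V = "snd c ` (fst c \<inter> fst ?d)"
  have oVG: "open ?VG" using cG by (simp add: is_chart_def)
  have oV: "open ?V" by (intro open_chart_image assms(1) chart_open d)
  have eV: "?e \<in> ?VG" "?u \<in> ?V" using cG d assms(3) by auto
  have contP: "continuous_on UNIV (\<lambda>v. ?e + P v)" and contQ: "continuous_on UNIV (\<lambda>v. ?u + Q v)"
    using bl[THEN linear_continuous_on] by (auto intro: continuous_on_add)
  define N1 where "N1 = (\<lambda>v. ?e + P v) -` ?VG \<inter> (\<lambda>v. ?u + Q v) -` ?V"
  have oN1: "open N1" unfolding N1_def by (intro open_Int open_continuous_vimage contP contQ oVG oV)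
  define \<kappa> where "\<kappa> v = (chart_inv ?cG (?e + P v), chart_inv c (?u + Q v))" for v
  have cont\<kappa>: "continuous_on N1 \<kappa>" unfolding \<kappa>_def[abs_def]
    using continuous_on_subset[OF contP] continuous_on_subset[OF contQ]
    by (intro continuous_on_Pair continuous_on_compose2[OF chart_inv_continuous[OF cG(3)]]
        continuous_on_compose2[OF chart_inv_continuous[OF assms(1)]]) (auto simp: N1_def)
  \<comment> \<open>\<open>N\<close> restricts to arguments for which the group element, the slice
    point and the product point all lie in their charts.\<close>
  define N where "N = N1 \<inter> \<kappa> -` (?act -` fst ?d)"
  have oN: "open N" unfolding N_def
    by (intro continuous_open_preimage cont\<kappa> oN1 open_continuous_vimage
        smooth_map_continuous[OF smooth_action_map] chart_open d)
  have "P 0 = 0" "Q 0 = 0" using linPQ linear_0 by auto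
  then have \<kappa>0: "\<kappa> 0 = (\<one>, s)" by (simp add: \<kappa>_def chart_inv_chart cG assms(1,3))
  have N0: "0 \<in> N"
    using \<open>P 0 = 0\<close> \<open>Q 0 = 0\<close> eV d by (simp add: N_def N1_def \<kappa>0)
  let ?p = "prod_chart ?cG ?d"
  define \<Psi> where "\<Psi> v = snd ?d (?act (\<kappa> v))" for v
  have \<kappa>N: "fst (\<kappa> v) \<in> fst ?cG" "snd (\<kappa> v) \<in> fst c \<inter> fst ?d" "snd ?cG (fst (\<kappa> v)) = ?e + P v"
    "snd c (snd (\<kappa> v)) = ?u + Q v" if "v \<in> N" for v
  proof -
    have v: "?e + P v \<in> ?VG" "?u + Q v \<in> ?V" using that by (auto simp: N_def N1_def)
    then show "fst (\<kappa> v) \<in> fst ?cG" "snd ?cG (fst (\<kappa> v)) = ?e + P v"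
      by (auto simp: \<kappa>_def chart_chart_inv chart_inv_in)
    obtain x where "x \<in> fst c \<inter> fst ?d" "?u + Q v = snd c x" using v(2) by blast
    then show "snd (\<kappa> v) \<in> fst c \<inter> fst ?d" "snd c (snd (\<kappa> v)) = ?u + Q v"
      by (auto simp: \<kappa>_def chart_inv_chart[OF assms(1)])
  qed
  have Ck\<Psi>: "Ck_on k N \<Psi>" for k
  proof -
    \<comment> \<open>Smoothness of the action is given in charts of the atlas, so the second
      component is first moved from the slice chart \<open>c\<close> to \<open>?d\<close>.\<close>
    let ?z = "\<lambda>v. (?e + P v, (snd ?d \<circ> chart_inv c) (?u + Q v))"
    have CkQ: "Ck_on k N ((snd ?d \<circ> chart_inv c) \<circ> (\<lambda>v. ?u + Q v))"
    proof (rule Ck_on_compose[OF finite_dim_M oN oV])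
      show "Ck_on k N (\<lambda>v. ?u + Q v)" by (intro Ck_on_add Ck_on_const Ck_on_bounded_linear bl oN)
      show "Ck_on k ?V (snd ?d \<circ> chart_inv c)"
        using assms(2) d(1) by (auto simp: compatible_def smooth_on_def)
    qed (auto simp: N_def N1_def)
    have CkP: "Ck_on k N (\<lambda>v. ?e + P v)" by (intro Ck_on_add Ck_on_const Ck_on_bounded_linear bl oN)
    have zeq: "?z v = snd ?p (\<kappa> v)" if "v \<in> N" for v
      using \<kappa>N[OF that] by (cases "\<kappa> v") (auto simp: snd_prod_chart \<kappa>_def)
    let ?W = "snd ?p ` (fst ?p \<inter> ?act -` fst ?d)"
    have "Ck_on k N ((snd ?d \<circ> ?act \<circ> chart_inv ?p) \<circ> ?z)"
    proof (rule Ck_on_compose[OF finite_dim_prod[OF finite_dim_lie finite_dim_M] oN])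
      show "open ?W"
        by (intro open_chart_image is_chart_prod cG d open_continuous_vimage
            smooth_map_continuous[OF smooth_action_map] chart_open)
      show "Ck_on k ?W (snd ?d \<circ> ?act \<circ> chart_inv ?p)"
        by (rule smooth_map_Ck[OF smooth_action_map prod_chart_in_atlas[OF cG(1) d(1)] d(1)])
      show "Ck_on k N ?z"
        using CkQ by (intro Ck_on_Pair CkP oN) (simp add: o_def)
      show "?z ` N \<subseteq> ?W"
      proof (rule image_subsetI)
        fix v assume v: "v \<in> N"
        have "\<kappa> v \<in> fst ?p \<inter> ?act -` fst ?d"
          using \<kappa>N[OF v] v by (cases "\<kappa> v") (auto simp: fst_prod_chart N_def)
        then show "?z v \<in> ?W" unfolding zeq[OF v] by (rule imageI)
      qed
    qed
    then show ?thesis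
    proof (rule Ck_on_cong[OF oN, rotated])
      fix v assume v: "v \<in> N"
      have "chart_inv ?p (?z v) = \<kappa> v" unfolding zeq[OF v]
        by (rule chart_inv_chart[OF is_chart_prod[OF cG(3) d(3)]])
          (use \<kappa>N[OF v] in \<open>cases "\<kappa> v", auto simp: fst_prod_chart\<close>)
      then show "((snd ?d \<circ> ?act \<circ> chart_inv ?p) \<circ> ?z) v = \<Psi> v" by (simp add: \<Psi>_def)
    qed
  qed
  \<comment> \<open>Along the line \<open>t *\<^sub>R v\<close>, \<open>\<Psi>\<close> reads the
    curve \<open>\<phi> (\<alpha> t) (\<beta> t)\<close> in \<open>?d\<close>. Its velocity is the
    sum of the two partial contributions, which is \<open>v\<close> by the choice of
    \<open>P\<close> and \<open>Q\<close>.\<close>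
  have D\<Psi>: "frechet_derivative \<Psi> (at 0) v = v" for v
  proof -
    have "((\<lambda>t. t *\<^sub>R v) has_derivative (\<lambda>t. t *\<^sub>R v)) (at 0)" by (auto intro!: derivative_eq_intros)
    moreover have D: "(\<Psi> has_derivative frechet_derivative \<Psi> (at 0)) (at (0 *\<^sub>R v))"
      using Ck_on_has_derivative[OF Ck\<Psi> N0] by simp
    ultimately have "(\<Psi> \<circ> (\<lambda>t. t *\<^sub>R v) has_derivative frechet_derivative \<Psi> (at 0) \<circ> (\<lambda>t. t *\<^sub>R v)) (at 0)"
      by (rule diff_chain_at)
    then have "((\<lambda>t. \<Psi> (t *\<^sub>R v)) has_vector_derivative frechet_derivative \<Psi> (at 0) v) (at 0)"
      using linear_scale[OF has_derivative_linear[OF D]] by (simp add: has_vector_derivative_def o_def)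
    moreover
    let ?\<alpha> = "\<lambda>t. chart_inv ?cG (?e + t *\<^sub>R P v)" and ?\<beta> = "\<lambda>t. chart_inv c (?u + t *\<^sub>R Q v)"
    have \<alpha>0: "?\<alpha> 0 = \<one>" and \<beta>0: "?\<beta> 0 = s" by (simp_all add: chart_inv_chart cG assms(1,3))
    have \<alpha>: "has_velocity AG ?\<alpha> (P v) 0"
      using chart_line[OF cG(3,2), of "P v"] by (simp add: has_velocity_def chart_inv_chart cG)
    have \<beta>: "has_velocity AM ?\<beta> (from_chart AM c s (Q v)) 0"
      by (rule chart_line_has_velocity[OF cov_M assms(1-3)])
    have "has_velocity AM (\<lambda>t. \<phi> (?\<alpha> t) (?\<beta> t)) (gen (P v) s + from_chart AM c s (Q v)) 0"
      using has_velocity_map2[OF finite_dim_lie finite_dim_M cov cov_M cov_M smooth_action_map \<alpha> \<beta>]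
      by (simp add: \<alpha>0[simplified] \<beta>0[simplified] generator_eq tangent_map_ident[OF cov_M])
    then have "has_velocity AM (\<lambda>t. \<phi> (?\<alpha> t) (?\<beta> t)) v 0" by (simp add: PQ)
    then have "((\<lambda>t. \<Psi> (t *\<^sub>R v)) has_vector_derivative v) (at 0)"
      using linear_scale[OF linPQ(1)] linear_scale[OF linPQ(2)]
      by (simp add: has_velocity_def \<Psi>_def \<kappa>_def \<alpha>0[simplified] \<beta>0[simplified])
    ultimately show ?thesis using vector_derivative_at by metis
  qed
  have \<Psi>0: "\<Psi> 0 = snd ?d s" by (simp add: \<Psi>_def \<kappa>0)
  have int: "snd ?d s \<in> interior (\<Psi> ` N)"
    using locally_surjective[OF finite_dim_M oN N0 Ck\<Psi> D\<Psi>] by (simp add: \<Psi>0)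
  define R where "R = fst ?d \<inter> snd ?d -` interior (\<Psi> ` N)"
  have "open R" unfolding R_def
    by (rule continuous_open_preimage[OF chart_continuous[OF d(3)] chart_open[OF d(3)] open_interior])
  moreover have "s \<in> R" using int d by (simp add: R_def)
  moreover have "R \<subseteq> (\<Union>g. \<phi> g ` S)"
  proof
    fix x assume x: "x \<in> R"
    then obtain v where v: "v \<in> N" "snd ?d x = \<Psi> v" using interior_subset by (auto simp: R_def)
    have "?act (\<kappa> v) \<in> fst ?d" using v(1) by (simp add: N_def)
    then have "x = ?act (\<kappa> v)"
      using v(2) x chart_inv_chart[OF d(3)] by (metis \<Psi>_def R_def IntD1)
    \<comment> \<open>Both \<open>?u\<close> and \<open>Q v\<close> lie in \<open>F\<close>, so the
      slice chart places the second component in \<open>S\<close> itself.\<close>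
    moreover have "snd (\<kappa> v) \<in> S"
    proof -
      have "?u \<in> F" using SF assms(3,4) by blast
      then have "?u + Q v \<in> F" using QF assms(5) by (intro subspace_add)
      then have "snd c (snd (\<kappa> v)) \<in> snd c ` fst c \<inter> F" using \<kappa>N[OF v(1)] by (metis IntD1 IntI imageI)
      then obtain y where "y \<in> S" "y \<in> fst c" "snd c (snd (\<kappa> v)) = snd c y" using SF by auto
      then show ?thesis using \<kappa>N(2)[OF v(1)] chart_inv_chart[OF assms(1)] by (metis IntD1)
    qed
    ultimately show "x \<in> (\<Union>g. \<phi> g ` S)" by (cases "\<kappa> v") auto
  qed
  ultimately show ?thesis by (rule interiorI)
qed

lemma open_saturation:
  assumes "\<And>s. s \<in> S \<Longrightarrow> s \<in> interior (\<Union>g. \<phi> g ` S)"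
  shows "open (\<Union>g. \<phi> g ` S)"
proof -
  let ?U = "\<Union>g. \<phi> g ` S"
  have "\<exists>R. open R \<and> \<phi> g s \<in> R \<and> R \<subseteq> ?U" if s: "s \<in> S" for g s
  proof (intro exI conjI)
    let ?R = "\<phi> (inv g) -` interior ?U"
    show "open ?R" by (rule open_continuous_vimage[OF smooth_map_continuous[OF smooth_act] open_interior])
    show "\<phi> g s \<in> ?R" using assms[OF s] by simp
    show "?R \<subseteq> ?U"
    proof
      fix x assume "x \<in> ?R"
      then have "\<phi> (inv g) x \<in> ?U" using interior_subset by blast
      then obtain h y where y: "y \<in> S" "\<phi> (inv g) x = \<phi> h y" by auto
      then have "x = \<phi> (g \<otimes> h) y" using act_inv(2)[of g x] by (simp add: act_mult)
      then show "x \<in> ?U" using y(1) by blast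
    qed
  qed
  then show ?thesis by (subst open_subopen) blast
qed

lemma saturation_invariant: "\<phi> g ` (\<Union>g. \<phi> g ` S) = (\<Union>g. \<phi> g ` S)"
proof
  show "\<phi> g ` (\<Union>g. \<phi> g ` S) \<subseteq> (\<Union>g. \<phi> g ` S)"
    by (auto simp: act_mult[symmetric] intro!: exI[of _ "g \<otimes> _"] imageI)
  show "(\<Union>g. \<phi> g ` S) \<subseteq> \<phi> g ` (\<Union>g. \<phi> g ` S)"
  proof
    fix x assume "x \<in> (\<Union>g. \<phi> g ` S)"
    then obtain h s where "s \<in> S" "x = \<phi> h s" by auto
    then have "x = \<phi> g (\<phi> (inv g \<otimes> h) s)" by (simp add: act_mult)
    then show "x \<in> \<phi> g ` (\<Union>g. \<phi> g ` S)" using \<open>s \<in> S\<close> by blast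
  qed
qed

text \<open>Turns a family indexed by pairs \<open>(g, s)\<close> into one indexed by the point
  \<open>\<phi> g s\<close>. For stabilizer-compatible families all members of the union coincide,
  so no representative has to be chosen.\<close>

definition saturate :: "'m set \<Rightarrow> ('g \<Rightarrow> 'm \<Rightarrow> 'e set) \<Rightarrow> 'm \<Rightarrow> 'e set" where
  "saturate S D u = \<Union>{D g s | g s. s \<in> S \<and> \<phi> g s = u}"

lemma saturate_eq:
  assumes slice: "\<And>x g. x \<in> S \<Longrightarrow> \<phi> g x \<in> S \<Longrightarrow> \<phi> g x0 = x0"
    and inv: "\<And>g h s. \<phi> h x0 = x0 \<Longrightarrow> s \<in> S \<Longrightarrow> D (g \<otimes> h) s = D g (\<phi> h s)"
    and s: "s \<in> S"
  shows "saturate S D (\<phi> g s) = D g s"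
proof -
  have "D g' s' = D g s" if "s' \<in> S" "\<phi> g' s' = \<phi> g s" for g' s'
  proof -
    define h where "h = inv g \<otimes> g'"
    have h: "\<phi> h s' = s" "g' = g \<otimes> h"
      using that(2) by (simp_all add: h_def act_mult inv_mult_cancel)
    then have "\<phi> h x0 = x0" using slice[OF that(1), of h] s by simp
    then show ?thesis using inv[OF _ that(1), of h g] h by simp
  qed
  then have "{D g' s' | g' s'. s' \<in> S \<and> \<phi> g' s' = \<phi> g s} = {D g s}" using s by blast
  then show ?thesis by (simp add: saturate_def)
qed

lemma saturate_invariant_family:
  assumes "\<And>g s. s \<in> S \<Longrightarrow> saturate S D (\<phi> g s) = D g s"
    and "\<And>k g s. s \<in> S \<Longrightarrow> T k (\<phi> g s) ` D g s = D (k \<otimes> g) s"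
  shows "invariant_family AM \<phi> UNIV (\<Union>g. \<phi> g ` S) (saturate S D)"
  unfolding invariant_family_def
proof (intro ballI)
  fix k u assume "u \<in> (\<Union>g. \<phi> g ` S)"
  then obtain g s where u: "s \<in> S" "u = \<phi> g s" by auto
  show "T k u ` saturate S D u = saturate S D (\<phi> k u)"
    using assms[OF u(1)] u(2) by (simp add: act_mult[symmetric])
qed

end

lemma direct_sumD:
  assumes "direct_sum T V W"
  shows "subspace V" "subspace W" "V \<inter> W = {0}" "T = {v + w | v w. v \<in> V \<and> w \<in> W}"
    "V \<subseteq> T" "W \<subseteq> T"
proof -
  show d: "subspace V" "subspace W" "V \<inter> W = {0}" and T: "T = {v + w | v w. v \<in> V \<and> w \<in> W}"
    using assms by (auto simp: direct_sum_def)
  have z: "0 \<in> V" "0 \<in> W" using d by (auto intro: subspace_0)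
  show "V \<subseteq> T"
  proof
    fix v assume "v \<in> V"
    then have "v + 0 \<in> T" using z(2) unfolding T by blast
    then show "v \<in> T" by simp
  qed
  show "W \<subseteq> T"
  proof
    fix w assume "w \<in> W"
    then have "0 + w \<in> T" using z(1) unfolding T by blast
    then show "w \<in> T" by simp
  qed
qed

lemma direct_sumI:
  assumes "subspace V" "subspace W" "\<And>v. v \<in> V \<Longrightarrow> v \<in> W \<Longrightarrow> v = 0"
    and "\<And>v w. v \<in> V \<Longrightarrow> w \<in> W \<Longrightarrow> v + w \<in> T" "\<And>x. x \<in> T \<Longrightarrow> \<exists>v\<in>V. \<exists>w\<in>W. x = v + w"
  shows "direct_sum T V W"
  unfolding direct_sum_def using assms subspace_0[OF assms(1)] subspace_0[OF assms(2)] by blast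

lemma direct_sum_subspace:
  assumes "direct_sum T V W"
  shows "subspace T"
  using subspace_sums[OF direct_sumD(1,2)[OF assms]] direct_sumD(4)[OF assms] by metis

context smooth_action_setting
begin

lemma subspace_gens: "subspace V \<Longrightarrow> subspace (gens V x)"
  unfolding generators_def by (rule linear_subspace_image[OF linear_generator])

lemma genI: "\<xi> \<in> V \<Longrightarrow> gen \<xi> x \<in> gens V x"
  by (auto simp: generators_def)

lemma slice_interior:
  assumes "is_slice G AG AM \<phi> x0 S" "s \<in> S"
  shows "s \<in> interior (\<Union>g. \<phi> g ` S)"
proof -
  have sub: "submanifold AM S"
    and trans: "\<forall>x\<in>S. UNIV = {v + w | v w. v \<in> gens UNIV x \<and> w \<in> tangent_space AM S x}"
    using assms(1) by (simp_all add: is_slice_def)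
  obtain F c where c: "subspace F" "is_chart c" "\<forall>d\<in>AM. compatible c d" "s \<in> fst c"
    "snd c ` (S \<inter> fst c) = snd c ` fst c \<inter> F"
    using sub assms(2) unfolding submanifold_def by blast
  show ?thesis
  proof (rule transverse_saturation_interior[OF c(2,3,4) assms(2) c(1,5)])
    fix v
    have "v \<in> {v + w | v w. v \<in> gens UNIV s \<and> w \<in> tangent_space AM S s}" using trans assms(2) by blast
    then show "\<exists>\<xi>. \<exists>w\<in>tangent_space AM S s. v = gen \<xi> s + w" by (auto simp: generators_def)
  qed
qed

text \<open>Since all tangent spaces of the slice have the same dimension, transversality of
  \<open>(\<tt>)\<^sub>M\<close> to the slice at \<open>x0\<close> carries over to every other point.\<close>

lemma slice_complement:
  assumes slice: "is_slice G AG AM \<phi> x0 S" and split_g: "direct_sum UNIV (isot x0) \<tt>"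
    and tang: "gens (isot x0) s \<subseteq> tangent_space AM S s" and sub_s: "subspace (tangent_space AM S s)"
    and s: "s \<in> S" and "\<tau> \<in> \<tt>" "w \<in> tangent_space AM S s" "gen \<tau> s + w = 0"
  shows "\<tau> = 0 \<and> w = 0"
proof -
  have sub: "submanifold AM S" and x0: "x0 \<in> S"
    and split0: "direct_sum UNIV (gens UNIV x0) (tangent_space AM S x0)"
    and trans: "\<forall>x\<in>S. UNIV = {v + w | v w. v \<in> gens UNIV x \<and> w \<in> tangent_space AM S x}"
    using slice by (simp_all add: is_slice_def)
  have split: "\<exists>\<eta>\<in>isot x0. \<exists>\<tau>\<in>\<tt>. gen \<xi> x = gen \<eta> x + gen \<tau> x" for \<xi> x
  proof -
    have "\<xi> \<in> {v + w | v w. v \<in> isot x0 \<and> w \<in> \<tt>}" using direct_sumD(4)[OF split_g] by blast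
    then show ?thesis using linear_add[OF linear_generator] by blast
  qed
  obtain F where F: "subspace F" "\<And>x. x \<in> S \<Longrightarrow> \<exists>c. is_chart c \<and> (\<forall>d\<in>AM. compatible c d) \<and> x \<in> fst c \<and>
      snd c ` (S \<inter> fst c) = snd c ` fst c \<inter> F"
    using sub unfolding submanifold_def by blast
  obtain c0 where c0: "is_chart c0" "\<forall>d\<in>AM. compatible c0 d" "x0 \<in> fst c0"
    "snd c0 ` (S \<inter> fst c0) = snd c0 ` fst c0 \<inter> F"
    using F(2)[OF x0] by blast
  obtain c where c: "is_chart c" "\<forall>d\<in>AM. compatible c d" "s \<in> fst c"
    "snd c ` (S \<inter> fst c) = snd c ` fst c \<inter> F"
    using F(2)[OF s] by blast
  \<comment> \<open>Both tangent spaces are images of the same model subspace \<open>F\<close>;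
    passing through \<open>F\<close> gives a linear map taking \<open>T_x0 S\<close> onto
    \<open>T_s S\<close>.\<close>
  let ?\<theta> = "\<lambda>v. from_chart AM c s (to_chart AM c0 x0 v)"
  let ?T0 = "tangent_space AM S x0" and ?Ts = "tangent_space AM S s"
  have T0: "?T0 = from_chart AM c0 x0 ` F"
    by (rule tangent_space_submanifold[OF finite_dim_M cov_M c0(1-3) x0 F(1) c0(4)])
  have "?Ts = from_chart AM c s ` F"
    by (rule tangent_space_submanifold[OF finite_dim_M cov_M c(1-3) s F(1) c(4)])
  then have Ts: "?\<theta> ` ?T0 = ?Ts"
    by (simp add: T0 image_image to_chart_from_chart[OF cov_M c0(1-3)])
  have lin: "linear ?\<theta>"
    using linear_compose[OF linear_to_chart[OF cov_M c0(2,3)] linear_from_chart[OF cov_M c(2,3)]]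
    by (simp add: o_def)
  show ?thesis
  proof (rule complement_transport[OF finite_dim_M linear_generator linear_generator lin, of \<tt> ?T0 x0 s])
    show "\<tau> = 0" if "\<tau> \<in> \<tt>" "gen \<tau> x0 = 0" for \<tau>
      using that direct_sumD(3)[OF split_g] by (auto simp: isotropy_algebra_iff[symmetric])
    show "(\<lambda>\<xi>. gen \<xi> x0) ` \<tt> \<inter> ?T0 \<subseteq> {0}"
      using direct_sumD(3)[OF split0] by (auto simp: generators_def)
    show "\<exists>\<tau>\<in>\<tt>. \<exists>w\<in>?T0. v = gen \<tau> x0 + w" for v
    proof -
      have "v \<in> {v + w | v w. v \<in> gens UNIV x0 \<and> w \<in> ?T0}" using trans x0 by blast
      then obtain \<xi> w where w: "w \<in> ?T0" "v = gen \<xi> x0 + w" by (auto simp: generators_def)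
      obtain \<eta> \<tau> where "\<eta> \<in> isot x0" "\<tau> \<in> \<tt>" "gen \<xi> x0 = gen \<eta> x0 + gen \<tau> x0" using split by blast
      then show ?thesis using w by (auto simp: isotropy_algebra_iff)
    qed
    show "\<exists>\<tau>\<in>\<tt>. \<exists>w\<in>?\<theta> ` ?T0. v = gen \<tau> s + w" for v
    proof -
      have "v \<in> {v + w | v w. v \<in> gens UNIV s \<and> w \<in> ?Ts}" using trans s by blast
      then obtain \<xi> w where w: "w \<in> ?Ts" "v = gen \<xi> s + w" by (auto simp: generators_def)
      obtain \<eta> \<tau> where h: "\<eta> \<in> isot x0" "\<tau> \<in> \<tt>" "gen \<xi> s = gen \<eta> s + gen \<tau> s" using split by blast
      \<comment> \<open>The \<open>g_x0\<close>-component of the group direction is tangent to the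
        slice and joins \<open>w\<close>, so \<open>\<tt>\<close> and the tangent space of the slice
        already span.\<close>
      have "gen \<eta> s + w \<in> ?Ts" using w(1) tang genI[OF h(1)] sub_s by (blast intro: subspace_add)
      moreover have "v = gen \<tau> s + (gen \<eta> s + w)" using w(2) h(3) by simp
      ultimately show ?thesis unfolding Ts using h(2) by blast
    qed
    show "w \<in> ?\<theta> ` ?T0" unfolding Ts by fact
  qed (use direct_sumD(2)[OF split_g] direct_sumD(2)[OF split0] assms in auto)
qed

end

theorem theorem8:
  fixes G :: "'g::t2_space monoid"
    and AG :: "('g, 'f::{real_inner, banach}) chart set"
    and AM :: "('m::t2_space, 'e::{real_inner, banach}) chart set"
    and \<phi> :: "'g \<Rightarrow> 'm \<Rightarrow> 'm"
    and x0 :: 'm and S U :: "'m set"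
    and \<tt> :: "'f set" and H :: "'m \<Rightarrow> 'e set"
  assumes action: "smooth_action G AG AM \<phi>"
    and slice: "is_slice G AG AM \<phi> x0 S"
    and split_g: "direct_sum UNIV (isotropy_algebra G AG \<phi> x0) \<tt>"
    and inv_t: "\<forall>h\<in>stabilizer G \<phi> x0. Ad G AG h ` \<tt> = \<tt>"
    and split_S: "\<forall>s\<in>S. direct_sum (tangent_space AM S s)
                    (generators G AG AM \<phi> (isotropy_algebra G AG \<phi> x0) s) (H s)"
    and inv_H: "invariant_family AM \<phi> (stabilizer G \<phi> x0) S H"
    and U: "U = (\<Union>g\<in>carrier G. \<phi> g ` S)"
  shows "open U \<and> (\<forall>g\<in>carrier G. \<phi> g ` U = U) \<and>
    (\<exists>D1 D2 D3 :: 'm \<Rightarrow> 'e set.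
       \<comment> \<open>the three distributions, independently of how a point is written as \<open>g \<cdot> s\<close>\<close>
       (\<forall>g\<in>carrier G. \<forall>s\<in>S.
          D1 (\<phi> g s) = tangent_map AM AM (\<phi> g) s ` H s \<and>
          D2 (\<phi> g s) = generators G AG AM \<phi> (Ad G AG g ` \<tt>) (\<phi> g s) \<and>
          D3 (\<phi> g s) = generators G AG AM \<phi> (isotropy_algebra G AG \<phi> (\<phi> g x0)) (\<phi> g s)) \<and>
       \<comment> \<open>the splitting of the tangent space and of its subspace of group directions\<close>
       (\<forall>u\<in>U. direct_sum UNIV (D1 u) (generators G AG AM \<phi> UNIV u) \<and>
          direct_sum (generators G AG AM \<phi> UNIV u) (D2 u) (D3 u)) \<and>
       \<comment> \<open>invariance\<close>
       invariant_family AM \<phi> (carrier G) U D1 \<and>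
       invariant_family AM \<phi> (carrier G) U D2 \<and>
       invariant_family AM \<phi> (carrier G) U D3 \<and>
       \<comment> \<open>\<open>D2\<close> is transverse, \<open>D3\<close> tangent to the translated slice\<close>
       (\<forall>g\<in>carrier G. \<forall>s\<in>S.
          direct_sum UNIV (D2 (\<phi> g s)) (tangent_space AM (\<phi> g ` S) (\<phi> g s)) \<and>
          D3 (\<phi> g s) \<subseteq> tangent_space AM (\<phi> g ` S) (\<phi> g s)))"
proof -
  interpret smooth_action_setting G AG AM \<phi> by unfold_locales (fact action)
  have U': "U = (\<Union>g. \<phi> g ` S)" using U by simp
  have slice_stab: "\<phi> g x0 = x0" if "x \<in> S" "\<phi> g x \<in> S" for x g
    using slice that by (auto simp: is_slice_def stabilizer_def)

  \<comment> \<open>The three families on pairs \<open>(g, s)\<close> and their descent to points of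
    \<open>U\<close>\<close>
  define E1 where "E1 g s = T g s ` H s" for g s
  define E2 where "E2 g s = gens (Ad G AG g ` \<tt>) (\<phi> g s)" for g s
  define E3 where "E3 g s = gens (isot (\<phi> g x0)) (\<phi> g s)" for g s
  have E2: "E2 g s = T g s ` gens \<tt> s" for g s by (simp add: E2_def generators_Ad)
  have E3: "E3 g s = T g s ` gens (isot x0) s" for g s
    by (simp add: E3_def isotropy_algebra_act generators_Ad)
  have E_stab: "E1 (g \<otimes>\<^bsub>G\<^esub> h) s = E1 g (\<phi> h s)" "E2 (g \<otimes>\<^bsub>G\<^esub> h) s = E2 g (\<phi> h s)"
    "E3 (g \<otimes>\<^bsub>G\<^esub> h) s = E3 g (\<phi> h s)" if h: "\<phi> h x0 = x0" and s: "s \<in> S" for g h s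
  proof -
    have stab: "h \<in> stabilizer G \<phi> x0" using h by (simp add: stabilizer_def)
    have "H (\<phi> h s) = T h s ` H s" using inv_H stab s by (simp add: invariant_family_def)
    then show "E1 (g \<otimes>\<^bsub>G\<^esub> h) s = E1 g (\<phi> h s)" by (simp add: E1_def T_mult image_image)
    have "Ad G AG (g \<otimes>\<^bsub>G\<^esub> h) ` \<tt> = Ad G AG g ` Ad G AG h ` \<tt>" by (simp add: image_image Ad_mult)
    then show "E2 (g \<otimes>\<^bsub>G\<^esub> h) s = E2 g (\<phi> h s)" using inv_t stab by (simp add: E2_def act_mult)
    show "E3 (g \<otimes>\<^bsub>G\<^esub> h) s = E3 g (\<phi> h s)" using h by (simp add: E3_def act_mult)
  qed
  have Dg: "saturate S E1 (\<phi> g s) = E1 g s" "saturate S E2 (\<phi> g s) = E2 g s"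
    "saturate S E3 (\<phi> g s) = E3 g s" if "s \<in> S" for g s
    by (rule saturate_eq[of S x0]; rule slice_stab E_stab that; assumption)+

  \<comment> \<open>Splitting at points of the slice\<close>
  have sub_t: "subspace \<tt>" and sub_i: "subspace (isot x0)" using direct_sumD[OF split_g] by auto
  note sp = direct_sumD[OF bspec[OF split_S]]
  have splits: "direct_sum UNIV (H s) (gens UNIV s)" "direct_sum (gens UNIV s) (gens \<tt> s) (gens (isot x0) s)"
    "direct_sum UNIV (gens \<tt> s) (tangent_space AM S s)" if s: "s \<in> S" for s
  proof -
    let ?Ts = "tangent_space AM S s"
    have sub_s: "subspace ?Ts" by (rule direct_sum_subspace[OF bspec[OF split_S s]])
    have compl: "\<tau> = 0 \<and> w = 0" if "\<tau> \<in> \<tt>" "w \<in> ?Ts" "gen \<tau> s + w = 0" for \<tau> w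
      by (rule slice_complement[OF slice split_g sp(5)[OF s] sub_s s that])
    have compl': "gen \<tau> s = 0" if "\<tau> \<in> \<tt>" "gen \<tau> s \<in> ?Ts" for \<tau>
      using compl[OF that(1), of "- gen \<tau> s"] subspace_neg[OF sub_s that(2)]
      by (simp add: linear_0[OF linear_generator])
    have split: "\<exists>\<tau>\<in>\<tt>. \<exists>\<eta>\<in>isot x0. gen \<xi> s = gen \<tau> s + gen \<eta> s" for \<xi>
    proof -
      have "\<xi> \<in> {v + w | v w. v \<in> isot x0 \<and> w \<in> \<tt>}" using direct_sumD(4)[OF split_g] by blast
      then obtain \<eta> \<tau> where "\<xi> = \<eta> + \<tau>" "\<eta> \<in> isot x0" "\<tau> \<in> \<tt>" by blast
      then show ?thesis
        using linear_add[OF linear_generator, of \<eta> \<tau> s] by (intro bexI[of _ \<tau>] bexI[of _ \<eta>]) auto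
    qed
    have trans: "\<exists>\<xi>. \<exists>w\<in>?Ts. v = gen \<xi> s + w" for v
    proof -
      have "UNIV = {v + w | v w. v \<in> gens UNIV s \<and> w \<in> ?Ts}" using slice s by (simp add: is_slice_def)
      then have "v \<in> {v + w | v w. v \<in> gens UNIV s \<and> w \<in> ?Ts}" by blast
      then show ?thesis by (auto simp: generators_def)
    qed
    \<comment> \<open>For \<open>v\<close> in the intersection, \<open>v\<close> and its
      \<open>g_x0\<close>-component are tangent to the slice, hence so is its
      \<open>\<tt>\<close>-component, which must vanish; then (ii) applies. For spanning, (ii)
      splits the slice component of a vector, and the part in \<open>(g_x0)_M(s)\<close> is moved to
      the group directions.\<close>
    show "direct_sum UNIV (H s) (gens UNIV s)"
    proof (rule direct_sumI)
      fix v assume v: "v \<in> H s" "v \<in> gens UNIV s"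
      then obtain \<xi> where "v = gen \<xi> s" by (auto simp: generators_def)
      then obtain \<tau> \<eta> where h: "\<tau> \<in> \<tt>" "\<eta> \<in> isot x0" "v = gen \<tau> s + gen \<eta> s" using split by metis
      have m: "v \<in> ?Ts" "gen \<eta> s \<in> ?Ts" using sp(5,6)[OF s] v(1) genI[OF h(2)] by auto
      have "gen \<tau> s = v - gen \<eta> s" using h(3) by simp
      then have "gen \<tau> s \<in> ?Ts" using subspace_diff[OF sub_s m] by simp
      then have "v = gen \<eta> s" using compl'[OF h(1)] h(3) by simp
      then show "v = 0" using v(1) genI[OF h(2), of s] sp(3)[OF s] by blast
    next
      fix v
      obtain \<xi> w where w: "w \<in> ?Ts" "v = gen \<xi> s + w" using trans by blast
      then obtain a b where ab: "a \<in> gens (isot x0) s" "b \<in> H s" "w = a + b" using sp(4)[OF s] by blast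
      have "gen \<xi> s + a \<in> gens UNIV s"
        using ab(1) linear_add[OF linear_generator, of \<xi> _ s] unfolding generators_def
        by (auto simp flip: linear_add[OF linear_generator])
      then show "\<exists>v'\<in>H s. \<exists>w\<in>gens UNIV s. v = v' + w"
        using ab w by (intro bexI[of _ b] bexI[of _ "gen \<xi> s + a"]) (auto simp: algebra_simps)
    qed (use sp(2)[OF s] subspace_gens[OF subspace_UNIV] in auto)
    show "direct_sum (gens UNIV s) (gens \<tt> s) (gens (isot x0) s)"
    proof (rule direct_sumI)
      fix v assume v: "v \<in> gens \<tt> s" "v \<in> gens (isot x0) s"
      then show "v = 0" using compl' sp(5)[OF s] by (auto simp: generators_def)
    next
      fix v w assume "v \<in> gens \<tt> s" "w \<in> gens (isot x0) s"
      then show "v + w \<in> gens UNIV s"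
        unfolding generators_def by (auto simp flip: linear_add[OF linear_generator])
    next
      fix v assume "v \<in> gens UNIV s"
      then obtain \<xi> where "v = gen \<xi> s" by (auto simp: generators_def)
      then show "\<exists>a\<in>gens \<tt> s. \<exists>b\<in>gens (isot x0) s. v = a + b"
        using split[of \<xi>] genI by metis
    qed (use subspace_gens sub_t sub_i in auto)
    show "direct_sum UNIV (gens \<tt> s) ?Ts"
    proof (rule direct_sumI)
      fix v assume "v \<in> gens \<tt> s" "v \<in> ?Ts"
      then show "v = 0" using compl' by (auto simp: generators_def)
    next
      fix v
      obtain \<xi> w where w: "w \<in> ?Ts" "v = gen \<xi> s + w" using trans by blast
      obtain \<tau> \<eta> where h: "\<tau> \<in> \<tt>" "\<eta> \<in> isot x0" "gen \<xi> s = gen \<tau> s + gen \<eta> s" using split by blast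
      have "gen \<eta> s + w \<in> ?Ts" using sp(5)[OF s] genI[OF h(2)] w(1) sub_s by (blast intro: subspace_add)
      then show "\<exists>a\<in>gens \<tt> s. \<exists>b\<in>?Ts. v = a + b"
        using h w genI[OF h(1)] by (intro bexI[of _ "gen \<tau> s"] bexI[of _ "gen \<eta> s + w"]) (auto simp: algebra_simps)
    qed (use subspace_gens[OF sub_t] sub_s in auto)
  qed

  \<comment> \<open>Translation from \<open>s\<close> to \<open>g s\<close>\<close>
  have inv1: "T k (\<phi> g s) ` E1 g s = E1 (k \<otimes>\<^bsub>G\<^esub> g) s" for k g s
    by (simp add: E1_def image_image T_mult)
  have inv2: "T k (\<phi> g s) ` E2 g s = E2 (k \<otimes>\<^bsub>G\<^esub> g) s"
    and inv3: "T k (\<phi> g s) ` E3 g s = E3 (k \<otimes>\<^bsub>G\<^esub> g) s" for k g s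
    by (simp_all add: E2 E3 image_image T_mult)
  have sum_u: "direct_sum UNIV (E1 g s) (gens UNIV (\<phi> g s))"
    "direct_sum (gens UNIV (\<phi> g s)) (E2 g s) (E3 g s)"
    "direct_sum UNIV (E2 g s) (tangent_space AM (\<phi> g ` S) (\<phi> g s))"
    "E3 g s \<subseteq> tangent_space AM (\<phi> g ` S) (\<phi> g s)" if s: "s \<in> S" for g s
    using splits(1,2,3)[OF s, THEN direct_sum_T, of g s] sp(5)[OF s]
    by (auto simp: E1_def E2 E3 generators_UNIV tangent_space_act surj_T)
  show ?thesis
  proof (rule conjI[OF _ conjI[OF _ exI[where x="saturate S E1", OF exI[where x="saturate S E2",
          OF exI[where x="saturate S E3"]]]]], goal_cases)
    case 1
    show "open U" unfolding U' by (rule open_saturation[OF slice_interior[OF slice]])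
  next
    case 2
    show "\<forall>g\<in>carrier G. \<phi> g ` U = U" unfolding U' by (intro ballI saturation_invariant)
  next
    case 3
    have "invariant_family AM \<phi> (carrier G) U (saturate S E1)"
      "invariant_family AM \<phi> (carrier G) U (saturate S E2)"
      "invariant_family AM \<phi> (carrier G) U (saturate S E3)"
      unfolding U' carrier_UNIV
      by (rule saturate_invariant_family[OF Dg(1) inv1] saturate_invariant_family[OF Dg(2) inv2]
          saturate_invariant_family[OF Dg(3) inv3]; assumption)+
    moreover have "\<forall>g\<in>carrier G. \<forall>s\<in>S.
          saturate S E1 (\<phi> g s) = T g s ` H s \<and>
          saturate S E2 (\<phi> g s) = gens (Ad G AG g ` \<tt>) (\<phi> g s) \<and>
          saturate S E3 (\<phi> g s) = gens (isot (\<phi> g x0)) (\<phi> g s)"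
      by (simp add: Dg E1_def E2_def E3_def)
    moreover have "\<forall>u\<in>U. direct_sum UNIV (saturate S E1 u) (gens UNIV u) \<and>
          direct_sum (gens UNIV u) (saturate S E2 u) (saturate S E3 u)"
      unfolding U' by (auto simp: Dg sum_u)
    moreover have "\<forall>g\<in>carrier G. \<forall>s\<in>S.
          direct_sum UNIV (saturate S E2 (\<phi> g s)) (tangent_space AM (\<phi> g ` S) (\<phi> g s)) \<and>
          saturate S E3 (\<phi> g s) \<subseteq> tangent_space AM (\<phi> g ` S) (\<phi> g s)"
      using sum_u by (simp add: Dg)
    ultimately show ?case by (intro conjI)
  qed
qed

end
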